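(* Let $\kappa=\rho/\mu$ be a positive rational number with $\rho,\mu\in\mathbb{N}$ and $\gcd(\rho,\mu)=1$. On $\mathbb{T}^n_t\times\mathbb{T}^1_x$ consider the system $L_j=D_{t_j}+P_j(D_x)$, $j=1,\dots,n$, where $P_j(D_x)$ has symbol $p_j(\xi)=c_j|\xi|^\kappa$ for $\xi\in\mathbb{Z}\setminus\{0\}$, with $c_j\in\mathbb{C}$. Write $c_j=\alpha_j+i\beta_j$ with $\alpha_j,\beta_j\in\mathbb{R}$, and $\alpha=(\alpha_1,\dots,\alpha_n)$, $\beta=(\beta_1,\dots,\beta_n)$. For each $p=0,1,\dots,n-1$, the operator $\mathbb{L}^p$ associated with this system is globally solvable if and only if $\alpha\in\mathbb{R}^n$ is either rational (i.e. $\alpha\in\mathbb{Q}^n$) or does not satisfy the condition $(SDA)_\mu$, whenever $\beta=0$ (that is: if and only if $\beta\ne0$, or $\alpha\in\mathbb{Q}^n$, or $\alpha\in\mathbb{R}^n\setminus\mathbb{Q}^n$ does not satisfy $(SDA)_\mu$).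
   Context: Coordinates on $\mathbb{T}^{n+1}\simeq\mathbb{R}^{n+1}/2\pi\mathbb{Z}^{n+1}$ are $(t,x)=(t_1,\dots,t_n,x)$, $D_{t_j}=i^{-1}\partial_{t_j}$, and $d_t$ is the exterior derivative in $t$. Operators: $P_j(D_x)u(x)=\sum_{\xi\in\mathbb{Z}}e^{ix\xi}p_j(\xi)\widehat u(\xi)$, with $\widehat u(\xi)=(2\pi)^{-1}\int_{\mathbb{T}^1}e^{-ix\xi}u(x)\,dx$. Forms: $C^\infty(\mathbb{T}^{n+1};\wedge^{p,0})$ (resp. $\mathcal{D}'(\mathbb{T}^{n+1};\wedge^{p,0})$) is the space of $u=\sum_{|K|=p}u_K(t,x)\,dt_K$, where $K=(k_1<\dots<k_p)$, $1\le k_1$, $k_p\le n$, $dt_K=dt_{k_1}\wedge\dots\wedge dt_{k_p}$, with $u_K\in C^\infty(\mathbb{T}^{n+1})$ (resp. $u_K\in\mathcal{D}'(\mathbb{T}^{n+1})$). The operator $\mathbb{L}^p:\mathcal{D}'(\mathbb{T}^{n+1};\wedge^{p,0})\to\mathcal{D}'(\mathbb{T}^{n+1};\wedge^{p+1,0})$ is $$\mathbb{L}^pu=\sum_{j=1}^n\sum_{|K|=p}(iL_ju_K)\,dt_j\wedge dt_K=d_tu+\sum_{j=1}^n\sum_{|K|=p}iP_j(D_x)u_K\,dt_j\wedge dt_K,$$ and $\mathbb{L}^n$ is the zero map. Partial Fourier coefficients: $f=\sum_{\xi\in\mathbb{Z}}\widehat f(t,\xi)e^{i\xi x}$, coefficientwise.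 Integral forms: for $\xi\in\mathbb{Z}$ set $c_{\xi0}=\sum_{j=1}^np_j(\xi)\,dt_j$. It is integral if it is real and $\frac1{2\pi}\int_\sigma c_{\xi0}\in\mathbb{Z}$ for every 1-cycle $\sigma$ in $\mathbb{T}^n$. In that case let $\psi_\xi\in C^\infty(\mathbb{R}^n;\mathbb{R})$ satisfy $d\psi_\xi=\Pi^*(c_{\xi0})$, $\Pi:\mathbb{R}^n\to\mathbb{T}^n$ the universal covering; then $e^{i\psi_\xi}$ is well defined on $\mathbb{T}^n$. Compatibility set: $\mathbb{E}^p$ is the set of $f\in C^\infty(\mathbb{T}^{n+1};\wedge^{p+1,0})$ such that $\mathbb{L}^{p+1}f=0$ and, for every $\xi$ with $c_{\xi0}$ integral, $\widehat f(t,\xi)e^{i\psi_\xi(t)}$ is an exact $(p+1)$-form on $\mathbb{T}^n$. Global solvability: $\mathbb{L}^p$ is globally solvable if for each $f\in\mathbb{E}^p$ there exists $u\in\mathcal{D}'(\mathbb{T}^{n+1};\wedge^{p,0})$ with $\mathbb{L}^pu=f$. Condition $(SDA)_\mu$: for $\mu\in\mathbb{N}$, a vector $\alpha=(\alpha_1,\dots,\alpha_n)\in\mathbb{R}^n\setminus\mathbb{Q}^n$ satisfies $(SDA)_\mu$ if there exist a positive constant $C$ and a sequence $(p_\ell,q_\ell)=(p_{1\ell},\dots,p_{n\ell},q_\ell)\in\mathbb{Z}^n\times\mathbb{N}$ such that $$\max_{j=1,\dots,n}\left|\alpha_j^\mu-\frac{(p_{j\ell})^\mu}{q_\ell}\right|<C\,q_\ell^{-\ell},\qquad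 \ell\in\mathbb{N}.$$
   Formalization: In condition (SDA)_μ the denominators are required to satisfy q_ℓ ≥ 2 and the approximation to be inexact (0 < max_j |α_j^μ − p_{jℓ}^μ/q_ℓ|); as printed, every irrational α satisfies it (q_ℓ = 1, C large) and the equivalence is false. *)

theory Defs
  imports "HOL-Analysis.Analysis" "HOL-Algebra.Free_Abelian_Groups"
begin

section \<open>Smooth functions and distributions on a torus\<close>

text \<open>
  Functions on a torus are functions on the covering Euclidean space \<open>'a\<close> that are \<open>2\<pi>\<close>-periodic in
  every coordinate. The \<open>n\<close>-torus is covered by \<open>real^'n\<close> with \<open>n = CARD('n)\<close>, and the
  \<open>(n+1)\<close>-torus with coordinates \<open>(t,x)\<close> by \<open>(real^'n) \<times> real\<close>.
  The linear order on \<open>'n\<close> is the order of the coordinates \<open>t\<^sub>1,\<dots>,t\<^sub>n\<close>.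
\<close>

definition pderiv_dir :: "'a::euclidean_space \<Rightarrow> ('a \<Rightarrow> 'b::real_normed_vector) \<Rightarrow> 'a \<Rightarrow> 'b" where
  "pderiv_dir b f x = frechet_derivative f (at x) b"

definition pderivs :: "'a::euclidean_space list \<Rightarrow> ('a \<Rightarrow> 'b::real_normed_vector) \<Rightarrow> 'a \<Rightarrow> 'b" where
  "pderivs bs f = foldr pderiv_dir bs f"

definition smooth :: "('a::euclidean_space \<Rightarrow> 'b::real_normed_vector) \<Rightarrow> bool" where
  "smooth f \<longleftrightarrow> (\<forall>bs. set bs \<subseteq> Basis \<longrightarrow> pderivs bs f differentiable_on UNIV)"

definition torus_smooth :: "('a::euclidean_space \<Rightarrow> complex) set" where
  "torus_smooth = {f. smooth f \<and> (\<forall>b\<in>Basis. \<forall>x. f (x + (2 * pi) *\<^sub>R b) = f x)}"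

definition Ck_norm :: "nat \<Rightarrow> ('a::euclidean_space \<Rightarrow> complex) \<Rightarrow> real" where
  "Ck_norm k f = (\<Sum>bs | set bs \<subseteq> Basis \<and> length bs \<le> k. SUP x. norm (pderivs bs f x))"

text \<open>
  A distribution is a linear form on \<open>torus_smooth\<close>, continuous in the sense of the usual seminorm
  estimate. It is represented by a total function whose values off \<open>torus_smooth\<close> are irrelevant;
  distributions are only ever compared on \<open>torus_smooth\<close>.
\<close>

type_synonym 'a functional = "('a \<Rightarrow> complex) \<Rightarrow> complex"

definition torus_distribution :: "'a::euclidean_space functional \<Rightarrow> bool" where
  "torus_distribution u \<longleftrightarrow>
     (\<forall>f\<in>torus_smooth. \<forall>g\<in>torus_smooth. u (\<lambda>x. f x + g x) = u f + u g) \<and>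
     (\<forall>f\<in>torus_smooth. \<forall>a. u (\<lambda>x. a * f x) = a * u f) \<and>
     (\<exists>C k. \<forall>f\<in>torus_smooth. norm (u f) \<le> C * Ck_norm k f)"

definition distr_of :: "('a::euclidean_space \<Rightarrow> complex) \<Rightarrow> 'a functional" where
  "distr_of f \<phi> = integral (cbox 0 ((2 * pi) *\<^sub>R One)) (\<lambda>x. f x * \<phi> x)"

definition distr_deriv :: "'a::euclidean_space \<Rightarrow> 'a functional \<Rightarrow> 'a functional" where
  "distr_deriv b u \<phi> = - u (pderiv_dir b \<phi>)"


section \<open>Fourier multipliers in the variable \<open>x\<close>\<close>

definition fourier_coeff :: "((real^'n) \<times> real \<Rightarrow> complex) \<Rightarrow> int \<Rightarrow> real^'n \<Rightarrow> complex" where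
  "fourier_coeff f \<xi> t = 
     1 / (2 * complex_of_real pi) * integral {0..2*pi} (\<lambda>x::real. exp (- \<i> * of_real x * of_int \<xi>) * f (t, x))"

definition distr_fourier_coeff :: "((real^'n) \<times> real) functional \<Rightarrow> int \<Rightarrow> (real^'n) functional" where
  "distr_fourier_coeff u \<xi> \<psi> = 1 / (2 * complex_of_real pi) * u (\<lambda>(t, x::real). exp (- \<i> * of_real x * of_int \<xi>) * \<psi> t)"

text \<open>The tensor product of a distribution \<open>v\<close> in \<open>t\<close> with the function \<open>e\<^sup>i\<^sup>x\<^sup>\<xi>\<close>.\<close>

definition tensor_exp :: "(real^'n) functional \<Rightarrow> int \<Rightarrow> ((real^'n) \<times> real) functional" where
  "tensor_exp v \<xi> \<phi> = v (\<lambda>t. integral {0..2*pi} (\<lambda>x::real. exp (\<i> * of_real x * of_int \<xi>) * \<phi> (t, x)))"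

text \<open>\<open>P(D\<^sub>x)u = \<Sum>\<^sub>\<xi> e\<^sup>i\<^sup>x\<^sup>\<xi> s(\<xi>) c(t,\<xi>)\<close> with \<open>c(\<cdot>,\<xi>)\<close> the partial Fourier coefficients of \<open>u\<close>; the series converges absolutely on test functions when
  the symbol \<open>s\<close> has polynomial growth.\<close>

definition multiplier :: "(int \<Rightarrow> complex) \<Rightarrow> ((real^'n) \<times> real) functional \<Rightarrow> ((real^'n) \<times> real) functional" where
  "multiplier s u \<phi> = (\<Sum>\<^sub>\<infinity>\<xi>\<in>UNIV. s \<xi> * tensor_exp (distr_fourier_coeff u \<xi>) \<xi> \<phi>)"

definition L_op :: "('n::finite \<Rightarrow> int \<Rightarrow> complex) \<Rightarrow> 'n \<Rightarrow>
    ((real^'n) \<times> real) functional \<Rightarrow> ((real^'n) \<times> real) functional" where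
  "L_op s j u \<phi> = 1 / \<i> * distr_deriv (axis j 1, 0) u \<phi> + multiplier (s j) u \<phi>"


section \<open>Forms\<close>

text \<open>
  A \<open>p\<close>-form \<open>\<Sum>\<^sub>K u\<^sub>K dt\<^sub>K\<close> is the family of its coefficients, an increasing multi-index \<open>K\<close> being
  identified with the set of its entries; coefficients with \<open>card K \<noteq> p\<close> are zero.
\<close>

definition smooth_forms :: "nat \<Rightarrow> ('n::finite set \<Rightarrow> 'a::euclidean_space \<Rightarrow> complex) set" where
  "smooth_forms p = {u. \<forall>K. if card K = p then u K \<in> torus_smooth else u K = (\<lambda>_. 0)}"

definition distr_forms :: "nat \<Rightarrow> ('n::finite set \<Rightarrow> 'a::euclidean_space functional) set" where
  "distr_forms p = {u. \<forall>K. if card K = p then torus_distribution (u K) else u K = (\<lambda>_. 0)}"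

text \<open>The coefficient of \<open>dt\<^sub>J\<close> in \<open>dt\<^sub>j \<and> dt\<^sub>K\<close>.\<close>

definition wedge_coeff :: "'n::{finite,linorder} \<Rightarrow> 'n set \<Rightarrow> 'n set \<Rightarrow> complex" where
  "wedge_coeff j K J = (if j \<notin> K \<and> J = insert j K then (- 1) ^ card {k\<in>K. k < j} else 0)"

definition d_t :: "nat \<Rightarrow> ('n::{finite,linorder} set \<Rightarrow> (real,'n) vec \<Rightarrow> complex) \<Rightarrow>
    ('n set \<Rightarrow> (real,'n) vec \<Rightarrow> complex)" where
  "d_t p v J t = (\<Sum>j\<in>UNIV. \<Sum>K | card K = p. wedge_coeff j K J * pderiv_dir (axis j 1) (v K) t)"

text \<open>Exactness of a \<open>(p+1)\<close>-form on the \<open>n\<close>-torus.\<close>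

definition exact_Suc :: "nat \<Rightarrow> ('n::{finite,linorder} set \<Rightarrow> (real,'n) vec \<Rightarrow> complex) \<Rightarrow> bool" where
  "exact_Suc p g \<longleftrightarrow> (\<exists>v\<in>smooth_forms p. d_t p v = g)"

text \<open>For \<open>p = n\<close> every \<open>wedge_coeff\<close> below vanishes, so the operator is the zero map.\<close>

definition LL :: "('n::{finite,linorder} \<Rightarrow> int \<Rightarrow> complex) \<Rightarrow> nat \<Rightarrow>
    ('n set \<Rightarrow> ((real,'n) vec \<times> real) functional) \<Rightarrow> ('n set \<Rightarrow> ((real,'n) vec \<times> real) functional)" where
  "LL s p u J \<phi> = (\<Sum>j\<in>UNIV. \<Sum>K | card K = p. wedge_coeff j K J * (\<i> * L_op s j (u K) \<phi>))"

definition eq_distr_form :: "('n set \<Rightarrow> 'a::euclidean_space functional) \<Rightarrow>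
    ('n set \<Rightarrow> 'a functional) \<Rightarrow> bool" where
  "eq_distr_form u v \<longleftrightarrow> (\<forall>J. \<forall>\<phi>\<in>torus_smooth. u J \<phi> = v J \<phi>)"


section \<open>Integral 1-forms\<close>

definition c_form :: "('n::finite \<Rightarrow> int \<Rightarrow> complex) \<Rightarrow> int \<Rightarrow> 'n set \<Rightarrow> real^'n \<Rightarrow> complex" where
  "c_form s \<xi> K t = (\<Sum>j\<in>UNIV. if K = {j} then s j \<xi> else 0)"

definition torus_point :: "real^'n \<Rightarrow> (real^'n) set" where
  "torus_point y = {z. \<forall>j. \<exists>k::int. z $ j = y $ j + 2 * pi * of_int k}"

text \<open>
  A piecewise smooth 1-simplex of the \<open>n\<close>-torus is given by a lift, i.e. a path in \<open>real^'n\<close>. A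
  1-chain is an integer combination of such paths; it is a cycle if its boundary vanishes in the
  free abelian group on the points of the torus.
\<close>

definition torus_1cycle :: "((real \<Rightarrow> real^'n) \<Rightarrow>\<^sub>0 int) \<Rightarrow> bool" where
  "torus_1cycle \<sigma> \<longleftrightarrow>
     (\<forall>\<gamma>\<in>Poly_Mapping.keys \<sigma>. \<gamma> piecewise_C1_differentiable_on {0..1}) \<and>
     frag_extend (\<lambda>\<gamma>. frag_of (torus_point (\<gamma> 1)) - frag_of (torus_point (\<gamma> 0))) \<sigma> = 0"

definition path_integral :: "('n::finite set \<Rightarrow> real^'n \<Rightarrow> complex) \<Rightarrow> (real \<Rightarrow> real^'n) \<Rightarrow> complex" where
  "path_integral \<omega> \<gamma> =
     integral {0..1} (\<lambda>\<tau>. \<Sum>j\<in>UNIV. \<omega> {j} (\<gamma> \<tau>) * of_real (vector_derivative \<gamma> (at \<tau>) $ j))"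

definition chain_integral :: "('n::finite set \<Rightarrow> real^'n \<Rightarrow> complex) \<Rightarrow>
    ((real \<Rightarrow> real^'n) \<Rightarrow>\<^sub>0 int) \<Rightarrow> complex" where
  "chain_integral \<omega> \<sigma> =
     (\<Sum>\<gamma>\<in>Poly_Mapping.keys \<sigma>. of_int (Poly_Mapping.lookup \<sigma> \<gamma>) * path_integral \<omega> \<gamma>)"

definition integral_form :: "('n::finite set \<Rightarrow> real^'n \<Rightarrow> complex) \<Rightarrow> bool" where
  "integral_form \<omega> \<longleftrightarrow>
     (\<forall>j t. \<omega> {j} t \<in> \<real>) \<and>
     (\<forall>\<sigma>. torus_1cycle \<sigma> \<longrightarrow> 1 / (2 * complex_of_real pi) * chain_integral \<omega> \<sigma> \<in> \<int>)"

text \<open>\<open>\<psi>\<close> is a smooth real primitive on \<open>real^'n\<close> of the pull-back of \<open>\<omega>\<close>.\<close>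

definition primitive :: "('n::finite set \<Rightarrow> real^'n \<Rightarrow> complex) \<Rightarrow> (real^'n \<Rightarrow> real) \<Rightarrow> bool" where
  "primitive \<omega> \<psi> \<longleftrightarrow>
     smooth \<psi> \<and> (\<forall>j t. of_real (pderiv_dir (axis j 1) \<psi> t) = \<omega> {j} t)"


section \<open>Global solvability\<close>

text \<open>The primitive \<open>\<psi>\<close> is unique up to an additive constant, which does not affect exactness.\<close>

definition EE :: "('n::{finite,linorder} \<Rightarrow> int \<Rightarrow> complex) \<Rightarrow> nat \<Rightarrow>
    ('n set \<Rightarrow> (real,'n) vec \<times> real \<Rightarrow> complex) set" where
  "EE s p = {f \<in> smooth_forms (p + 1).
     eq_distr_form (LL s (p + 1) (\<lambda>K. distr_of (f K))) (\<lambda>_ _. 0) \<and>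
     (\<forall>\<xi> \<psi>. integral_form (c_form s \<xi>) \<and> primitive (c_form s \<xi>) \<psi> \<longrightarrow>
        exact_Suc p (\<lambda>K t. fourier_coeff (f K) \<xi> t * exp (\<i> * of_real (\<psi> t))))}"

definition globally_solvable :: "('n::{finite,linorder} \<Rightarrow> int \<Rightarrow> complex) \<Rightarrow> nat \<Rightarrow> bool" where
  "globally_solvable s p \<longleftrightarrow>
     (\<forall>f\<in>EE s p. \<exists>u\<in>distr_forms p. eq_distr_form (LL s p u) (\<lambda>K. distr_of (f K)))"


section \<open>The condition \<open>(SDA)\<^sub>\<mu>\<close>\<close>

definition rational_vec :: "real^'n \<Rightarrow> bool" where
  "rational_vec \<alpha> \<longleftrightarrow> (\<forall>j. \<alpha> $ j \<in> \<rat>)"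

text \<open>
  As in the definition of Liouville numbers, the denominators are at least \<open>2\<close> and the approximation
  is not exact. With \<open>q l = 1\<close> allowed, every vector would satisfy the estimate (large \<open>C\<close>). With
  exact approximations allowed, so would, for \<open>\<mu> \<ge> 2\<close>, every vector with \<open>\<alpha>\<^sub>j\<^sup>\<mu> = P\<^sub>j\<^sup>\<mu> / Q\<close> for all
  \<open>j\<close>, such as \<open>1 / sqrt 2\<close> for \<open>\<mu> = 2\<close>. For \<open>\<mu> = 1\<close> inexactness is automatic when \<open>\<alpha>\<close> is not
  rational.
\<close>

definition SDA :: "nat \<Rightarrow> real^'n::finite \<Rightarrow> bool" where
  "SDA \<mu> \<alpha> \<longleftrightarrow> \<not> rational_vec \<alpha> \<and>
     (\<exists>C>0. \<exists>(P :: nat \<Rightarrow> int^'n) (q :: nat \<Rightarrow> nat). \<forall>l. q l \<ge> 2 \<and>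
        (let e = (MAX j\<in>UNIV. \<bar>(\<alpha> $ j) ^ \<mu> - of_int (P l $ j) ^ \<mu> / of_nat (q l)\<bar>)
         in 0 < e \<and> e < C / real (q l) ^ l))"

end

theory Submission
  imports Defs
begin

text \<open>
  On the Fourier mode \<open>m = (\<tau>, \<xi>)\<close> the operator is exterior multiplication by \<open>i w(m)\<close>, where
  \<open>w\<^sub>j(m) = \<tau>\<^sub>j + s\<^sub>j(\<xi>)\<close>. If \<open>w(m) \<noteq> 0\<close>, its kernel is inverted by contraction with the coordinate
  vector of the largest \<open>w\<^sub>j(m)\<close>, at the cost of a factor \<open>1 / |w(m)|\<close>. If \<open>w(m) = 0\<close>, then \<open>\<xi>\<close> is
  resonant and the exactness condition makes the mode of \<open>f\<close> vanish. Hence solvability holds if and only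
  if the nonzero values \<open>|w(m)|\<close> are bounded below by a negative power of \<open>1 + |m|\<close>; if they are
  not, weighting the forms \<open>w(m) \<and> dt\<^sub>K\<close> by \<open>|w(m)|\<^sup>-\<^sup>1\<^sup>/\<^sup>2\<close> along a sequence of small divisors gives
  a datum without distribution solution. For \<open>s\<^sub>j(\<xi>) = c\<^sub>j |\<xi>|\<^sup>\<kappa>\<close> and real \<open>c\<^sub>j = \<alpha>\<^sub>j\<close>, comparing
  \<open>|\<alpha>\<^sub>j |\<xi>|\<^sup>\<kappa> + \<tau>\<^sub>j|\<close> with the difference of the \<open>\<mu>\<close>-th powers turns small divisors into
  approximations of \<open>\<alpha>\<^sub>j\<^sup>\<mu>\<close> by \<open>(-\<tau>\<^sub>j)\<^sup>\<mu> / |\<xi>|\<^sup>\<rho>\<close>.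
\<close>

section \<open>Periodic functions and their integrals\<close>

text \<open>Two facts keep general distributions out of the analysis. Inverting the symbol costs
  only a polynomial factor per mode, so a solution for a smooth \<open>f\<close> again has rapidly
  decreasing coefficients and all series converge absolutely. Conversely, a hypothetical
  distribution solution is tested on characters only, where homogeneity and the seminorm estimate
  suffice. The pairing \<open>distr_of\<close> contains no conjugation, so pairing with
  \<open>chr m\<close> sees the mode \<open>- m\<close>; hence the reflected frequencies throughout.
  On the arithmetical side, \<open>|\<xi>|^\<kappa>\<close> is in general irrational, but its
  \<open>\<mu>\<close>-th power \<open>|\<xi>|^\<rho>\<close> is an integer; this is why
  \<open>\<mu>\<close>-th powers are compared. Two mismatches shape that part. Frequencies only give
  denominators that are \<open>\<rho>\<close>-th powers, whereas \<open>SDA\<close> allows any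
  \<open>q\<close>; coprimality of \<open>\<rho>\<close> and \<open>\<mu>\<close> repairs this. And
  for even \<open>\<mu>\<close> a \<open>\<mu>\<close>-th power forgets the sign of its base, so
  signs have to be controlled separately.\<close>

abbreviation tbox :: "'a::euclidean_space set" where
  "tbox \<equiv> cbox 0 ((2 * pi) *\<^sub>R One)"

definition periodic :: "('a::euclidean_space \<Rightarrow> 'b) \<Rightarrow> bool" where
  "periodic f \<longleftrightarrow> (\<forall>b\<in>Basis. \<forall>x. f (x + (2 * pi) *\<^sub>R b) = f x)"

definition lattice :: "'a::euclidean_space set" where
  "lattice = {m. \<forall>b\<in>Basis. m \<bullet> b \<in> \<int>}"

definition chr :: "'a::euclidean_space \<Rightarrow> 'a \<Rightarrow> complex" where
  "chr m x = exp (\<i> * of_real (m \<bullet> x))"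

lemma periodic_int_multiple:
  assumes "periodic f" "b \<in> Basis"
  shows "f (x + (2 * pi * of_int k) *\<^sub>R b) = f x"
proof (induction k rule: int_induct[where k = 0])
  case base
  show ?case by simp
next
  case (step1 i)
  have "f (x + (2 * pi * of_int (i + 1)) *\<^sub>R b) = f ((x + (2 * pi * of_int i) *\<^sub>R b) + (2 * pi) *\<^sub>R b)"
    by (simp add: algebra_simps)
  with step1 assms show ?case unfolding periodic_def by simp
next
  case (step2 i)
  have "f (x + (2 * pi * of_int i) *\<^sub>R b) = f ((x + (2 * pi * of_int (i - 1)) *\<^sub>R b) + (2 * pi) *\<^sub>R b)"
    by (simp add: algebra_simps)
  with step2 assms show ?case unfolding periodic_def by simp
qed

lemma periodic_sum_shift:
  assumes "periodic f" "finite B" "B \<subseteq> Basis"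
  shows "f (x + (\<Sum>b\<in>B. (2 * pi * of_int (k b)) *\<^sub>R b)) = f x"
  using assms(2,3)
proof (induction B arbitrary: x rule: finite_induct)
  case (insert b B)
  have "f (x + (\<Sum>b\<in>insert b B. (2 * pi * of_int (k b)) *\<^sub>R b))
      = f ((x + (2 * pi * of_int (k b)) *\<^sub>R b) + (\<Sum>b\<in>B. (2 * pi * of_int (k b)) *\<^sub>R b))"
    using insert by (simp add: algebra_simps)
  also have "\<dots> = f x"
    using insert periodic_int_multiple[OF assms(1), of b x "k b"] by simp
  finally show ?case .
qed simp

text \<open>Reduction modulo the period keeps the fractional part of each coordinate. The point
  \<open>y\<close> is chosen before \<open>f\<close>, so it serves all periodic functions at
  once.\<close>

lemma periodic_representative:
  fixes x :: "'a::euclidean_space"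
  shows "\<exists>y\<in>tbox. \<forall>f :: 'a \<Rightarrow> 'b. periodic f \<longrightarrow> f x = f y"
proof -
  define k where "k b = - \<lfloor>x \<bullet> b / (2 * pi)\<rfloor>" for b
  define y where "y = x + (\<Sum>b\<in>Basis. (2 * pi * of_int (k b)) *\<^sub>R b)"
  have "0 \<le> y \<bullet> b \<and> y \<bullet> b \<le> 2 * pi" if "b \<in> Basis" for b
  proof -
    have "y \<bullet> b = x \<bullet> b + 2 * pi * of_int (k b)"
      using that by (simp add: y_def inner_add_left inner_sum_left_Basis)
    also have "\<dots> = 2 * pi * frac (x \<bullet> b / (2 * pi))"
      by (simp add: k_def frac_def field_simps)
    finally show ?thesis
      using frac_ge_0[of "x \<bullet> b / (2 * pi)"] frac_lt_1[of "x \<bullet> b / (2 * pi)"]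
      by simp
  qed
  then have "y \<in> tbox" by (simp add: mem_box)
  moreover have "f x = f y" if "periodic f" for f :: "'a \<Rightarrow> 'b"
    unfolding y_def using periodic_sum_shift[OF that, of Basis x k] by simp
  ultimately show ?thesis by blast
qed

lemma periodic_bounded:
  fixes f :: "'a::euclidean_space \<Rightarrow> 'b::real_normed_vector"
  assumes "periodic f" "continuous_on UNIV f"
  shows "bounded (range f)"
proof -
  have "range f \<subseteq> f ` tbox"
  proof safe
    fix x
    show "f x \<in> f ` tbox"
      using periodic_representative[of x, where ?'b = 'b] assms by blast
  qed
  moreover have "bounded (f ` tbox)"
    using assms by (intro compact_imp_bounded compact_continuous_image) (auto intro: continuous_on_subset)
  ultimately show ?thesis by (rule bounded_subset[rotated])
qed

text \<open>The box lengthened by \<open>h\<close> in direction \<open>b\<close> is cut once at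
  \<open>h\<close> and once at \<open>2 * pi\<close>. The two short pieces differ by a translation
  by one period, so the two long pieces have equal integrals.\<close>

lemma integral_tbox_translate:
  fixes f :: "'a::euclidean_space \<Rightarrow> 'b::euclidean_space"
  assumes per: "periodic f" and cont: "continuous_on UNIV f" and b: "b \<in> Basis"
    and h: "0 \<le> h" "h \<le> 2 * pi"
  shows "integral tbox (\<lambda>x. f (x + h *\<^sub>R b)) = integral tbox f"
proof -
  let ?O = "(2 * pi) *\<^sub>R (One :: 'a)"
  have int: "f integrable_on cbox u v" for u v
    using cont by (intro integrable_continuous) (auto intro: continuous_on_subset)
  define P where "P = cbox (0 :: 'a) (?O + (h - 2 * pi) *\<^sub>R b)"
  define B where "B = cbox (0 :: 'a) (?O + h *\<^sub>R b)"
  have mem: "x \<in> cbox (c *\<^sub>R b) (?O + d *\<^sub>R b) \<longleftrightarrow>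
      c \<le> x \<bullet> b \<and> x \<bullet> b \<le> 2 * pi + d \<and> (\<forall>k\<in>Basis - {b}. 0 \<le> x \<bullet> k \<and> x \<bullet> k \<le> 2 * pi)" for x c d
  proof -
    have Basis: "Basis = insert b (Basis - {b})" using b by blast
    have "x \<in> cbox (c *\<^sub>R b) (?O + d *\<^sub>R b) \<longleftrightarrow>
      (\<forall>k\<in>insert b (Basis - {b}). (c *\<^sub>R b) \<bullet> k \<le> x \<bullet> k \<and> x \<bullet> k \<le> (?O + d *\<^sub>R b) \<bullet> k)"
      using Basis by (simp add: mem_box)
    also have "\<dots> \<longleftrightarrow> ((c *\<^sub>R b) \<bullet> b \<le> x \<bullet> b \<and> x \<bullet> b \<le> (?O + d *\<^sub>R b) \<bullet> b) \<and>
      (\<forall>k\<in>Basis - {b}. (c *\<^sub>R b) \<bullet> k \<le> x \<bullet> k \<and> x \<bullet> k \<le> (?O + d *\<^sub>R b) \<bullet> k)"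
      by blast
    also have "\<dots> \<longleftrightarrow> c \<le> x \<bullet> b \<and> x \<bullet> b \<le> 2 * pi + d \<and>
      (\<forall>k\<in>Basis - {b}. 0 \<le> x \<bullet> k \<and> x \<bullet> k \<le> 2 * pi)"
      using b by (auto simp: inner_add_left inner_Basis)
    finally show ?thesis .
  qed
  note mem0 = mem[of _ 0, unfolded scale_zero_left]
  note mem00 = mem0[of _ 0, unfolded scale_zero_left add_0_right]
  have 1: "B \<inter> {x. x \<bullet> b \<le> h} = P" and 3: "B \<inter> {x. x \<bullet> b \<le> 2 * pi} = tbox"
    and 2: "B \<inter> {x. x \<bullet> b \<ge> h} = cbox (h *\<^sub>R b) (?O + h *\<^sub>R b)"
    and 4: "B \<inter> {x. x \<bullet> b \<ge> 2 * pi} = cbox ((2 * pi) *\<^sub>R b) (?O + h *\<^sub>R b)"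
    unfolding B_def P_def using h by (auto simp: mem mem0 mem00)
  have "integral B f = integral P f + integral (cbox (h *\<^sub>R b) (?O + h *\<^sub>R b)) f"
    using integral_split[OF int[of 0 "?O + h *\<^sub>R b"] b, of h] 1 2 by (simp add: B_def)
  moreover have "integral B f = integral tbox f + integral (cbox ((2 * pi) *\<^sub>R b) (?O + h *\<^sub>R b)) f"
    using integral_split[OF int[of 0 "?O + h *\<^sub>R b"] b, of "2 * pi"] 3 4 by (simp add: B_def)
  moreover have "integral (cbox ((2 * pi) *\<^sub>R b) (?O + h *\<^sub>R b)) f = integral P f"
    using integral_shift_cbox[of "(2 * pi) *\<^sub>R b" "(2 * pi) *\<^sub>R b" "?O + h *\<^sub>R b" f] per b
    by (simp add: periodic_def P_def algebra_simps)
  moreover have "integral (cbox (h *\<^sub>R b) (?O + h *\<^sub>R b)) f = integral tbox (\<lambda>x. f (x + h *\<^sub>R b))"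
    using integral_shift_cbox[of "h *\<^sub>R b" "h *\<^sub>R b" "?O + h *\<^sub>R b" f] by simp
  ultimately show ?thesis by simp
qed

text \<open>The integral of the translate of \<open>f\<close> by \<open>h\<close> is constant in
  \<open>h\<close>; differentiating under the integral at \<open>h = 0\<close> gives the claim. The
  derivative is taken within \<open>{0..2 * pi}\<close>, the range for which translation invariance
  was shown.\<close>

lemma integral_pderiv_dir_eq_0:
  fixes f :: "'a::euclidean_space \<Rightarrow> complex"
  assumes per: "periodic f" and diff: "f differentiable_on UNIV"
    and cont: "continuous_on UNIV (pderiv_dir b f)" and b: "b \<in> Basis"
  shows "integral tbox (pderiv_dir b f) = 0"
proof -
  have contf: "continuous_on UNIV f"
    using diff by (rule differentiable_imp_continuous_on)
  let ?G = "\<lambda>h::real. integral tbox (\<lambda>x. f (x + h *\<^sub>R b))"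
  have "(?G has_vector_derivative integral tbox (\<lambda>x. pderiv_dir b f (x + 0 *\<^sub>R b)))
      (at 0 within {0..2 * pi})"
  proof (rule leibniz_rule_vector_derivative)
    fix h x
    have "(f has_derivative frechet_derivative f (at (x + h *\<^sub>R b))) (at (x + h *\<^sub>R b))"
      using diff by (simp add: differentiable_on_def frechet_derivative_works)
    then have "((\<lambda>h. f (x + h *\<^sub>R b)) has_derivative
        (\<lambda>k. frechet_derivative f (at (x + h *\<^sub>R b)) (0 + k *\<^sub>R b))) (at h within {0..2 * pi})"
      by (intro has_derivative_compose[where f = "\<lambda>h. x + h *\<^sub>R b" and g = f])
         (auto intro!: derivative_eq_intros)
    moreover have "linear (frechet_derivative f (at (x + h *\<^sub>R b)))"
      using diff by (intro linear_frechet_derivative) (simp add: differentiable_on_def)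
    ultimately show "((\<lambda>h. f (x + h *\<^sub>R b)) has_vector_derivative pderiv_dir b f (x + h *\<^sub>R b))
        (at h within {0..2 * pi})"
      by (simp add: has_vector_derivative_def pderiv_dir_def linear_cmul)
  next
    show "(\<lambda>x. f (x + h *\<^sub>R b)) integrable_on tbox" for h
      by (intro integrable_continuous continuous_on_compose2[OF contf] continuous_intros) auto
    show "continuous_on ({0..2 * pi} \<times> tbox) (\<lambda>(h, x). pderiv_dir b f (x + h *\<^sub>R b))"
      unfolding split_beta
      by (intro continuous_on_compose2[OF cont] continuous_intros) auto
  qed auto
  moreover have "(?G has_vector_derivative 0) (at 0 within {0..2 * pi})"
  proof (rule has_vector_derivative_transform)
    show "?G h = integral tbox f" if "h \<in> {0..2 * pi}" for h
      using integral_tbox_translate[OF per contf b, of h] that by simp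
  qed auto
  ultimately show ?thesis
    using vector_derivative_unique_within_closed_interval[of 0 "2 * pi" 0] by auto
qed

section \<open>Smooth functions on the torus\<close>

lemma torus_smooth_iff: "f \<in> torus_smooth \<longleftrightarrow> smooth f \<and> periodic f"
  by (simp add: torus_smooth_def periodic_def)

lemma pderivs_snoc: "pderivs (bs @ [b]) f = pderivs bs (pderiv_dir b f)"
  by (simp add: pderivs_def)

lemma pderivs_Nil [simp]: "pderivs [] f = f"
  and pderivs_Cons: "pderivs (b # bs) f = pderiv_dir b (pderivs bs f)"
  by (simp_all add: pderivs_def)

lemma smooth_differentiable_pderivs:
  "smooth f \<Longrightarrow> set bs \<subseteq> Basis \<Longrightarrow> pderivs bs f differentiable_on UNIV"
  by (simp add: smooth_def)

lemma smooth_continuous: "smooth f \<Longrightarrow> continuous_on UNIV f"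
  using smooth_differentiable_pderivs[of f "[]"] by (simp add: differentiable_imp_continuous_on)

lemma smooth_pderiv_dir: "smooth f \<Longrightarrow> b \<in> Basis \<Longrightarrow> smooth (pderiv_dir b f)"
  unfolding smooth_def by (metis pderivs_snoc set_append le_sup_iff empty_set empty_subsetI
      insert_subset list.simps(15))

lemma periodic_pderiv_dir:
  assumes "periodic f" "f differentiable_on UNIV"
  shows "periodic (pderiv_dir b f)"
  unfolding periodic_def
proof safe
  fix k x :: 'a assume k: "k \<in> Basis"
  let ?y = "x + (2 * pi) *\<^sub>R k"
  have "(f has_derivative frechet_derivative f (at ?y)) (at ?y)"
    using assms(2) by (simp add: differentiable_on_def frechet_derivative_works)
  then have "((\<lambda>z. f (z + (2 * pi) *\<^sub>R k)) has_derivative (\<lambda>h. frechet_derivative f (at ?y) h)) (at x)"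
    by (intro has_derivative_compose[where f = "\<lambda>z. z + (2 * pi) *\<^sub>R k" and g = f])
       (auto intro!: derivative_eq_intros)
  moreover have "(\<lambda>z. f (z + (2 * pi) *\<^sub>R k)) = f"
    using assms(1) k by (auto simp: periodic_def)
  ultimately have "frechet_derivative f (at ?y) = frechet_derivative f (at x)"
    by (simp add: frechet_derivative_at)
  then show "pderiv_dir b f ?y = pderiv_dir b f x"
    by (simp add: pderiv_dir_def)
qed

lemma torus_smooth_pderiv_dir:
  assumes "f \<in> torus_smooth" "b \<in> Basis"
  shows "pderiv_dir b f \<in> torus_smooth"
  using assms smooth_pderiv_dir[of f b] periodic_pderiv_dir[of f b] smooth_differentiable_pderivs[of f "[]"]
  by (simp add: torus_smooth_iff)

lemma torus_smooth_pderivs: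
  assumes "f \<in> torus_smooth" "set bs \<subseteq> Basis"
  shows "pderivs bs f \<in> torus_smooth"
  using assms(2) by (induction bs) (auto simp: pderivs_Cons assms(1) torus_smooth_pderiv_dir)

lemma torus_smooth_continuous: "f \<in> torus_smooth \<Longrightarrow> continuous_on S f"
  using smooth_continuous continuous_on_subset by (fastforce simp: torus_smooth_iff)

lemma pderiv_dir_cmult:
  fixes f :: "'a::euclidean_space \<Rightarrow> complex"
  assumes "f differentiable_on UNIV"
  shows "pderiv_dir b (\<lambda>x. a * f x) = (\<lambda>x. a * pderiv_dir b f x)"
proof
  fix x
  have "(f has_derivative frechet_derivative f (at x)) (at x)"
    using assms by (simp add: differentiable_on_def frechet_derivative_works)
  then have "((\<lambda>x. a * f x) has_derivative (\<lambda>h. a * frechet_derivative f (at x) h)) (at x)"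
    by (rule has_derivative_mult_right)
  then show "pderiv_dir b (\<lambda>x. a * f x) x = a * pderiv_dir b f x"
    by (simp add: pderiv_dir_def frechet_derivative_at[symmetric])
qed

lemma pderivs_cmult:
  fixes f :: "'a::euclidean_space \<Rightarrow> complex"
  assumes "smooth f" "set bs \<subseteq> Basis"
  shows "pderivs bs (\<lambda>x. a * f x) = (\<lambda>x. a * pderivs bs f x)"
  using assms(2)
  by (induction bs) (auto simp: pderivs_Cons pderiv_dir_cmult smooth_differentiable_pderivs assms(1))

lemma torus_smooth_zero: "(\<lambda>x. 0) \<in> torus_smooth"
proof -
  have "pderivs bs (\<lambda>x. 0 :: complex) = (\<lambda>x. 0)" for bs :: "'a list"
    by (induction bs) (auto simp: pderivs_Cons pderiv_dir_def)
  then show ?thesis by (simp add: torus_smooth_def smooth_def)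
qed

lemma finite_Basis_lists: "finite {bs :: 'a::euclidean_space list. set bs \<subseteq> Basis \<and> length bs \<le> k}"
  by (rule finite_lists_length_le) simp

text \<open>The suprema in \<open>Ck_norm\<close> are genuine because continuous periodic functions
  are bounded; being nonnegative, each is at most their sum.\<close>

lemma pderivs_le_Ck_norm:
  assumes "f \<in> torus_smooth" "set bs \<subseteq> Basis" "length bs \<le> k"
  shows "norm (pderivs bs f x) \<le> Ck_norm k f"
proof -
  have bdd: "bdd_above (range (\<lambda>x. norm (pderivs bs f x)))" if "set bs \<subseteq> Basis" for bs
  proof -
    have "bounded (range (pderivs bs f))"
      using torus_smooth_pderivs[OF assms(1) that] torus_smooth_continuous
      by (intro periodic_bounded) (auto simp: torus_smooth_iff)
    then show ?thesis unfolding bounded_iff bdd_above_def by auto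
  qed
  have nn: "0 \<le> (SUP x. norm (pderivs bs f x))" if "set bs \<subseteq> Basis" for bs
    using cSUP_upper[OF _ bdd[OF that], of undefined] norm_ge_zero order_trans by (metis UNIV_I)
  have "norm (pderivs bs f x) \<le> (SUP x. norm (pderivs bs f x))"
    using bdd[OF assms(2)] by (intro cSUP_upper) auto
  also have "\<dots> \<le> Ck_norm k f"
    unfolding Ck_norm_def using assms nn finite_Basis_lists
    by (intro member_le_sum[where f = "\<lambda>bs. SUP x. norm (pderivs bs f x)"]) auto
  finally show ?thesis .
qed

section \<open>Characters and Fourier coefficients\<close>

lemma has_derivative_chr: "(chr m has_derivative (\<lambda>h. \<i> * of_real (m \<bullet> h) * chr m x)) (at x)"
proof -
  have "((\<lambda>x. \<i> * of_real (m \<bullet> x)) has_derivative (\<lambda>h. \<i> * of_real (m \<bullet> h))) (at x)"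
    by (auto intro!: derivative_eq_intros)
  from has_derivative_compose[OF this DERIV_exp[unfolded has_field_derivative_def]]
  show ?thesis by (simp add: chr_def[abs_def] mult_ac)
qed

lemma pderiv_dir_chr: "pderiv_dir b (chr m) = (\<lambda>x. \<i> * of_real (m \<bullet> b) * chr m x)"
  unfolding pderiv_dir_def frechet_derivative_at[OF has_derivative_chr, symmetric] ..

lemma differentiable_chr: "chr m differentiable_on S"
  using has_derivative_chr[of m] by (meson differentiableI differentiable_at_imp_differentiable_on)

lemma pderivs_chr: "pderivs bs (chr m) = (\<lambda>x. (\<Prod>b\<leftarrow>bs. \<i> * of_real (m \<bullet> b)) * chr m x)"
proof (induction bs)
  case (Cons b bs)
  then show ?case
    by (simp only: pderivs_Cons pderiv_dir_cmult[OF differentiable_chr] pderiv_dir_chr) (simp add: mult_ac)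
qed simp

lemma norm_chr [simp]: "norm (chr m x) = 1"
  by (simp add: chr_def)

lemma continuous_on_chr [continuous_intros]: "continuous_on S (chr m)"
  by (rule differentiable_imp_continuous_on[OF differentiable_chr])

lemma chr_add: "chr (m + k) x = chr m x * chr k x"
  by (simp add: chr_def inner_add_left algebra_simps exp_add)

lemma chr_zero [simp]: "chr 0 x = 1"
  by (simp add: chr_def)

lemma exp_2pi_Ints: "k \<in> \<int> \<Longrightarrow> exp (\<i> * of_real (2 * pi * k)) = 1"
  by (auto elim!: Ints_cases simp: exp_eq_1 mult_ac)

lemma periodic_chr: "m \<in> lattice \<Longrightarrow> periodic (chr m)"
  unfolding periodic_def lattice_def
proof safe
  fix b x :: 'a assume "\<forall>b\<in>Basis. m \<bullet> b \<in> \<int>" "b \<in> Basis"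
  then have "exp (\<i> * of_real (2 * pi * (m \<bullet> b))) = 1" by (intro exp_2pi_Ints) auto
  then show "chr m (x + (2 * pi) *\<^sub>R b) = chr m x"
    by (simp add: chr_def inner_add_right algebra_simps exp_add)
qed

lemma torus_smooth_chr: "m \<in> lattice \<Longrightarrow> chr m \<in> torus_smooth"
  by (auto simp: torus_smooth_iff periodic_chr smooth_def pderivs_chr differentiable_chr
      intro!: differentiable_on_mult)

lemma lattice_uminus: "m \<in> lattice \<Longrightarrow> - m \<in> lattice"
  and lattice_add: "m \<in> lattice \<Longrightarrow> k \<in> lattice \<Longrightarrow> m + k \<in> lattice"
  and lattice_diff: "m \<in> lattice \<Longrightarrow> k \<in> lattice \<Longrightarrow> m - k \<in> lattice"
  and zero_lattice [simp]: "0 \<in> lattice"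
  by (auto simp: lattice_def inner_diff_left inner_add_left)

text \<open>Integration by parts: the product of \<open>f\<close> and \<open>chr m\<close> is
  periodic, so its derivative integrates to zero and the boundary term is absent.\<close>

lemma distr_of_pderiv_dir:
  assumes "f \<in> torus_smooth" "b \<in> Basis" "m \<in> lattice"
  shows "distr_of (pderiv_dir b f) (chr m) = - \<i> * of_real (m \<bullet> b) * distr_of f (chr m)"
proof -
  have df: "f differentiable_on UNIV"
    using assms smooth_differentiable_pderivs[of f "[]"] by (simp add: torus_smooth_iff)
  have cont: "continuous_on UNIV f" "continuous_on UNIV (pderiv_dir b f)"
    using assms torus_smooth_continuous torus_smooth_pderiv_dir by blast+
  have eq: "pderiv_dir b (\<lambda>x. f x * chr m x) =
      (\<lambda>x. pderiv_dir b f x * chr m x + \<i> * of_real (m \<bullet> b) * (f x * chr m x))"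
  proof
    fix x
    have "(f has_derivative frechet_derivative f (at x)) (at x)"
      using df by (simp add: differentiable_on_def frechet_derivative_works)
    from has_derivative_mult[OF this has_derivative_chr[of m x]]
    show "pderiv_dir b (\<lambda>x. f x * chr m x) x =
        pderiv_dir b f x * chr m x + \<i> * of_real (m \<bullet> b) * (f x * chr m x)"
      by (simp add: pderiv_dir_def frechet_derivative_at[symmetric])
  qed
  have "integral tbox (pderiv_dir b (\<lambda>x. f x * chr m x)) = 0"
  proof (rule integral_pderiv_dir_eq_0)
    show "periodic (\<lambda>x. f x * chr m x)"
      using assms periodic_chr[of m] by (auto simp: torus_smooth_iff periodic_def)
    show "(\<lambda>x. f x * chr m x) differentiable_on UNIV"
      by (intro differentiable_on_mult df differentiable_chr)
    show "continuous_on UNIV (pderiv_dir b (\<lambda>x. f x * chr m x))"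
      unfolding eq by (intro continuous_intros cont)
  qed (use assms in auto)
  moreover have "integral tbox (pderiv_dir b (\<lambda>x. f x * chr m x)) =
      integral tbox (\<lambda>x. pderiv_dir b f x * chr m x) + integral tbox (\<lambda>x. \<i> * of_real (m \<bullet> b) * (f x * chr m x))"
    unfolding eq using cont
    by (intro integral_add integrable_continuous continuous_intros) (auto intro: continuous_on_subset)
  ultimately show ?thesis
    by (simp add: distr_of_def add_eq_0_iff)
qed

lemma content_tbox: "measure lborel (tbox :: 'a::euclidean_space set) = (2 * pi) ^ DIM('a)"
  by (subst content_cbox) auto

lemma norm_distr_of_le:
  fixes f g :: "'a::euclidean_space \<Rightarrow> complex"
  assumes "continuous_on tbox f" "continuous_on tbox g" "\<And>x. x \<in> tbox \<Longrightarrow> norm (f x) \<le> A"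
    "\<And>x. x \<in> tbox \<Longrightarrow> norm (g x) \<le> B"
  shows "norm (distr_of f g) \<le> A * B * (2 * pi) ^ DIM('a)"
proof -
  have "0 \<in> (tbox :: 'a set)" by (simp add: mem_box)
  then have "0 \<le> A" "0 \<le> B" using assms(3,4)[of 0] norm_ge_zero order_trans by blast+
  then have "norm (integral tbox (\<lambda>x. f x * g x)) \<le> A * B * measure lborel (tbox :: 'a set)"
    using assms
    by (intro has_integral_bound[where f = "\<lambda>x. f x * g x"] integrable_integral integrable_continuous continuous_intros)
       (auto simp: norm_mult intro!: mult_mono)
  then show ?thesis unfolding distr_of_def content_tbox .
qed

section \<open>Decay of the Fourier coefficients of smooth functions\<close>

lemma distr_of_pderivs_replicate:
  assumes "f \<in> torus_smooth" "b \<in> Basis" "m \<in> lattice"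
  shows "distr_of (pderivs (replicate k b) f) (chr m) = (- \<i> * of_real (m \<bullet> b)) ^ k * distr_of f (chr m)"
proof (induction k)
  case (Suc k)
  have "set (replicate k b) \<subseteq> Basis" using assms by auto
  then have "distr_of (pderiv_dir b (pderivs (replicate k b) f)) (chr m)
      = - \<i> * of_real (m \<bullet> b) * distr_of (pderivs (replicate k b) f) (chr m)"
    using assms torus_smooth_pderivs by (intro distr_of_pderiv_dir) auto
  with Suc show ?case by (simp add: pderivs_Cons)
qed simp

text \<open>The decay estimate differentiates in a single direction, so one coordinate has to
  control the whole norm. Integrality makes that coordinate at least 1, which absorbs the 1 in
  \<open>1 + norm m\<close>.\<close>

lemma lattice_large_coordinate:
  fixes m :: "'a::euclidean_space"
  assumes "m \<in> lattice" "m \<noteq> 0"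
  obtains b where "b \<in> Basis" "1 \<le> \<bar>m \<bullet> b\<bar>" "norm m \<le> DIM('a) * \<bar>m \<bullet> b\<bar>"
proof -
  let ?M = "Max ((\<lambda>b. \<bar>m \<bullet> b\<bar>) ` Basis)"
  have "?M \<in> (\<lambda>b. \<bar>m \<bullet> b\<bar>) ` Basis" by (intro Max_in) auto
  then obtain b where b1: "b \<in> Basis" "?M = \<bar>m \<bullet> b\<bar>" by (rule imageE)
  then have b2: "\<bar>m \<bullet> c\<bar> \<le> \<bar>m \<bullet> b\<bar>" if "c \<in> Basis" for c
    using that b1(2)[symmetric] by simp
  obtain c where c: "c \<in> Basis" "m \<bullet> c \<noteq> 0"
    using assms(2) by (metis euclidean_all_zero_iff)
  have "m \<bullet> b \<in> \<int>" using assms(1) b1(1) by (simp add: lattice_def)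
  moreover have "m \<bullet> b \<noteq> 0" using b2[OF c(1)] c(2) by auto
  ultimately have "1 \<le> \<bar>m \<bullet> b\<bar>" by (rule Ints_nonzero_abs_ge1)
  moreover have "norm m \<le> (\<Sum>c\<in>Basis. \<bar>m \<bullet> c\<bar>)" by (rule norm_le_l1)
  moreover have "(\<Sum>c\<in>Basis. \<bar>m \<bullet> c\<bar>) \<le> (\<Sum>c\<in>(Basis :: 'a set). \<bar>m \<bullet> b\<bar>)"
    by (intro sum_mono b2)
  ultimately show ?thesis using that b1(1) by simp
qed

text \<open>Integrate by parts \<open>k\<close> times in the direction of the largest coordinate of
  \<open>m\<close>. The factor \<open>(1 + DIM('a)) ^ k\<close> compares \<open>1 + norm m\<close>
  with that coordinate.\<close>

lemma distr_of_chr_decay: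
  "\<exists>C\<ge>0. \<forall>f\<in>torus_smooth. \<forall>m\<in>lattice.
     norm (distr_of f (chr m)) * (1 + norm (m :: 'a::euclidean_space)) ^ k \<le> C * Ck_norm k f"
proof (intro exI[of _ "(1 + DIM('a)) ^ k * (2 * pi) ^ DIM('a)"] conjI ballI)
  fix f :: "'a \<Rightarrow> complex" and m :: 'a
  assume f: "f \<in> torus_smooth" and m: "m \<in> lattice"
  have *: "norm (distr_of (pderivs bs f) (chr m)) \<le> Ck_norm k f * (2 * pi) ^ DIM('a)"
    if "set bs \<subseteq> Basis" "length bs \<le> k" for bs
    using norm_distr_of_le[of "pderivs bs f" "chr m" "Ck_norm k f" 1] f that
      pderivs_le_Ck_norm[OF f that] torus_smooth_continuous[OF torus_smooth_pderivs[OF f]]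
    by (simp add: continuous_on_chr)
  show "norm (distr_of f (chr m)) * (1 + norm m) ^ k
      \<le> real ((1 + DIM('a)) ^ k) * (2 * pi) ^ DIM('a) * Ck_norm k f"
  proof (cases "m = 0")
    case True
    have "norm (distr_of f (chr m)) \<le> 1 * (Ck_norm k f * (2 * pi) ^ DIM('a))"
      using *[of "[]"] by simp
    also have "\<dots> \<le> real ((1 + DIM('a)) ^ k) * (Ck_norm k f * (2 * pi) ^ DIM('a))"
      using order_trans[OF norm_ge_zero *[of "[]"]] by (intro mult_right_mono) auto
    finally show ?thesis using True by (simp add: mult_ac)
  next
    case False
    then obtain b where b: "b \<in> Basis" "1 \<le> \<bar>m \<bullet> b\<bar>" "norm m \<le> DIM('a) * \<bar>m \<bullet> b\<bar>"
      using lattice_large_coordinate[OF m] by blast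
    have "(1 + norm m) ^ k \<le> ((1 + DIM('a)) * \<bar>m \<bullet> b\<bar>) ^ k"
      using b by (intro power_mono) (auto simp: algebra_simps)
    then have "norm (distr_of f (chr m)) * (1 + norm m) ^ k
        \<le> norm (distr_of f (chr m)) * ((1 + DIM('a)) * \<bar>m \<bullet> b\<bar>) ^ k"
      by (rule mult_left_mono) simp
    also have "\<dots> = (1 + DIM('a)) ^ k * norm ((- \<i> * of_real (m \<bullet> b)) ^ k * distr_of f (chr m))"
      by (simp add: norm_mult norm_power power_mult_distrib)
    also have "\<dots> = (1 + DIM('a)) ^ k * norm (distr_of (pderivs (replicate k b) f) (chr m))"
      using distr_of_pderivs_replicate[OF f b(1) m] by simp
    also have "\<dots> \<le> (1 + DIM('a)) ^ k * (Ck_norm k f * (2 * pi) ^ DIM('a))"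
      using b by (intro mult_left_mono *) auto
    finally show ?thesis by (simp add: mult_ac)
  qed
qed auto

section \<open>Summation over the lattice\<close>

lemma summable_on_int_inverse_square: "(\<lambda>i::int. inverse ((1 + \<bar>real_of_int i\<bar>)\<^sup>2)) summable_on UNIV"
proof -
  let ?f = "\<lambda>i::int. inverse ((1 + \<bar>real_of_int i\<bar>)\<^sup>2)"
  have "summable (\<lambda>n. inverse (real (Suc n) ^ 2))"
    using inverse_power_summable[of 2, where ?'a = real] by (subst summable_Suc_iff) auto
  then have "summable (\<lambda>n. norm (inverse ((1 + real n)\<^sup>2)))" by (simp add: add_ac)
  then have nat: "(\<lambda>n::nat. inverse ((1 + real n)\<^sup>2)) summable_on UNIV"
    by (rule norm_summable_imp_summable_on)
  have "?f summable_on range int"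
    using nat by (subst summable_on_reindex) (auto simp: o_def)
  moreover have "?f summable_on range (\<lambda>n. - int n)"
    using nat by (subst summable_on_reindex) (auto simp: o_def inj_on_def)
  ultimately have "?f summable_on (range int \<union> range (\<lambda>n. - int n))"
    by (rule summable_on_union)
  moreover have "i \<in> range int \<union> range (\<lambda>n. - int n)" for i
    by (cases i rule: int_cases2) auto
  then have "range int \<union> range (\<lambda>n. - int n) = UNIV" by blast
  ultimately show ?thesis by simp
qed

text \<open>The exponent is 2 per dimension: the term is dominated by the product over the
  coordinates of \<open>1 / (1 + |m \<bullet> b|)^2\<close>, and such a product of summable families
  is summable over all integer coordinate vectors.\<close>

lemma lattice_summable:
  "(\<lambda>m::'a::euclidean_space. inverse ((1 + norm m) ^ (2 * DIM('a)))) summable_on lattice"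
proof -
  let ?q = "\<lambda>i::int. inverse ((1 + \<bar>real_of_int i\<bar>)\<^sup>2)"
  let ?\<phi> = "\<lambda>m::'a. restrict (\<lambda>b. \<lfloor>m \<bullet> b\<rfloor>) Basis"
  have "Infinite_Set_Sum.abs_summable_on (\<lambda>g. \<Prod>b\<in>(Basis :: 'a set). ?q (g b)) (PiE Basis (\<lambda>_. UNIV))"
    using summable_on_int_inverse_square
    by (intro abs_summable_on_prod_PiE) (auto simp: abs_summable_equivalent[symmetric])
  then have "(\<lambda>g. norm (\<Prod>b\<in>(Basis :: 'a set). ?q (g b))) summable_on (PiE Basis (\<lambda>_. UNIV))"
    by (rule abs_summable_equivalent[THEN iffD2])
  then have "(\<lambda>g. norm (\<Prod>b\<in>(Basis :: 'a set). ?q (g b))) summable_on ?\<phi> ` lattice"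
    by (rule summable_on_subset_banach) auto
  moreover have "inj_on ?\<phi> lattice"
  proof (rule inj_onI)
    fix m k :: 'a assume mk: "m \<in> lattice" "k \<in> lattice" "?\<phi> m = ?\<phi> k"
    show "m = k"
    proof (rule euclidean_eqI)
      fix b :: 'a assume b: "b \<in> Basis"
      with mk have "\<lfloor>m \<bullet> b\<rfloor> = \<lfloor>k \<bullet> b\<rfloor>" by (metis restrict_apply')
      with mk b show "m \<bullet> b = k \<bullet> b"
        unfolding lattice_def by (metis (mono_tags, lifting) Ints_cases floor_of_int mem_Collect_eq)
    qed
  qed
  ultimately have "(\<lambda>m. norm (\<Prod>b\<in>(Basis :: 'a set). ?q (?\<phi> m b))) summable_on lattice"
    by (subst (asm) summable_on_reindex) (simp_all add: o_def)
  then show ?thesis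
  proof (rule summable_on_comparison_test)
    fix m :: 'a assume m: "m \<in> lattice"
    have fl: "real_of_int \<lfloor>m \<bullet> b\<rfloor> = m \<bullet> b" if "b \<in> Basis" for b
      using m that by (auto simp: lattice_def elim!: Ints_cases)
    have "(\<Prod>b\<in>(Basis :: 'a set). (1 + \<bar>m \<bullet> b\<bar>)\<^sup>2) \<le> (\<Prod>b\<in>(Basis :: 'a set). (1 + norm m)\<^sup>2)"
      by (intro prod_mono) (auto intro!: power_mono Basis_le_norm)
    also have "\<dots> = (1 + norm m) ^ (2 * DIM('a))"
      by (simp add: power_mult)
    finally have "inverse ((1 + norm m) ^ (2 * DIM('a))) \<le> inverse (\<Prod>b\<in>(Basis :: 'a set). (1 + \<bar>m \<bullet> b\<bar>)\<^sup>2)"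
      by (intro le_imp_inverse_le prod_pos) auto
    also have "\<dots> = (\<Prod>b\<in>(Basis :: 'a set). ?q (?\<phi> m b))"
      by (simp add: prod_inversef[symmetric] fl)
    also have "\<dots> = norm (\<Prod>b\<in>(Basis :: 'a set). ?q (?\<phi> m b))"
      by (subst real_norm_def, subst abs_of_nonneg) (auto intro!: prod_nonneg)
    finally show "inverse ((1 + norm m) ^ (2 * DIM('a))) \<le> norm (\<Prod>b\<in>(Basis :: 'a set). ?q (?\<phi> m b))" .
  qed auto
qed

text \<open>The Weierstrass test makes the finite partial sums converge uniformly along the filter
  of finite subsets of \<open>A\<close>, and integration commutes with uniform limits.\<close>

lemma has_sum_integral_cbox:
  fixes f :: "'i \<Rightarrow> 'a::euclidean_space \<Rightarrow> complex"
  assumes "\<And>i. continuous_on (cbox a b) (f i)" "\<And>i x. i \<in> A \<Longrightarrow> x \<in> cbox a b \<Longrightarrow> norm (f i x) \<le> M i"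
    and "M summable_on A"
  shows "((\<lambda>i. integral (cbox a b) (f i)) has_sum integral (cbox a b) (\<lambda>x. \<Sum>\<^sub>\<infinity>i\<in>A. f i x)) A"
    and "continuous_on (cbox a b) (\<lambda>x. \<Sum>\<^sub>\<infinity>i\<in>A. f i x)"
proof -
  have ul: "uniform_limit (cbox a b) (\<lambda>X x. \<Sum>i\<in>X. f i x) (\<lambda>x. \<Sum>\<^sub>\<infinity>i\<in>A. f i x) (finite_subsets_at_top A)"
    using assms(2,3) by (rule Weierstrass_m_test_general)
  have cont: "continuous_on (cbox a b) (\<lambda>x. \<Sum>i\<in>X. f i x)" for X
    using assms(1) by (intro continuous_intros)
  show "continuous_on (cbox a b) (\<lambda>x. \<Sum>\<^sub>\<infinity>i\<in>A. f i x)"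
    using uniform_limit_theorem[OF _ ul] cont by simp
  from uniform_limit_integral_cbox[OF ul cont] obtain I J where
    IJ: "\<And>X. ((\<lambda>x. \<Sum>i\<in>X. f i x) has_integral I X) (cbox a b)"
    "((\<lambda>x. \<Sum>\<^sub>\<infinity>i\<in>A. f i x) has_integral J) (cbox a b)" "(I \<longlongrightarrow> J) (finite_subsets_at_top A)"
    by auto
  have "I X = (\<Sum>i\<in>X. integral (cbox a b) (f i))" if "finite X" for X
    using integral_unique[OF IJ(1)[of X]] that assms(1)
    by (subst (asm) integral_sum) (auto intro!: integrable_continuous)
  then have "((\<lambda>X. \<Sum>i\<in>X. integral (cbox a b) (f i)) \<longlongrightarrow> J) (finite_subsets_at_top A)"
    using IJ(3) by (rule_tac Lim_transform_eventually) (auto intro: eventually_finite_subsets_at_top_weakI)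
  then show "((\<lambda>i. integral (cbox a b) (f i)) has_sum integral (cbox a b) (\<lambda>x. \<Sum>\<^sub>\<infinity>i\<in>A. f i x)) A"
    using IJ(2) by (simp add: has_sum_def integral_unique)
qed

text \<open>If \<open>m + k\<close> is nonzero, the product of the characters is, up to a nonzero
  factor, a derivative of itself in some coordinate, so it integrates to zero.\<close>

lemma distr_of_chr_chr:
  fixes m k :: "'a::euclidean_space"
  assumes "m \<in> lattice" "k \<in> lattice"
  shows "distr_of (chr m) (chr k) = (if k = - m then (2 * of_real pi) ^ DIM('a) else 0)"
proof (cases "m + k = 0")
  case True
  have "distr_of (chr m) (chr k) = integral tbox (\<lambda>x::'a. 1 :: complex)"
    unfolding distr_of_def chr_add[symmetric] using True by simp
  also have "\<dots> = of_real (measure lborel (tbox :: 'a set))"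
    by (simp add: scaleR_conv_of_real)
  finally show ?thesis using True
    by (simp add: content_tbox eq_neg_iff_add_eq_0 add.commute)
next
  case False
  define l where "l = m + k"
  have l: "l \<in> lattice" using assms by (simp add: l_def lattice_add)
  obtain b where b: "b \<in> Basis" "l \<bullet> b \<noteq> 0"
    using False unfolding l_def by (metis euclidean_all_zero_iff)
  have "integral tbox (pderiv_dir b (chr l)) = 0"
    using b l periodic_chr
    by (intro integral_pderiv_dir_eq_0) (auto simp: differentiable_chr pderiv_dir_chr intro!: continuous_intros)
  then have "integral tbox (chr l) = 0" using b by (simp add: pderiv_dir_chr)
  moreover have "k \<noteq> - m" using False by auto
  ultimately show ?thesis by (simp add: distr_of_def chr_add[symmetric] l_def)
qed

lemma chr_diff: "chr (m - k) x = chr m x * chr (- k) x"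
  using chr_add[of m "- k"] by simp

section \<open>Completeness of the characters\<close>

text \<open>The embedding of the torus into Euclidean space by cosines and sines. It makes periodic
  functions into functions on a compact set, where the Stone-Weierstrass theorem applies.\<close>

definition circle_map :: "'a::euclidean_space \<Rightarrow> 'a \<times> 'a" where
  "circle_map x = (\<Sum>b\<in>Basis. cos (x \<bullet> b) *\<^sub>R b, \<Sum>b\<in>Basis. sin (x \<bullet> b) *\<^sub>R b)"

lemma continuous_on_circle_map: "continuous_on S circle_map"
  unfolding circle_map_def by (intro continuous_intros)

text \<open>Multiplication by a cosine or sine of a coordinate only shifts frequencies by a basis
  vector, so it preserves the property that all coefficients vanish. The function \<open>g\<close>
  is generalised because in the product case the second factor acts on \<open>g\<close> already
  multiplied by the first.\<close>

lemma fourier_coefficients_times_polynomial: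
  fixes r :: "'a::euclidean_space \<times> 'a \<Rightarrow> real" and g :: "'a \<Rightarrow> complex"
  assumes "real_polynomial_function r"
    and "continuous_on tbox g" "\<forall>m\<in>lattice. distr_of g (chr m) = 0"
  shows "continuous_on tbox (\<lambda>x. g x * of_real (r (circle_map x))) \<and>
    (\<forall>m\<in>lattice. distr_of (\<lambda>x. g x * of_real (r (circle_map x))) (chr m) = 0)"
  using assms
proof (induction r arbitrary: g)
  case (linear r)
  have Basis_lattice: "b \<in> lattice" if "b \<in> Basis" for b :: 'a
    using that by (auto simp: lattice_def inner_Basis)
  interpret r: bounded_linear r by fact
  have cos: "of_real (cos (x \<bullet> b)) = (chr b x + chr (- b) x) / 2"
    and sin: "of_real (sin (x \<bullet> b)) = (chr b x - chr (- b) x) / (2 * \<i>)" for b x :: 'a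
    by (simp_all add: chr_def cos_exp_eq sin_exp_eq inner_commute flip: cos_of_real sin_of_real)
  \<comment> \<open>By Euler's formulas, \<open>u b\<close> and \<open>v b\<close> are the
    coefficients of \<open>chr b\<close> and \<open>chr (- b)\<close> in the linear form
    \<open>r\<close> evaluated on the embedded torus.\<close>
  define u where "u b = complex_of_real (r (b, 0)) / 2 + of_real (r (0, b)) / (2 * \<i>)" for b
  define v where "v b = complex_of_real (r (b, 0)) / 2 - of_real (r (0, b)) / (2 * \<i>)" for b
  have rG: "of_real (r (circle_map x)) = (\<Sum>b\<in>Basis. u b * chr b x + v b * chr (- b) x)" for x
  proof -
    have split: "(a + d) / 2 * R + (a - d) / (2 * \<i>) * S = (R / 2 + S / (2 * \<i>)) * a + (R / 2 - S / (2 * \<i>)) * d"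
      for a d R S :: complex
      by (simp add: field_simps)
    have "circle_map x = (\<Sum>b\<in>Basis. cos (x \<bullet> b) *\<^sub>R (b, 0)) + (\<Sum>b\<in>Basis. sin (x \<bullet> b) *\<^sub>R (0, b))"
      by (auto simp: circle_map_def prod_eq_iff fst_sum snd_sum)
    then have "r (circle_map x) = (\<Sum>b\<in>Basis. cos (x \<bullet> b) * r (b, 0) + sin (x \<bullet> b) * r (0, b))"
      by (simp only: r.add r.sum r.scaleR sum.distrib) simp
    then have "of_real (r (circle_map x)) = (\<Sum>b\<in>Basis. of_real (cos (x \<bullet> b)) * complex_of_real (r (b, 0))
        + of_real (sin (x \<bullet> b)) * of_real (r (0, b)))"
      by simp
    then show ?thesis
      by (simp only: cos sin split u_def v_def)
  qed
  have "distr_of (\<lambda>x. g x * of_real (r (circle_map x))) (chr m) = 0" if m: "m \<in> lattice" for m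
  proof -
    have "distr_of (\<lambda>x. g x * of_real (r (circle_map x))) (chr m)
        = integral tbox (\<lambda>x. \<Sum>b\<in>Basis. u b * (g x * chr (m + b) x) + v b * (g x * chr (m - b) x))"
      unfolding distr_of_def rG
      by (intro arg_cong[where f = "integral _"] ext)
         (simp add: chr_add chr_diff sum_distrib_left sum_distrib_right distrib_left distrib_right mult_ac)
    also have "\<dots> = (\<Sum>b\<in>Basis. u b * distr_of g (chr (m + b)) + v b * distr_of g (chr (m - b)))"
    proof -
      have int: "(\<lambda>x. a * (g x * chr k x)) integrable_on tbox" for a k
        using linear.prems(1) by (intro integrable_continuous continuous_intros)
      show ?thesis
        unfolding distr_of_def
        by (subst integral_sum) (simp_all add: integral_add integrable_add int)
    qed
    also have "\<dots> = 0"
      using linear.prems m Basis_lattice by (intro sum.neutral) (simp add: lattice_add lattice_diff)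
    finally show ?thesis .
  qed
  moreover have "continuous_on tbox (\<lambda>x. g x * of_real (r (circle_map x)))"
    by (intro continuous_intros linear.prems r.continuous_on continuous_on_circle_map)
  ultimately show ?case by blast
next
  case (const c)
  then show ?case by (auto simp: distr_of_def mult_ac intro!: continuous_intros)
next
  case (add p q)
  have "distr_of (\<lambda>x. g x * of_real (p (circle_map x) + q (circle_map x))) (chr m)
      = distr_of (\<lambda>x. g x * of_real (p (circle_map x))) (chr m) + distr_of (\<lambda>x. g x * of_real (q (circle_map x))) (chr m)" for m
  proof -
    have "(\<lambda>x. g x * of_real (p (circle_map x)) * chr m x) integrable_on tbox"
      "(\<lambda>x. g x * of_real (q (circle_map x)) * chr m x) integrable_on tbox"
      using add.IH[OF add.prems] by (auto intro!: integrable_continuous continuous_on_mult continuous_on_chr)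
    from integral_add[OF this] show ?thesis
      by (simp add: distr_of_def distrib_left distrib_right)
  qed
  moreover have "continuous_on tbox (\<lambda>x. g x * of_real (p (circle_map x)) + g x * of_real (q (circle_map x)))"
    using add.IH[OF add.prems] by (intro continuous_on_add) auto
  ultimately show ?case using add.IH[OF add.prems] by (simp add: distrib_left)
next
  case (mult p q)
  from mult.IH(1)[OF mult.prems] mult.IH(2)[of "\<lambda>x. g x * of_real (p (circle_map x))"]
  show ?case by (simp add: mult_ac)
qed

text \<open>A function with vanishing coefficients is orthogonal to all polynomials in cosines and
  sines. Since these approximate its conjugate uniformly, the integral of its squared modulus is
  zero.\<close>

theorem fourier_unique:
  fixes g :: "'a::euclidean_space \<Rightarrow> complex"
  assumes per: "periodic g" and cont: "continuous_on UNIV g"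
    and zero: "\<And>m. m \<in> lattice \<Longrightarrow> distr_of g (chr m) = 0"
  shows "g = (\<lambda>x. 0)"
proof -
  note contG = continuous_on_circle_map
  have contg: "continuous_on S g" for S
    using cont continuous_on_subset by blast
  have G_eq: "g x = g y" if "circle_map x = circle_map y" for x y
  proof -
    have "\<exists>n::int. x \<bullet> b = y \<bullet> b + 2 * pi * of_int n" if b: "b \<in> Basis" for b
    proof -
      have "fst (circle_map z) \<bullet> b = cos (z \<bullet> b)" "snd (circle_map z) \<bullet> b = sin (z \<bullet> b)" for z
        using b by (auto simp: circle_map_def)
      with \<open>circle_map x = circle_map y\<close> have "cos (x \<bullet> b) = cos (y \<bullet> b)" "sin (x \<bullet> b) = sin (y \<bullet> b)" by metis+
      then show ?thesis using sin_cos_eq_iff by blast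
    qed
    then obtain k :: "'a \<Rightarrow> int" where k: "\<And>b. b \<in> Basis \<Longrightarrow> x \<bullet> b = y \<bullet> b + 2 * pi * of_int (k b)"
      by metis
    have "x = y + (\<Sum>b\<in>Basis. (2 * pi * of_int (k b)) *\<^sub>R b)"
    proof (rule euclidean_eqI)
      fix b :: 'a assume b: "b \<in> Basis"
      then have "(\<Sum>b\<in>Basis. (2 * pi * of_int (k b)) *\<^sub>R b) \<bullet> b = 2 * pi * of_int (k b)"
        by (rule inner_sum_left_Basis)
      then show "x \<bullet> b = (y + (\<Sum>b\<in>Basis. (2 * pi * of_int (k b)) *\<^sub>R b)) \<bullet> b"
        by (simp only: k[OF b] inner_add_left)
    qed
    then show ?thesis using periodic_sum_shift[OF per finite_Basis order_refl, of y k] by simp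
  qed
  \<comment> \<open>This is \<open>g\<close> read on the embedded torus; \<open>G_eq\<close> makes
    the choice of preimage irrelevant.\<close>
  define h where "h y = g (inv_into tbox circle_map y)" for y
  have h: "h (circle_map x) = g x" if "x \<in> tbox" for x
    unfolding h_def using that by (intro G_eq f_inv_into_f) auto
  have compS: "compact (circle_map ` tbox)" by (intro compact_continuous_image contG compact_cbox)
  \<comment> \<open>Continuity follows from compactness: preimages of closed sets under
    \<open>h\<close> are images of compact subsets of \<open>tbox\<close> under
    \<open>circle_map\<close>.\<close>
  have "continuous_on (circle_map ` tbox) h"
  proof (subst continuous_on_closed_vimage)
    show "closed (circle_map ` tbox)" by (rule compact_imp_closed[OF compS])
    show "\<forall>B. closed B \<longrightarrow> closed (h -` B \<inter> circle_map ` tbox)"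
    proof safe
      fix B :: "complex set" assume "closed B"
      then have "closed (g -` B)" using cont by (simp add: continuous_on_closed_vimage)
      then have "compact (tbox \<inter> g -` B)" by (intro compact_Int_closed compact_cbox)
      then have "closed (circle_map ` (tbox \<inter> g -` B))"
        by (intro compact_imp_closed compact_continuous_image contG)
      moreover have "h -` B \<inter> circle_map ` tbox = circle_map ` (tbox \<inter> g -` B)" using h by auto
      ultimately show "closed (h -` B \<inter> circle_map ` tbox)" by simp
    qed
  qed
  then have conth: "continuous_on (circle_map ` tbox) (\<lambda>y. cnj (h y))" by (intro continuous_intros)
  obtain B where B: "\<And>x. norm (g x) \<le> B"
    using periodic_bounded[OF per cont] unfolding bounded_iff by auto
  define K where "K = B * (2 * pi) ^ DIM('a)"
  \<comment> \<open>Replacing the conjugate of \<open>g\<close> by a polynomial within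
    \<open>e\<close> leaves only the error term, as the polynomial pairs to zero with
    \<open>g\<close>.\<close>
  have "norm (distr_of g (\<lambda>x. cnj (g x))) \<le> K * e" if e: "e > 0" for e
  proof -
    obtain P where P: "polynomial_function P" "\<And>y. y \<in> circle_map ` tbox \<Longrightarrow> norm (cnj (h y) - P y) < e"
      using Stone_Weierstrass_polynomial_function[OF compS conth e] by blast
    have Re: "real_polynomial_function (\<lambda>y. Re (P y))" and Im: "real_polynomial_function (\<lambda>y. Im (P y))"
      using P(1) bounded_linear_Re bounded_linear_Im unfolding polynomial_function_def o_def by blast+
    note RP = fourier_coefficients_times_polynomial[OF Re contg]
      fourier_coefficients_times_polynomial[OF Im contg]
    have RP0: "distr_of g (\<lambda>x. of_real (Re (P (circle_map x)))) = 0" "distr_of g (\<lambda>x. of_real (Im (P (circle_map x)))) = 0"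
      using RP zero zero_lattice by (auto simp: distr_of_def dest!: bspec[OF _ zero_lattice])
    have contP: "continuous_on tbox (\<lambda>x. P (circle_map x))"
      by (intro continuous_on_compose2[OF continuous_on_polymonial_function[OF P(1)] contG]) auto
    have "distr_of g (\<lambda>x. P (circle_map x)) = integral tbox (\<lambda>x. g x * of_real (Re (P (circle_map x))) + \<i> * (g x * of_real (Im (P (circle_map x)))))"
      unfolding distr_of_def
      by (intro arg_cong[where f = "integral _"] ext) (metis complex_eq distrib_left mult.left_commute)
    also have "\<dots> = distr_of g (\<lambda>x. of_real (Re (P (circle_map x)))) + \<i> * distr_of g (\<lambda>x. of_real (Im (P (circle_map x))))"
      unfolding distr_of_def using contP
      by (subst integral_add) (auto intro!: integrable_continuous continuous_intros contg)
    finally have "distr_of g (\<lambda>x. P (circle_map x)) = 0" using RP0 by simp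
    moreover have "distr_of g (\<lambda>x. cnj (g x) - P (circle_map x)) = distr_of g (\<lambda>x. cnj (g x)) - distr_of g (\<lambda>x. P (circle_map x))"
      unfolding distr_of_def using contP
      by (subst integral_diff[symmetric])
         (auto intro!: integrable_continuous continuous_intros contg simp: algebra_simps)
    moreover have "norm (distr_of g (\<lambda>x. cnj (g x) - P (circle_map x))) \<le> B * e * (2 * pi) ^ DIM('a)"
    proof (intro norm_distr_of_le contg continuous_intros contP B)
      show "norm (cnj (g x) - P (circle_map x)) \<le> e" if "x \<in> tbox" for x
        using P(2)[of "circle_map x"] h[OF that] that by (simp add: less_imp_le)
    qed
    ultimately show ?thesis by (simp add: K_def mult_ac)
  qed
  then have small: "norm (distr_of g (\<lambda>x. cnj (g x))) \<le> K * e" if "e > 0" for e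
    using that by blast
  have "0 \<le> K" using order_trans[OF norm_ge_zero B] by (simp add: K_def)
  have "norm (distr_of g (\<lambda>x. cnj (g x))) \<le> 0 + e" if "e > 0" for e
  proof -
    \<comment> \<open>Dividing by \<open>K + 1\<close> instead of \<open>K\<close> covers the case
      \<open>K = 0\<close>.\<close>
    have "K * (e / (K + 1)) \<le> e" using that \<open>0 \<le> K\<close> by (simp add: field_simps)
    then show ?thesis using small[of "e / (K + 1)"] that \<open>0 \<le> K\<close> by simp
  qed
  then have "distr_of g (\<lambda>x. cnj (g x)) = 0"
    using field_le_epsilon[of "norm (distr_of g (\<lambda>x. cnj (g x)))" 0] by simp
  then have "integral tbox (\<lambda>x. complex_of_real ((norm (g x))\<^sup>2)) = 0"
    by (simp only: distr_of_def complex_norm_square)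
  then have "integral tbox (\<lambda>x. (norm (g x))\<^sup>2) = 0"
    using integral_linear[OF _ bounded_linear_of_real[where ?'a = complex], of "\<lambda>x. (norm (g x))\<^sup>2" tbox] contg
    by (simp add: o_def integrable_continuous continuous_intros)
  then have "g x = 0" if "x \<in> tbox" for x
    using that contg
    by (subst (asm) integral_cbox_eq_0_iff) (auto intro!: continuous_intros simp: box_ne_empty)
  then show ?thesis
    using periodic_representative[where ?'b = complex] per by (metis ext)
qed


section \<open>Rapidly decreasing Fourier series\<close>

definition rapid :: "('a::euclidean_space \<Rightarrow> complex) \<Rightarrow> bool" where
  "rapid c \<longleftrightarrow> (\<forall>k. \<exists>C. \<forall>m\<in>lattice. norm (c m) * (1 + norm m) ^ k \<le> C)"

definition fourier_series :: "('a::euclidean_space \<Rightarrow> complex) \<Rightarrow> 'a \<Rightarrow> complex" where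
  "fourier_series c x = (\<Sum>\<^sub>\<infinity>m\<in>lattice. c m * chr m x)"

text \<open>The pairing with \<open>chr m\<close> gives the Fourier coefficient at \<open>- m\<close>, times \<open>(2\<pi>)\<^sup>d\<close>; hence the
  distribution \<open>\<Sum>\<^sub>m c(m) e\<^sup>i\<^sup>m\<^sup>x\<close> acts by the following formula.\<close>

definition series_distr :: "('a::euclidean_space \<Rightarrow> complex) \<Rightarrow> 'a functional" where
  "series_distr c \<phi> = (\<Sum>\<^sub>\<infinity>m\<in>lattice. c m * distr_of \<phi> (chr m))"

lemma rapidI:
  assumes "\<And>k. \<exists>C. \<forall>m\<in>lattice. norm (c m) * (1 + norm m) ^ k \<le> C"
  shows "rapid c"
  using assms by (simp add: rapid_def)

text \<open>The form in which every later operation is shown to preserve rapid decrease: a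
  polynomial loss is absorbed by using the bound for \<open>c\<close> with exponent
  \<open>N + k\<close>.\<close>

lemma rapid_bounded_by:
  assumes "rapid c" "\<And>m. m \<in> lattice \<Longrightarrow> norm (a m) \<le> B * (1 + norm m) ^ N * norm (c m)"
  shows "rapid a"
proof (rule rapidI)
  fix k
  obtain C where C: "\<forall>m\<in>lattice. norm (c m) * (1 + norm m) ^ (N + k) \<le> C"
    using assms(1) unfolding rapid_def by blast
  have "norm (a m) * (1 + norm m) ^ k \<le> \<bar>B\<bar> * C" if m: "m \<in> lattice" for m
  proof -
    have "norm (a m) * (1 + norm m) ^ k \<le> (B * (1 + norm m) ^ N * norm (c m)) * (1 + norm m) ^ k"
      using assms(2)[OF m] by (intro mult_right_mono) auto
    also have "\<dots> = B * (norm (c m) * (1 + norm m) ^ (N + k))"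
      by (simp add: power_add)
    also have "\<dots> \<le> \<bar>B\<bar> * (norm (c m) * (1 + norm m) ^ (N + k))"
      by (intro mult_right_mono) auto
    also have "\<dots> \<le> \<bar>B\<bar> * C"
      using C m by (intro mult_left_mono) auto
    finally show ?thesis .
  qed
  then show "\<exists>C. \<forall>m\<in>lattice. norm (a m) * (1 + norm m) ^ k \<le> C" by blast
qed

lemma rapid_reflect_divide: "rapid c \<Longrightarrow> rapid (\<lambda>m. c (- m) / a)"
proof (rule rapidI)
  fix k assume "rapid c"
  then obtain C where C: "\<forall>m\<in>lattice. norm (c m) * (1 + norm m) ^ k \<le> C"
    unfolding rapid_def by blast
  have "norm (c (- m) / a) * (1 + norm m) ^ k \<le> C / norm a" if "m \<in> lattice" for m
    using C[rule_format, OF lattice_uminus[OF that]] by (simp add: norm_divide divide_right_mono)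
  then show "\<exists>C. \<forall>m\<in>lattice. norm (c (- m) / a) * (1 + norm m) ^ k \<le> C" by blast
qed

text \<open>The bound with \<open>2 * DIM('a)\<close> additional powers leaves a summable
  factor.\<close>

lemma rapid_summable:
  fixes c :: "'a::euclidean_space \<Rightarrow> complex"
  assumes "rapid c"
  shows "(\<lambda>m. norm (c m) * (1 + norm m) ^ k) summable_on lattice"
proof -
  obtain C where C: "\<forall>m\<in>lattice. norm (c m) * (1 + norm m) ^ (k + 2 * DIM('a)) \<le> C"
    using assms unfolding rapid_def by blast
  have "(\<lambda>m::'a. C * inverse ((1 + norm m) ^ (2 * DIM('a)))) summable_on lattice"
    by (intro summable_on_cmult_right lattice_summable)
  then show ?thesis
  proof (rule summable_on_comparison_test)
    fix m :: 'a assume "m \<in> lattice"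
    then have "norm (c m) * (1 + norm m) ^ k * (1 + norm m) ^ (2 * DIM('a)) \<le> C"
      using C by (simp add: power_add mult_ac)
    moreover have "0 < (1 + norm m) ^ (2 * DIM('a))"
      by (intro zero_less_power) (simp add: add_pos_nonneg)
    ultimately show "norm (c m) * (1 + norm m) ^ k \<le> C * inverse ((1 + norm m) ^ (2 * DIM('a)))"
      by (simp add: field_simps)
  qed auto
qed

lemma rapid_summable_norm: "rapid c \<Longrightarrow> (\<lambda>m. norm (c m)) summable_on lattice"
  using rapid_summable[of c 0] by simp

lemma rapid_torus_smooth:
  assumes "f \<in> torus_smooth"
  shows "rapid (\<lambda>m. distr_of f (chr m))"
proof (rule rapidI)
  fix k
  obtain C where "\<forall>f\<in>torus_smooth. \<forall>m\<in>lattice.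
     norm (distr_of f (chr m)) * (1 + norm (m :: 'a)) ^ k \<le> C * Ck_norm k f"
    using distr_of_chr_decay[of k, where ?'a = 'a] by blast
  with assms show "\<exists>C. \<forall>m\<in>lattice. norm (distr_of f (chr m)) * (1 + norm m) ^ k \<le> C"
    by blast
qed

lemma distr_of_fourier_series:
  fixes c :: "'a::euclidean_space \<Rightarrow> complex"
  assumes "rapid c" and \<phi>: "continuous_on tbox \<phi>"
  shows "distr_of (fourier_series c) \<phi> = series_distr c \<phi>"
    and "(\<lambda>m. norm (c m * distr_of \<phi> (chr m))) summable_on lattice"
proof -
  obtain B where B: "\<And>x. x \<in> tbox \<Longrightarrow> norm (\<phi> x) \<le> B"
    using compact_imp_bounded[OF compact_continuous_image[OF \<phi> compact_cbox]]
    unfolding bounded_iff by auto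
  have "((\<lambda>m. integral tbox (\<lambda>x. c m * chr m x * \<phi> x)) has_sum
      integral tbox (\<lambda>x. \<Sum>\<^sub>\<infinity>m\<in>lattice. c m * chr m x * \<phi> x)) lattice"
  proof (rule has_sum_integral_cbox)
    show "continuous_on tbox (\<lambda>x. c m * chr m x * \<phi> x)" for m
      by (intro continuous_intros \<phi>)
    show "norm (c m * chr m x * \<phi> x) \<le> norm (c m) * B" if "x \<in> tbox" for m x
      using B[OF that] by (simp add: norm_mult mult_left_mono)
    show "(\<lambda>m. norm (c m) * B) summable_on lattice"
      using rapid_summable_norm[OF assms(1)] by (rule summable_on_cmult_left)
  qed
  moreover have "integral tbox (\<lambda>x. c m * chr m x * \<phi> x) = c m * distr_of \<phi> (chr m)" for m
    by (simp add: distr_of_def mult_ac flip: integral_mult_right)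
  ultimately show "distr_of (fourier_series c) \<phi> = series_distr c \<phi>"
    by (simp add: distr_of_def fourier_series_def series_distr_def infsum_cmult_left' infsumI)
  have "(\<lambda>m. norm (c m) * (1 * B * (2 * pi) ^ DIM('a))) summable_on lattice"
    using rapid_summable_norm[OF assms(1)] by (rule summable_on_cmult_left)
  then show "(\<lambda>m. norm (c m * distr_of \<phi> (chr m))) summable_on lattice"
  proof (rule Infinite_Sum.abs_summable_on_comparison_test')
    fix m
    show "norm (c m * distr_of \<phi> (chr m)) \<le> norm (c m) * (1 * B * (2 * pi) ^ DIM('a))"
      using norm_distr_of_le[where f = \<phi> and g = "chr m" and A = B and B = 1, OF \<phi> continuous_on_chr] B
      by (simp add: norm_mult mult_left_mono)
  qed
qed

lemma distr_of_fourier_series_chr: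
  fixes c :: "'a::euclidean_space \<Rightarrow> complex"
  assumes "rapid c" "m \<in> lattice"
  shows "distr_of (fourier_series c) (chr m) = (2 * of_real pi) ^ DIM('a) * c (- m)"
proof -
  have "distr_of (fourier_series c) (chr m) = (\<Sum>\<^sub>\<infinity>k\<in>lattice. c k * distr_of (chr m) (chr k))"
    using distr_of_fourier_series(1)[OF assms(1) continuous_on_chr] by (simp add: series_distr_def)
  also have "\<dots> = (\<Sum>\<^sub>\<infinity>k\<in>{- m}. c k * (2 * of_real pi) ^ DIM('a))"
    using assms(2) by (intro infsum_cong_neutral) (auto simp: distr_of_chr_chr lattice_uminus)
  finally show ?thesis by simp
qed

section \<open>Termwise differentiation and Fourier inversion\<close>

lemma countable_lattice: "countable (lattice :: 'a::euclidean_space set)"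
proof -
  have "(\<lambda>m::'a. norm (inverse ((1 + norm m) ^ (2 * DIM('a))))) summable_on lattice"
    using lattice_summable[where ?'a = 'a] by simp
  from abs_summable_countable[OF this] have "countable {m \<in> lattice :: 'a set. 1 + norm m \<noteq> 0}"
    by simp
  moreover have "1 + norm (m :: 'a) \<noteq> 0" for m using norm_ge_zero[of m] by linarith
  ultimately show ?thesis by simp
qed

lemma infinite_lattice: "infinite (lattice :: 'a::euclidean_space set)"
proof -
  obtain b :: 'a where b: "b \<in> Basis" using nonempty_Basis by blast
  have "(\<lambda>n::nat. real n *\<^sub>R b) ` UNIV \<subseteq> lattice"
    using b by (auto simp: lattice_def inner_Basis)
  moreover have "inj (\<lambda>n::nat. real n *\<^sub>R b)"
    using b by (auto simp: inj_on_def)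
  ultimately show ?thesis by (meson finite_imageD infinite_UNIV_nat infinite_super)
qed

text \<open>The differentiation theorem for series concerns sequences, so the lattice is enumerated.
  Being countable and infinite, it is in bijection with the naturals through
  \<open>from_nat_into\<close>.\<close>

lemma lattice_sums:
  fixes a :: "'a::euclidean_space \<Rightarrow> complex"
  assumes "(\<lambda>m. norm (a m)) summable_on lattice"
  shows "(\<lambda>n. a (from_nat_into lattice n)) sums (\<Sum>\<^sub>\<infinity>m\<in>lattice. a m)"
proof -
  have "(a has_sum (\<Sum>\<^sub>\<infinity>m\<in>lattice. a m)) lattice"
    using abs_summable_summable[OF assms] by simp
  then show ?thesis
    using has_sum_reindex_bij_betw[OF bij_betw_from_nat_into[OF countable_lattice infinite_lattice], of a]
    by (intro has_sum_imp_sums) auto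
qed

text \<open>The derivatives of the terms are bounded, uniformly in \<open>x\<close>, by
  \<open>norm (c m) * (1 + norm m)\<close> times \<open>norm h\<close>. The tails of this summable
  majorant give the uniform convergence of the differentiated series.\<close>

lemma has_derivative_fourier_series:
  fixes c :: "'a::euclidean_space \<Rightarrow> complex"
  assumes "rapid c"
  shows "(fourier_series c has_derivative
    (\<lambda>h. \<Sum>\<^sub>\<infinity>m\<in>lattice. \<i> * of_real (m \<bullet> h) * c m * chr m x)) (at x)"
proof -
  let ?e = "from_nat_into (lattice :: 'a set)"
  let ?f = "\<lambda>n x. c (?e n) * chr (?e n) x"
  let ?f' = "\<lambda>n x h. \<i> * of_real (?e n \<bullet> h) * c (?e n) * chr (?e n) x"
  let ?a = "\<lambda>n. norm (c (?e n)) * (1 + norm (?e n))"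
  have bij: "bij_betw ?e UNIV lattice"
    by (rule bij_betw_from_nat_into[OF countable_lattice infinite_lattice])
  have "(\<lambda>m. norm (c m) * (1 + norm m)) summable_on lattice"
    using rapid_summable[OF assms, of 1] by simp
  then have "?a summable_on UNIV"
    using summable_on_reindex_bij_betw[OF bij, of "\<lambda>m. norm (c m) * (1 + norm m)"] by simp
  then have a: "summable ?a" by (rule summable_on_imp_summable)
  have f'_le: "norm (?f' n x h) \<le> ?a n * norm h" for n x h
  proof -
    have "norm (?f' n x h) = norm (c (?e n)) * \<bar>?e n \<bullet> h\<bar>" by (simp add: norm_mult)
    also have "\<dots> \<le> norm (c (?e n)) * (norm (?e n) * norm h)"
      by (intro mult_left_mono Cauchy_Schwarz_ineq2) simp
    also have "\<dots> \<le> norm (c (?e n)) * ((1 + norm (?e n)) * norm h)"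
      by (intro mult_left_mono mult_right_mono) auto
    finally show ?thesis by simp
  qed
  have sm: "summable (\<lambda>n. ?f' n x h)" for x h
    by (rule summable_comparison_test'[OF summable_mult2[OF a]]) (rule f'_le)
  have "\<exists>g. \<forall>x\<in>UNIV. (\<lambda>n. ?f n x) sums g x \<and>
      (g has_derivative (\<lambda>h. suminf (\<lambda>n. ?f' n x h))) (at x within UNIV)"
  proof (rule has_derivative_series)
    show "(?f n has_derivative ?f' n x) (at x within UNIV)" for n x
      using has_derivative_mult_right[OF has_derivative_chr[of "?e n" x], of "c (?e n)"]
      by (simp add: mult_ac)
    show "\<forall>\<^sub>F n in sequentially. \<forall>x\<in>UNIV. \<forall>h.
        norm ((\<Sum>i<n. ?f' i x h) - suminf (\<lambda>n. ?f' n x h)) \<le> e * norm h" if e: "e > 0" for e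
    proof -
      obtain N where N: "\<And>n. n \<ge> N \<Longrightarrow> norm (suminf (\<lambda>i. ?a (i + n))) < e"
        using suminf_exist_split[OF e a] by blast
      have "norm ((\<Sum>i<n. ?f' i x h) - suminf (\<lambda>n. ?f' n x h)) \<le> e * norm h" if n: "n \<ge> N" for n x h
      proof -
        have "norm ((\<Sum>i<n. ?f' i x h) - suminf (\<lambda>n. ?f' n x h)) = norm (suminf (\<lambda>i. ?f' (i + n) x h))"
          unfolding suminf_minus_initial_segment[OF sm[of h x], of n] by (simp add: norm_minus_commute)
        also have "\<dots> \<le> (suminf (\<lambda>i. ?a (i + n) * norm h))"
          using a by (intro norm_suminf_le f'_le summable_mult2 summable_ignore_initial_segment)
        also have "\<dots> = (suminf (\<lambda>i. ?a (i + n))) * norm h"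
          using a by (intro suminf_mult2[symmetric] summable_ignore_initial_segment)
        also have "\<dots> \<le> e * norm h"
          using N[OF n] by (intro mult_right_mono) auto
        finally show ?thesis .
      qed
      then show ?thesis unfolding eventually_sequentially by blast
    qed
    show "(\<lambda>n. ?f n 0) sums fourier_series c 0"
      unfolding fourier_series_def using rapid_summable_norm[OF assms]
      by (intro lattice_sums) (simp add: norm_mult)
  qed auto
  then obtain g where g: "\<And>x. (\<lambda>n. ?f n x) sums g x"
      "\<And>x. (g has_derivative (\<lambda>h. suminf (\<lambda>n. ?f' n x h))) (at x)"
    by auto
  have "(\<lambda>n. ?f n x) sums fourier_series c x" for x
    unfolding fourier_series_def using rapid_summable_norm[OF assms]
    by (intro lattice_sums) (simp add: norm_mult)
  with g(1) have "g = fourier_series c" using sums_unique2 by blast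
  moreover have "(\<lambda>n. ?f' n x h) sums (\<Sum>\<^sub>\<infinity>m\<in>lattice. \<i> * of_real (m \<bullet> h) * c m * chr m x)" for x h
  proof (rule lattice_sums)
    have "(\<lambda>m. norm (c m) * (1 + norm m) * norm h) summable_on lattice"
      using rapid_summable[OF assms, of 1] by (intro summable_on_cmult_left) simp
    then show "(\<lambda>m. norm (\<i> * of_real (m \<bullet> h) * c m * chr m x)) summable_on lattice"
    proof (rule Infinite_Sum.abs_summable_on_comparison_test')
      fix m :: 'a assume "m \<in> lattice"
      then obtain n where "m = ?e n" using bij unfolding bij_betw_def by blast
      then show "norm (\<i> * of_real (m \<bullet> h) * c m * chr m x) \<le> norm (c m) * (1 + norm m) * norm h"
        using f'_le[of n h x] by simp
    qed
  qed
  ultimately show ?thesis using g(2)[of x] by (simp add: sums_iff)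
qed

lemma pderiv_dir_fourier_series:
  assumes "rapid c"
  shows "pderiv_dir b (fourier_series c) = fourier_series (\<lambda>m. \<i> * of_real (m \<bullet> b) * c m)"
  by (rule ext) (simp add: pderiv_dir_def fourier_series_def
      frechet_derivative_at[OF has_derivative_fourier_series[OF assms], symmetric])

lemma rapid_derivative:
  assumes "rapid c"
  shows "rapid (\<lambda>m. \<i> * of_real (m \<bullet> b) * c m)"
proof (rule rapid_bounded_by[OF assms])
  show "norm (\<i> * of_real (m \<bullet> b) * c m) \<le> norm b * (1 + norm m) ^ 1 * norm (c m)" for m
  proof -
    have "\<bar>m \<bullet> b\<bar> \<le> norm b * (1 + norm m)"
      using Cauchy_Schwarz_ineq2[of m b] mult_right_mono[of "norm m" "1 + norm m" "norm b"]
      by (simp add: mult.commute)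
    then show ?thesis by (simp add: norm_mult mult_right_mono)
  qed
qed

text \<open>Differentiation maps Fourier series with rapid coefficients to such series, so every
  iterated derivative is again differentiable.\<close>

lemma torus_smooth_fourier_series:
  assumes "rapid c"
  shows "fourier_series c \<in> torus_smooth"
proof -
  have "\<exists>c'. rapid c' \<and> pderivs bs (fourier_series c) = fourier_series c'" for bs
  proof (induction bs)
    case (Cons b bs)
    then show ?case using pderiv_dir_fourier_series rapid_derivative by (metis pderivs_Cons)
  qed (use assms in auto)
  moreover have "fourier_series c' differentiable_on UNIV" if "rapid c'" for c' :: "'a \<Rightarrow> complex"
    using has_derivative_fourier_series[OF that]
    by (meson differentiableI differentiable_at_imp_differentiable_on)
  ultimately have "smooth (fourier_series c)"
    unfolding smooth_def by metis
  moreover have "periodic (fourier_series c)"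
    unfolding periodic_def fourier_series_def
  proof (intro ballI allI infsum_cong)
    fix b x m :: 'a assume "b \<in> Basis" "m \<in> lattice"
    with periodic_chr[of m] show "c m * chr m (x + (2 * pi) *\<^sub>R b) = c m * chr m x"
      by (simp add: periodic_def)
  qed
  ultimately show ?thesis by (simp add: torus_smooth_iff)
qed

text \<open>The function and its Fourier series have the same coefficients, so completeness
  identifies them.\<close>

theorem fourier_inversion:
  fixes f :: "'a::euclidean_space \<Rightarrow> complex"
  assumes "f \<in> torus_smooth"
  shows "f = fourier_series (\<lambda>m. distr_of f (chr (- m)) / (2 * of_real pi) ^ DIM('a))"
proof -
  define c where "c m = distr_of f (chr (- m)) / (2 * of_real pi) ^ DIM('a)" for m
  have c: "rapid c"
    unfolding c_def by (rule rapid_reflect_divide[OF rapid_torus_smooth[OF assms]])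
  note smooth = torus_smooth_fourier_series[OF c] assms
  have cont: "continuous_on S f" "continuous_on S (fourier_series c)" for S
    using torus_smooth_continuous smooth by blast+
  have "(\<lambda>x. f x - fourier_series c x) = (\<lambda>x. 0)"
  proof (rule fourier_unique)
    show "periodic (\<lambda>x. f x - fourier_series c x)"
      using smooth by (simp add: torus_smooth_iff periodic_def)
    show "continuous_on UNIV (\<lambda>x. f x - fourier_series c x)"
      by (intro continuous_intros cont)
    fix m :: 'a assume m: "m \<in> lattice"
    have "distr_of (\<lambda>x. f x - fourier_series c x) (chr m) = distr_of f (chr m) - distr_of (fourier_series c) (chr m)"
      unfolding distr_of_def
      by (subst integral_diff[symmetric]) (auto intro!: integrable_continuous continuous_intros cont simp: algebra_simps)
    also have "\<dots> = 0"
      unfolding distr_of_fourier_series_chr[OF c m] by (simp add: c_def)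
    finally show "distr_of (\<lambda>x. f x - fourier_series c x) (chr m) = 0" .
  qed
  then show ?thesis unfolding c_def[abs_def, symmetric] by (simp add: fun_eq_iff)
qed

lemma torus_distribution_series_distr:
  fixes c :: "'a::euclidean_space \<Rightarrow> complex"
  assumes "rapid c"
  shows "torus_distribution (series_distr c)"
  unfolding torus_distribution_def
proof (intro conjI ballI allI)
  fix f g :: "'a \<Rightarrow> complex" assume "f \<in> torus_smooth" "g \<in> torus_smooth"
  then have cont: "continuous_on tbox f" "continuous_on tbox g" by (auto intro: torus_smooth_continuous)
  have "distr_of (\<lambda>x. f x + g x) (chr m) = distr_of f (chr m) + distr_of g (chr m)" for m
    unfolding distr_of_def using cont
    by (subst integral_add[symmetric]) (auto intro!: integrable_continuous continuous_intros simp: algebra_simps)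
  then show "series_distr c (\<lambda>x. f x + g x) = series_distr c f + series_distr c g"
    using cont[THEN distr_of_fourier_series(2)[OF assms], THEN abs_summable_summable]
    by (simp add: series_distr_def distrib_left infsum_add)
next
  fix f :: "'a \<Rightarrow> complex" and a assume "f \<in> torus_smooth"
  then show "series_distr c (\<lambda>x. a * f x) = a * series_distr c f"
    by (simp add: series_distr_def distr_of_def mult.assoc mult.left_commute infsum_cmult_right')
next
  let ?S = "\<Sum>\<^sub>\<infinity>m\<in>lattice. norm (c m)"
  \<comment> \<open>A bound by the supremum norm is available, hence order \<open>k = 0\<close>: the
    coefficients are absolutely summable.\<close>
  show "\<exists>C k. \<forall>f\<in>torus_smooth. norm (series_distr c f) \<le> C * Ck_norm k f"
  proof (intro exI[of _ "?S * (2 * pi) ^ DIM('a)"] exI[of _ 0] ballI)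
    fix f :: "'a \<Rightarrow> complex" assume f: "f \<in> torus_smooth"
    have le: "norm (c m * distr_of f (chr m)) \<le> norm (c m) * (Ck_norm 0 f * (2 * pi) ^ DIM('a))" for m
      using norm_distr_of_le[where f = f and g = "chr m" and A = "Ck_norm 0 f" and B = 1, OF torus_smooth_continuous[OF f] continuous_on_chr]
        pderivs_le_Ck_norm[OF f, of "[]" 0]
      by (simp add: norm_mult mult_left_mono)
    note sm = distr_of_fourier_series(2)[OF assms torus_smooth_continuous[OF f]]
    have "norm (series_distr c f) \<le> (\<Sum>\<^sub>\<infinity>m\<in>lattice. norm (c m * distr_of f (chr m)))"
      unfolding series_distr_def by (rule norm_infsum_bound[OF sm])
    also have "\<dots> \<le> (\<Sum>\<^sub>\<infinity>m\<in>lattice. norm (c m) * (Ck_norm 0 f * (2 * pi) ^ DIM('a)))"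
      using le by (intro infsum_mono sm summable_on_cmult_left rapid_summable_norm[OF assms])
    also have "\<dots> = ?S * (2 * pi) ^ DIM('a) * Ck_norm 0 f"
      unfolding infsum_cmult_left' by (simp add: mult_ac)
    finally show "norm (series_distr c f) \<le> ?S * (2 * pi) ^ DIM('a) * Ck_norm 0 f" .
  qed
qed

section \<open>Splitting off the last coordinate\<close>

lemma One_Pair: "(One :: 'a::euclidean_space \<times> 'b::euclidean_space) = (One, One)"
proof (rule euclidean_eqI)
  fix b :: "'a \<times> 'b" assume b: "b \<in> Basis"
  then have "(One, One) \<bullet> b = 1"
    by (auto simp: Basis_prod_def)
  with b show "(One :: 'a \<times> 'b) \<bullet> b = (One, One) \<bullet> b" by simp
qed

lemma tbox_Pair: "(tbox :: ('a::euclidean_space \<times> real) set) = cbox (0, 0) ((2 * pi) *\<^sub>R One, 2 * pi)"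
  by (simp add: One_Pair zero_prod_def)

lemma mem_lattice_Pair: "(t, x) \<in> lattice \<longleftrightarrow> t \<in> lattice \<and> (x :: real) \<in> \<int>"
  by (auto simp: lattice_def Basis_prod_def)

lemma snd_lattice: "m \<in> lattice \<Longrightarrow> of_int \<lfloor>snd m\<rfloor> = (snd m :: real)"
  using mem_lattice_Pair[of "fst m" "snd m"] by (auto elim!: Ints_cases)

lemma mem_lattice_real: "(x :: real) \<in> lattice \<longleftrightarrow> x \<in> \<int>"
  by (simp add: lattice_def)

lemma chr_Pair: "chr m (t, x :: real) = chr (fst m) t * chr (snd m) x"
  by (cases m) (simp add: chr_def algebra_simps exp_add)

lemma exp_eq_chr: "exp (\<i> * of_real x * of_int k) = chr (of_int k) x"
  "exp (- \<i> * of_real x * of_int k) = chr (- of_int k) x"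
  by (simp_all add: chr_def mult_ac)

lemma integral_chr_chr_real:
  assumes "x \<in> \<int>" "y \<in> \<int>"
  shows "integral {0..2 * pi} (\<lambda>t. chr x t * chr y t) = (if y = - x then 2 * of_real pi else 0)"
  using distr_of_chr_chr[of x y] assms by (simp add: distr_of_def mem_lattice_real)

lemma integral_tbox_Pair:
  fixes f :: "'a::euclidean_space \<times> real \<Rightarrow> complex"
  assumes "continuous_on tbox f"
  shows "integral tbox f = integral tbox (\<lambda>t. integral {0..2 * pi} (\<lambda>x. f (t, x)))"
  using integral_prod_continuous[of 0 0 "(2 * pi) *\<^sub>R One" "2 * pi" f] assms
  by (simp add: tbox_Pair)

text \<open>The test function at which \<open>u\<close> is evaluated when
  \<open>distr_fourier_coeff\<close> and \<open>tensor_exp\<close> are composed. It is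
  \<open>2 * pi\<close> times the component of \<phi> with frequency \<open>- \<xi>\<close> in
  x.\<close>

definition x_mode :: "int \<Rightarrow> ((real^'n) \<times> real \<Rightarrow> complex) \<Rightarrow> (real^'n) \<times> real \<Rightarrow> complex" where
  "x_mode \<xi> \<phi> = (\<lambda>(t, x). chr (- of_int \<xi>) x * integral {0..2 * pi} (\<lambda>y. chr (of_int \<xi>) y * \<phi> (t, y)))"

lemma tensor_exp_distr_fourier_coeff:
  "tensor_exp (distr_fourier_coeff u \<xi>) \<xi> \<phi> = 1 / (2 * of_real pi) * u (x_mode \<xi> \<phi>)"
  unfolding tensor_exp_def distr_fourier_coeff_def x_mode_def exp_eq_chr ..

lemma continuous_on_x_integral:
  fixes \<phi> :: "(real^'n::finite) \<times> real \<Rightarrow> complex"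
  assumes "continuous_on UNIV \<phi>"
  shows "continuous_on S (\<lambda>t. integral {0..2 * pi} (\<lambda>y. chr k y * \<phi> (t, y)))"
proof -
  have "continuous_on UNIV (\<lambda>t. integral (cbox 0 (2 * pi)) (\<lambda>y. chr k y * \<phi> (t, y)))"
    by (rule integral_continuous_on_param)
       (auto simp: split_beta intro!: continuous_intros continuous_on_compose2[OF continuous_on_chr]
         continuous_on_compose2[OF assms])
  then show ?thesis using continuous_on_subset by force
qed

lemma continuous_on_x_mode:
  assumes "continuous_on UNIV (\<phi> :: (real^'n::finite) \<times> real \<Rightarrow> complex)"
  shows "continuous_on S (x_mode \<xi> \<phi>)"
  unfolding x_mode_def split_beta
  by (intro continuous_intros continuous_on_compose2[OF continuous_on_chr[of UNIV]]
      continuous_on_compose2[OF continuous_on_x_integral[OF assms, of UNIV]]) auto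

text \<open>By Fubini the x-integral separates and orthogonality on the circle selects one
  frequency. The sign agrees with the pairing: \<open>chr m\<close> sees the mode
  \<open>- m\<close>.\<close>

lemma distr_of_x_mode:
  fixes \<phi> :: "(real^'n::finite) \<times> real \<Rightarrow> complex"
  assumes \<phi>: "continuous_on UNIV \<phi>" and m: "m \<in> lattice"
  shows "distr_of (x_mode \<xi> \<phi>) (chr m) = (if snd m = of_int \<xi> then 2 * of_real pi * distr_of \<phi> (chr m) else 0)"
proof -
  have sm: "snd m \<in> \<int>" using m mem_lattice_Pair[of "fst m" "snd m"] by simp
  let ?h = "\<lambda>t. integral {0..2 * pi} (\<lambda>y. chr (of_int \<xi>) y * \<phi> (t, y))"
  have "distr_of (x_mode \<xi> \<phi>) (chr m)
      = integral tbox (\<lambda>t. integral {0..2 * pi} (\<lambda>x. x_mode \<xi> \<phi> (t, x) * chr m (t, x)))"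
    unfolding distr_of_def
    by (rule integral_tbox_Pair) (intro continuous_intros continuous_on_x_mode[OF \<phi>])
  also have "\<dots> = integral tbox (\<lambda>t. ?h t * chr (fst m) t *
      integral {0..2 * pi} (\<lambda>x. chr (- of_int \<xi>) x * chr (snd m) x))"
  proof (rule arg_cong[where f = "integral tbox"], rule ext)
    fix t
    have "integral {0..2 * pi} (\<lambda>x. x_mode \<xi> \<phi> (t, x) * chr m (t, x)) =
        integral {0..2 * pi} (\<lambda>x. (?h t * chr (fst m) t) * (chr (- of_int \<xi>) x * chr (snd m) x))"
      by (simp only: x_mode_def chr_Pair case_prod_conv mult_ac)
    then show "integral {0..2 * pi} (\<lambda>x. x_mode \<xi> \<phi> (t, x) * chr m (t, x)) =
        ?h t * chr (fst m) t * integral {0..2 * pi} (\<lambda>x. chr (- of_int \<xi>) x * chr (snd m) x)"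
      by simp
  qed
  also have "\<dots> = (if snd m = of_int \<xi> then 2 * of_real pi * integral tbox (\<lambda>t. ?h t * chr (fst m) t) else 0)"
    using sm by (simp add: integral_chr_chr_real)
  also have "\<dots> = (if snd m = of_int \<xi> then 2 * of_real pi * distr_of \<phi> (chr m) else 0)"
  proof (rule if_cong[OF refl _ refl])
    assume "snd m = of_int \<xi>"
    have "distr_of \<phi> (chr m) = integral tbox (\<lambda>t. integral {0..2 * pi} (\<lambda>x. \<phi> (t, x) * chr m (t, x)))"
      unfolding distr_of_def
      by (rule integral_tbox_Pair) (intro continuous_intros continuous_on_subset[OF \<phi>] subset_UNIV)
    also have "\<dots> = integral tbox (\<lambda>t. integral {0..2 * pi} (\<lambda>x. chr (fst m) t * (chr (of_int \<xi>) x * \<phi> (t, x))))"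
      by (simp only: chr_Pair \<open>snd m = of_int \<xi>\<close> mult_ac)
    also have "\<dots> = integral tbox (\<lambda>t. ?h t * chr (fst m) t)"
      by (simp add: mult.commute)
    finally show "2 * of_real pi * integral tbox (\<lambda>t. ?h t * chr (fst m) t) = 2 * of_real pi * distr_of \<phi> (chr m)"
      by simp
  qed
  finally show ?thesis .
qed

section \<open>The operators on Fourier series and on characters\<close>

text \<open>The value at the frequency \<open>m\<close> of the symbol of \<open>L\<^sub>j\<close>.\<close>

definition total_symbol :: "('n::finite \<Rightarrow> int \<Rightarrow> complex) \<Rightarrow> 'n \<Rightarrow> (real^'n) \<times> real \<Rightarrow> complex" where
  "total_symbol s j m = of_real (fst m $ j) + s j \<lfloor>snd m\<rfloor>"

definition poly_growth :: "(int \<Rightarrow> complex) \<Rightarrow> bool" where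
  "poly_growth \<sigma> \<longleftrightarrow> (\<exists>C N. \<forall>\<xi>. norm (\<sigma> \<xi>) \<le> C * (1 + \<bar>real_of_int \<xi>\<bar>) ^ N)"

lemma norm_snd_le_Pair: "\<bar>snd m\<bar> \<le> norm (m :: 'a::real_normed_vector \<times> real)"
  by (cases m) (simp add: norm_Pair real_le_rsqrt)

lemma poly_growth_lattice:
  assumes "poly_growth \<sigma>"
  obtains B N where "0 \<le> B" "\<And>m. m \<in> lattice \<Longrightarrow> norm (\<sigma> \<lfloor>snd m\<rfloor>) \<le> B * (1 + norm (m :: 'a::euclidean_space \<times> real)) ^ N"
proof -
  obtain C N where C: "\<And>\<xi>. norm (\<sigma> \<xi>) \<le> C * (1 + \<bar>real_of_int \<xi>\<bar>) ^ N"
    using assms unfolding poly_growth_def by blast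
  have "0 \<le> C" using order_trans[OF norm_ge_zero C[of 0]] by simp
  have "norm (\<sigma> \<lfloor>snd m\<rfloor>) \<le> C * (1 + norm m) ^ N" if "m \<in> lattice" for m :: "'a \<times> real"
  proof -
    have "norm (\<sigma> \<lfloor>snd m\<rfloor>) \<le> C * (1 + \<bar>snd m\<bar>) ^ N"
      using C[of "\<lfloor>snd m\<rfloor>"] snd_lattice[OF that] by simp
    also have "\<dots> \<le> C * (1 + norm m) ^ N"
      using \<open>0 \<le> C\<close> norm_snd_le_Pair[of m] by (intro mult_left_mono power_mono) auto
    finally show ?thesis .
  qed
  with \<open>0 \<le> C\<close> that show ?thesis by blast
qed

section \<open>The operators on Fourier series\<close>

lemma rapid_symbol:
  assumes "poly_growth \<sigma>" "rapid c"
  shows "rapid (\<lambda>m :: 'a::euclidean_space \<times> real. \<sigma> \<lfloor>snd m\<rfloor> * c m)"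
proof -
  obtain B N where "\<And>m. m \<in> lattice \<Longrightarrow> norm (\<sigma> \<lfloor>snd m\<rfloor>) \<le> B * (1 + norm (m :: 'a \<times> real)) ^ N"
    using poly_growth_lattice[OF assms(1)] by blast
  then show ?thesis
    by (intro rapid_bounded_by[OF assms(2), of _ B N]) (simp add: norm_mult mult_right_mono)
qed

text \<open>The summand for \<xi> collects the frequencies \<open>m\<close> with
  \<open>snd m = of_int \<xi>\<close>, on which the symbol is constant. Absolute summability lets
  the lattice be summed fibre by fibre.\<close>

lemma multiplier_series_distr:
  fixes \<phi> :: "(real^'n::finite) \<times> real \<Rightarrow> complex"
  assumes c: "rapid c" and \<sigma>: "poly_growth \<sigma>" and \<phi>: "continuous_on UNIV \<phi>"
  shows "multiplier \<sigma> (series_distr c) \<phi> = series_distr (\<lambda>m. \<sigma> \<lfloor>snd m\<rfloor> * c m) \<phi>"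
proof -
  let ?A = "\<lambda>m. distr_of \<phi> (chr m)"
  let ?fib = "\<lambda>\<xi>::int. {m \<in> lattice :: ((real^'n) \<times> real) set. snd m = of_int \<xi>}"
  have "tensor_exp (distr_fourier_coeff (series_distr c) \<xi>) \<xi> \<phi> = (\<Sum>\<^sub>\<infinity>m\<in>?fib \<xi>. c m * ?A m)" for \<xi>
  proof -
    have "series_distr c (x_mode \<xi> \<phi>) = (\<Sum>\<^sub>\<infinity>m\<in>?fib \<xi>. 2 * of_real pi * (c m * ?A m))"
      unfolding series_distr_def
      by (rule infsum_cong_neutral) (auto simp: distr_of_x_mode[OF \<phi>])
    then show ?thesis
      unfolding tensor_exp_distr_fourier_coeff by (simp add: infsum_cmult_right')
  qed
  then have "multiplier \<sigma> (series_distr c) \<phi> = (\<Sum>\<^sub>\<infinity>\<xi>. \<Sum>\<^sub>\<infinity>m\<in>?fib \<xi>. \<sigma> \<xi> * (c m * ?A m))"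
    unfolding multiplier_def by (simp add: infsum_cmult_right')
  also have "\<dots> = (\<Sum>\<^sub>\<infinity>\<xi>. \<Sum>\<^sub>\<infinity>m\<in>?fib \<xi>. (\<sigma> \<lfloor>snd m\<rfloor> * c m) * ?A m)"
    by (intro infsum_cong) (simp add: mult_ac)
  also have "\<dots> = (\<Sum>\<^sub>\<infinity>(\<xi>, m)\<in>Sigma UNIV ?fib. (\<sigma> \<lfloor>snd m\<rfloor> * c m) * ?A m)"
  proof (rule infsum_Sigma'_banach)
    have bij: "bij_betw snd (Sigma UNIV ?fib) (lattice :: ((real^'n) \<times> real) set)"
      by (rule bij_betw_byWitness[where f' = "\<lambda>m. (\<lfloor>snd m\<rfloor>, m)"])
         (auto simp: mem_lattice_Pair elim!: Ints_cases)
    have "(\<lambda>m. (\<sigma> \<lfloor>snd m\<rfloor> * c m) * ?A m) summable_on lattice"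
      using distr_of_fourier_series(2)[OF rapid_symbol[OF \<sigma> c] continuous_on_subset[OF \<phi> subset_UNIV]]
      by (rule abs_summable_summable)
    then show "(\<lambda>(\<xi>, m). (\<sigma> \<lfloor>snd m\<rfloor> * c m) * ?A m) summable_on Sigma UNIV ?fib"
      using summable_on_reindex_bij_betw[OF bij, of "\<lambda>m. (\<sigma> \<lfloor>snd m\<rfloor> * c m) * ?A m"]
      by (simp add: case_prod_unfold)
  qed
  also have "\<dots> = (\<Sum>\<^sub>\<infinity>p\<in>Sigma UNIV ?fib. (\<sigma> \<lfloor>snd (snd p)\<rfloor> * c (snd p)) * ?A (snd p))"
    by (simp add: case_prod_unfold)
  also have "\<dots> = series_distr (\<lambda>m. \<sigma> \<lfloor>snd m\<rfloor> * c m) \<phi>"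
    unfolding series_distr_def
    by (rule infsum_reindex_bij_betw[of snd "Sigma UNIV ?fib" lattice "\<lambda>m. (\<sigma> \<lfloor>snd m\<rfloor> * c m) * ?A m"],
        rule bij_betw_byWitness[where f' = "\<lambda>m. (\<lfloor>snd m\<rfloor>, m)"]) (auto simp: mem_lattice_Pair elim!: Ints_cases)
  finally show ?thesis .
qed

lemma axis_Basis_Pair: "(axis j 1, 0) \<in> (Basis :: ((real^'n) \<times> real) set)"
  by (auto simp: Basis_prod_def axis_in_Basis_iff)

lemma inner_axis_Pair: "m \<bullet> (axis j 1, 0 :: real) = fst m $ j"
  by (cases m) (simp add: inner_axis)

lemma series_distr_add:
  assumes "rapid c" "rapid d" "continuous_on tbox \<phi>"
  shows "series_distr (\<lambda>m. c m + d m) \<phi> = series_distr c \<phi> + series_distr d \<phi>"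
  using infsum_add[OF abs_summable_summable[OF distr_of_fourier_series(2)[OF assms(1,3)]]
      abs_summable_summable[OF distr_of_fourier_series(2)[OF assms(2,3)]]]
  by (simp add: series_distr_def distrib_right)

lemma L_op_series_distr:
  fixes \<phi> :: "(real^'n::finite) \<times> real \<Rightarrow> complex"
  assumes c: "rapid c" and s: "poly_growth (s j)" and \<phi>: "\<phi> \<in> torus_smooth"
  shows "L_op s j (series_distr c) \<phi> = series_distr (\<lambda>m. total_symbol s j m * c m) \<phi>"
proof -
  let ?e = "(axis j 1, 0) :: (real^'n) \<times> real"
  have "series_distr c (pderiv_dir ?e \<phi>) = (\<Sum>\<^sub>\<infinity>m\<in>lattice. - 1 * (\<i> * of_real (m \<bullet> ?e) * c m * distr_of \<phi> (chr m)))"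
    unfolding series_distr_def
    by (rule infsum_cong) (simp add: distr_of_pderiv_dir[OF \<phi> axis_Basis_Pair])
  also have "\<dots> = (\<Sum>\<^sub>\<infinity>m\<in>lattice. - \<i> * (of_real (m \<bullet> ?e) * c m * distr_of \<phi> (chr m)))"
    by (simp add: mult_ac)
  also have "\<dots> = - \<i> * series_distr (\<lambda>m. of_real (m \<bullet> ?e) * c m) \<phi>"
    unfolding series_distr_def by (rule infsum_cmult_right')
  finally have "1 / \<i> * distr_deriv ?e (series_distr c) \<phi> = series_distr (\<lambda>m. of_real (m \<bullet> ?e) * c m) \<phi>"
    by (simp add: distr_deriv_def)
  moreover have "rapid (\<lambda>m. of_real (m \<bullet> ?e) * c m)"
    using rapid_bounded_by[OF rapid_derivative[OF c, of ?e], of "\<lambda>m. of_real (m \<bullet> ?e) * c m" 1 0]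
    by (simp add: norm_mult)
  ultimately show ?thesis
    using series_distr_add[OF _ rapid_symbol[OF s c] torus_smooth_continuous[OF \<phi>],
        of "\<lambda>m. of_real (m \<bullet> ?e) * c m"]
    unfolding L_op_def multiplier_series_distr[OF c s torus_smooth_continuous[OF \<phi>]]
    by (simp add: total_symbol_def inner_axis_Pair distrib_right)
qed

text \<open>The two functionals agree on continuous test functions but need not be equal as total
  functions. So agreement is checked at the arguments \<open>L_op\<close> uses: a derivative of
  \<phi> and the functions \<open>x_mode\<close>.\<close>

lemma L_op_distr_of_fourier_series:
  fixes \<phi> :: "(real^'n::finite) \<times> real \<Rightarrow> complex"
  assumes c: "rapid c" and \<phi>: "\<phi> \<in> torus_smooth"
  shows "L_op s j (distr_of (fourier_series c)) \<phi> = L_op s j (series_distr c) \<phi>"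
proof -
  let ?e = "(axis j 1, 0) :: (real^'n) \<times> real"
  have "continuous_on tbox (pderiv_dir ?e \<phi>)"
    by (intro torus_smooth_continuous torus_smooth_pderiv_dir \<phi> axis_Basis_Pair)
  then show ?thesis
    by (simp add: L_op_def distr_deriv_def multiplier_def tensor_exp_distr_fourier_coeff
        distr_of_fourier_series(1)[OF c]
        distr_of_fourier_series(1)[OF c continuous_on_x_mode[OF torus_smooth_continuous[OF \<phi>]]])
qed

section \<open>The operators on characters\<close>

lemma x_mode_chr:
  fixes m :: "(real^'n::finite) \<times> real"
  assumes "m \<in> lattice"
  shows "x_mode \<xi> (chr m) = (\<lambda>z. (if snd m = - of_int \<xi> then 2 * of_real pi else 0) * chr m z)"
proof -
  have sm: "snd m \<in> \<int>" using assms mem_lattice_Pair[of "fst m" "snd m"] by simp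
  have "x_mode \<xi> (chr m) (t, x) = (if snd m = - of_int \<xi> then 2 * of_real pi else 0) * chr m (t, x)" for t x
  proof -
    have "x_mode \<xi> (chr m) (t, x)
        = chr (- of_int \<xi>) x * chr (fst m) t * integral {0..2 * pi} (\<lambda>y. chr (of_int \<xi>) y * chr (snd m) y)"
      by (simp add: x_mode_def chr_Pair mult_ac flip: integral_mult_right)
    also have "\<dots> = (if snd m = - of_int \<xi> then 2 * of_real pi else 0) * chr m (t, x)"
      using sm by (simp add: integral_chr_chr_real chr_Pair)
    finally show ?thesis .
  qed
  then show ?thesis by auto
qed

text \<open>Differentiation and \<open>x_mode\<close> turn a character into a multiple of itself, so
  homogeneity of \<open>u\<close> is enough. The frequency is \<open>- m\<close> by duality.\<close>

lemma L_op_chr: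
  fixes m :: "(real^'n::finite) \<times> real"
  assumes u: "\<And>f a. f \<in> torus_smooth \<Longrightarrow> u (\<lambda>z. a * f z) = a * u f" and m: "m \<in> lattice"
  shows "L_op s j u (chr m) = total_symbol s j (- m) * u (chr m)"
proof -
  let ?e = "(axis j 1, 0) :: (real^'n) \<times> real"
  note uchr = u[OF torus_smooth_chr[OF m]]
  have "distr_deriv ?e u (chr m) = - \<i> * of_real (fst m $ j) * u (chr m)"
    by (simp add: distr_deriv_def pderiv_dir_chr uchr inner_axis_Pair)
  moreover have "multiplier (s j) u (chr m) = (\<Sum>\<^sub>\<infinity>\<xi>. s j \<xi> * (if snd m = - of_int \<xi> then u (chr m) else 0))"
    unfolding multiplier_def tensor_exp_distr_fourier_coeff x_mode_chr[OF m] uchr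
    by (intro infsum_cong) simp
  moreover have "\<dots> = (\<Sum>\<^sub>\<infinity>\<xi>\<in>{- \<lfloor>snd m\<rfloor>}. s j \<xi> * u (chr m))"
    using snd_lattice[OF m] by (intro infsum_cong_neutral) auto
  moreover have "\<lfloor>- snd m\<rfloor> = - \<lfloor>snd m\<rfloor>"
    using snd_lattice[OF m] by (metis floor_of_int of_int_minus)
  ultimately show ?thesis
    by (simp add: L_op_def total_symbol_def algebra_simps)
qed

text \<open>Used to make the exactness condition trivial for a datum whose frequencies avoid all
  resonant \<xi>.\<close>

lemma fourier_coeff_fourier_series_eq_0:
  fixes c :: "(real^'n::finite) \<times> real \<Rightarrow> complex"
  assumes "rapid c" "\<And>m. m \<in> lattice \<Longrightarrow> snd m = of_int \<xi> \<Longrightarrow> c m = 0"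
  shows "fourier_coeff (fourier_series c) \<xi> t = 0"
proof -
  let ?f = "\<lambda>m x. c m * chr (fst m) t * (chr (- of_int \<xi>) x * chr (snd m) x)"
  have "((\<lambda>m. integral (cbox 0 (2 * pi)) (?f m)) has_sum
      integral (cbox 0 (2 * pi)) (\<lambda>x. \<Sum>\<^sub>\<infinity>m\<in>lattice. ?f m x)) lattice"
    by (rule has_sum_integral_cbox[OF _ _ rapid_summable_norm[OF assms(1)]])
       (auto intro!: continuous_intros simp: norm_mult)
  moreover have "integral (cbox 0 (2 * pi)) (?f m) = 0" if m: "m \<in> lattice" for m
  proof -
    have sm: "snd m \<in> \<int>" using m mem_lattice_Pair[of "fst m" "snd m"] by simp
    then show ?thesis using assms(2)[OF m] by (auto simp: integral_chr_chr_real)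
  qed
  ultimately have "integral {0..2 * pi} (\<lambda>x. \<Sum>\<^sub>\<infinity>m\<in>lattice. ?f m x) = 0"
    by (metis (no_types, lifting) cbox_interval has_sum_0 has_sum_unique)
  moreover have "chr (- of_int \<xi>) x * fourier_series c (t, x) = (\<Sum>\<^sub>\<infinity>m\<in>lattice. ?f m x)" for x
    unfolding fourier_series_def chr_Pair
    by (subst infsum_cmult_right'[symmetric]) (simp add: mult_ac)
  ultimately show ?thesis
    by (simp only: fourier_coeff_def exp_eq_chr) simp
qed

text \<open>Links the exactness condition, stated on partial coefficients over the n-torus, to the
  full modes on the larger torus.\<close>

lemma integral_fourier_coeff_chr:
  fixes f :: "(real^'n::finite) \<times> real \<Rightarrow> complex"
  assumes f: "continuous_on UNIV f"
  shows "integral tbox (\<lambda>t. fourier_coeff f \<xi> t * chr k t) = 1 / (2 * of_real pi) * distr_of f (chr (k, - of_int \<xi>))"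
proof -
  have "distr_of f (chr (k, - of_int \<xi>))
      = integral tbox (\<lambda>t. integral {0..2 * pi} (\<lambda>x. f (t, x) * chr (k, - of_int \<xi>) (t, x)))"
    unfolding distr_of_def
    by (rule integral_tbox_Pair) (intro continuous_intros continuous_on_subset[OF f] subset_UNIV)
  then show ?thesis
    unfolding fourier_coeff_def exp_eq_chr by (simp add: chr_Pair mult_ac flip: integral_mult_right)
qed

section \<open>Exterior multiplication by a covector\<close>

definition shuffle_sign :: "'n::linorder \<Rightarrow> 'n set \<Rightarrow> complex" where
  "shuffle_sign j K = (- 1) ^ card {k\<in>K. k < j}"

definition wedge :: "('n::linorder \<Rightarrow> complex) \<Rightarrow> ('n set \<Rightarrow> complex) \<Rightarrow> 'n set \<Rightarrow> complex" where
  "wedge w u J = (\<Sum>j\<in>J. shuffle_sign j (J - {j}) * (w j * u (J - {j})))"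

lemma shuffle_sign_square [simp]: "shuffle_sign j K * shuffle_sign j K = 1"
  by (simp add: shuffle_sign_def flip: power_mult_distrib)

lemma norm_shuffle_sign [simp]: "norm (shuffle_sign j K) = 1"
  by (simp add: shuffle_sign_def norm_power)

lemma shuffle_sign_insert:
  assumes "finite K" "i \<notin> K"
  shows "shuffle_sign j (insert i K) = (if i < j then - 1 else 1) * shuffle_sign j K"
proof (cases "i < j")
  case True
  then have "{k \<in> insert i K. k < j} = insert i {k \<in> K. k < j}" by auto
  then show ?thesis using assms True by (simp add: shuffle_sign_def)
next
  case False
  then have "{k \<in> insert i K. k < j} = {k \<in> K. k < j}" by auto
  then show ?thesis using False by (simp add: shuffle_sign_def)
qed

lemma shuffle_sign_anticommute:
  assumes "finite K" "i \<notin> K" "j \<notin> K" "i \<noteq> j"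
  shows "shuffle_sign i K * shuffle_sign j (insert i K) = - (shuffle_sign j K * shuffle_sign i (insert j K))"
proof -
  have "i < j \<longleftrightarrow> \<not> j < i" using assms(4) by auto
  then show ?thesis
    by (simp add: shuffle_sign_insert[OF assms(1,2)] shuffle_sign_insert[OF assms(1,3)])
qed

lemma wedge_wedge:
  assumes "finite J"
  shows "wedge w (wedge w u) J = 0"
proof -
  \<comment> \<open>Setting the diagonal to zero lets both indices range over all of
    \<open>J\<close>, so that swapping the sums shows the double sum to be its own negative.\<close>
  define T where "T j i = (if i = j then 0 else shuffle_sign j (J - {j}) * shuffle_sign i (J - {j} - {i})
    * (w j * w i * u (J - {j} - {i})))" for i j
  have anti: "T j i = - T i j" if "i \<in> J" "j \<in> J" for i j
  proof (cases "i = j")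
    case False
    define K where "K = J - {i, j}"
    have K: "finite K" "i \<notin> K" "j \<notin> K" "J - {j} = insert i K" "J - {i} = insert j K"
      "J - {j} - {i} = K" "J - {i} - {j} = K"
      using that False assms by (auto simp: K_def)
    have "T j i = (shuffle_sign i K * shuffle_sign j (insert i K)) * (w j * w i * u K)"
      using False K(2) by (simp add: T_def K(4))
    also have "\<dots> = - (shuffle_sign j K * shuffle_sign i (insert j K)) * (w j * w i * u K)"
      using shuffle_sign_anticommute[OF K(1-3) False] by simp
    also have "\<dots> = - T i j"
      using False K(3) by (simp add: T_def K(5))
    finally show ?thesis .
  qed (simp add: T_def)
  have "wedge w (wedge w u) J = (\<Sum>j\<in>J. \<Sum>i\<in>J. T j i)"
    unfolding wedge_def
  proof (rule sum.cong[OF refl])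
    fix j assume "j \<in> J"
    have "(\<Sum>i\<in>J. T j i) = (\<Sum>i\<in>J - {j}. T j i)"
      by (rule sum.mono_neutral_right) (auto simp: T_def assms)
    also have "\<dots> = shuffle_sign j (J - {j}) * (w j *
        (\<Sum>i\<in>J - {j}. shuffle_sign i (J - {j} - {i}) * (w i * u (J - {j} - {i}))))"
      unfolding sum_distrib_left by (rule sum.cong) (auto simp: T_def mult_ac)
    finally show "shuffle_sign j (J - {j}) * (w j *
        (\<Sum>i\<in>J - {j}. shuffle_sign i (J - {j} - {i}) * (w i * u (J - {j} - {i})))) = (\<Sum>i\<in>J. T j i)"
      by simp
  qed
  moreover have "(\<Sum>j\<in>J. \<Sum>i\<in>J. T j i) = - (\<Sum>j\<in>J. \<Sum>i\<in>J. T j i)"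
  proof -
    have "(\<Sum>j\<in>J. \<Sum>i\<in>J. T j i) = (\<Sum>i\<in>J. \<Sum>j\<in>J. T j i)" by (rule sum.swap)
    also have "\<dots> = - (\<Sum>i\<in>J. \<Sum>j\<in>J. T i j)"
      unfolding sum_negf[symmetric] by (intro sum.cong refl anti)
    finally show ?thesis .
  qed
  ultimately show ?thesis by simp
qed

text \<open>Contraction with the \<open>j\<close>-th coordinate vector, divided by \<open>w j\<close>, inverts exterior
  multiplication by \<open>w\<close> on its kernel.\<close>

lemma wedge_contraction:
  fixes F :: "'n::linorder set \<Rightarrow> complex"
  assumes J: "finite J" and wj: "w j \<noteq> 0"
    and closed: "j \<notin> J \<Longrightarrow> wedge w F (insert j J) = 0"
  shows "wedge w (\<lambda>K. if j \<in> K then 0 else shuffle_sign j K * F (insert j K) / w j) J = F J"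
    (is "wedge w ?u J = _")
proof (cases "j \<in> J")
  case True
  have "wedge w ?u J = (\<Sum>i\<in>{j}. shuffle_sign i (J - {i}) * (w i * ?u (J - {i})))"
    unfolding wedge_def using True J by (intro sum.mono_neutral_right) auto
  also have "\<dots> = (shuffle_sign j (J - {j}) * shuffle_sign j (J - {j})) * F J"
    using True wj by (simp add: insert_absorb)
  finally show ?thesis by simp
next
  case False
  \<comment> \<open>Closedness at \<open>insert j J\<close> contains \<open>F J\<close> in its term
    of index \<open>j\<close>; solving for that term expresses \<open>F J\<close> by the
    coefficients that enter the contraction.\<close>
  have "wedge w F (insert j J) = shuffle_sign j J * (w j * F J) +
      (\<Sum>i\<in>J. shuffle_sign i (insert j J - {i}) * (w i * F (insert j J - {i})))"
    unfolding wedge_def using False J by simp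
  then have "shuffle_sign j J * (w j * F J) =
      - (\<Sum>i\<in>J. shuffle_sign i (insert j J - {i}) * (w i * F (insert j J - {i})))"
    using closed[OF False] by (simp add: eq_neg_iff_add_eq_0)
  moreover have "w j * F J = shuffle_sign j J * (shuffle_sign j J * (w j * F J))"
    by (simp flip: mult.assoc)
  ultimately have "w j * F J = (\<Sum>i\<in>J. - (shuffle_sign j J * shuffle_sign i (insert j J - {i})) * (w i * F (insert j J - {i})))"
    by (simp add: sum_distrib_left sum_negf mult.assoc)
  also have "\<dots> = (\<Sum>i\<in>J. w j * (shuffle_sign i (J - {i}) * (w i * ?u (J - {i}))))"
  proof (rule sum.cong[OF refl])
    fix i assume i: "i \<in> J"
    define K where "K = J - {i}"
    have K: "finite K" "i \<notin> K" "j \<notin> K" "i \<noteq> j" "J = insert i K" "insert j J - {i} = insert j K"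
      using i False J by (auto simp: K_def)
    have "- (shuffle_sign j (insert i K) * shuffle_sign i (insert j K)) = shuffle_sign i K * shuffle_sign j K"
    proof -
      have "i < j \<longleftrightarrow> \<not> j < i" using K(4) by auto
      then show ?thesis
        by (simp add: shuffle_sign_insert[OF K(1,2)] shuffle_sign_insert[OF K(1,3)])
    qed
    then show "- (shuffle_sign j J * shuffle_sign i (insert j J - {i})) * (w i * F (insert j J - {i}))
        = w j * (shuffle_sign i (J - {i}) * (w i * ?u (J - {i})))"
      unfolding K_def[symmetric] K(6) using K(3,5) wj by (simp add: mult_ac)
  qed
  also have "\<dots> = w j * wedge w ?u J"
    by (simp add: wedge_def sum_distrib_left)
  finally show ?thesis using wj by simp
qed

text \<open>For given \<open>j\<close> and \<open>J\<close> the only multi-index that contributes is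
  \<open>J - {j}\<close>.\<close>

lemma sum_wedge_coeff:
  fixes J :: "'n::{finite,linorder} set"
  shows "(\<Sum>j\<in>UNIV. \<Sum>K | card K = p. wedge_coeff j K J * g j K) =
    (if card J = p + 1 then \<Sum>j\<in>J. shuffle_sign j (J - {j}) * g j (J - {j}) else 0)"
proof -
  have "(\<Sum>K | card K = p. wedge_coeff j K J * g j K) =
      (if j \<in> J \<and> card J = p + 1 then shuffle_sign j (J - {j}) * g j (J - {j}) else 0)" for j
  proof (cases "j \<in> J \<and> card J = p + 1")
    case True
    then have "(\<Sum>K | card K = p. wedge_coeff j K J * g j K) = (\<Sum>K\<in>{J - {j}}. wedge_coeff j K J * g j K)"
      by (intro sum.mono_neutral_right) (auto simp: wedge_coeff_def)
    moreover have "wedge_coeff j (J - {j}) J = shuffle_sign j (J - {j})"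
      using True by (auto simp: wedge_coeff_def shuffle_sign_def)
    ultimately show ?thesis using True by simp
  next
    case False
    then have "wedge_coeff j K J = 0" if "card K = p" for K
      using that by (auto simp: wedge_coeff_def)
    then show ?thesis using False by auto
  qed
  then have "(\<Sum>j\<in>UNIV. \<Sum>K | card K = p. wedge_coeff j K J * g j K) =
      (\<Sum>j\<in>UNIV. if j \<in> J \<and> card J = p + 1 then shuffle_sign j (J - {j}) * g j (J - {j}) else 0)"
    by simp
  also have "\<dots> = (if card J = p + 1 then \<Sum>j\<in>J. shuffle_sign j (J - {j}) * g j (J - {j}) else 0)"
    by (cases "card J = p + 1") (simp_all flip: sum.inter_restrict)
  finally show ?thesis .
qed

section \<open>The operator on forms as exterior multiplication by the symbol\<close>

lemma LL_eq:
  "LL s p u J \<phi> = (if card J = p + 1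
    then \<Sum>j\<in>J. shuffle_sign j (J - {j}) * (\<i> * L_op s j (u (J - {j})) \<phi>) else 0)"
  unfolding LL_def by (rule sum_wedge_coeff)

lemma LL_chr:
  assumes "\<And>K f a. f \<in> torus_smooth \<Longrightarrow> u K (\<lambda>z. a * f z) = a * u K f" "m \<in> lattice" "card J = p + 1"
  shows "LL s p u J (chr m) = \<i> * wedge (\<lambda>j. total_symbol s j (- m)) (\<lambda>K. u K (chr m)) J"
  using assms by (simp add: LL_eq wedge_def L_op_chr[of "u _"] sum_distrib_left mult_ac)

lemma rapid_zero: "rapid (\<lambda>m. 0)"
  by (rule rapidI) auto

lemma series_distr_cmult: "series_distr (\<lambda>m. a * c m) \<phi> = a * series_distr c \<phi>"
  by (simp add: series_distr_def mult.assoc infsum_cmult_right')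

lemma rapid_cmult: "rapid c \<Longrightarrow> rapid (\<lambda>m. a * c m)"
  using rapid_bounded_by[of c "\<lambda>m. a * c m" "norm a" 0] by (simp add: norm_mult)

lemma rapid_add:
  assumes "rapid c" "rapid d"
  shows "rapid (\<lambda>m. c m + d m)"
proof (rule rapidI)
  fix k
  obtain C D where "\<forall>m\<in>lattice. norm (c m) * (1 + norm m) ^ k \<le> C"
    "\<forall>m\<in>lattice. norm (d m) * (1 + norm m) ^ k \<le> D"
    using assms unfolding rapid_def by metis
  moreover have "norm (c m + d m) * (1 + norm m) ^ k \<le> norm (c m) * (1 + norm m) ^ k + norm (d m) * (1 + norm m) ^ k" for m
    using norm_triangle_ineq[of "c m" "d m"] by (simp add: mult_right_mono flip: distrib_right)
  ultimately have "norm (c m + d m) * (1 + norm m) ^ k \<le> C + D" if "m \<in> lattice" for m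
    using that by (meson add_mono order_trans)
  then show "\<exists>C. \<forall>m\<in>lattice. norm (c m + d m) * (1 + norm m) ^ k \<le> C" by blast
qed

lemma rapid_sum: "finite A \<Longrightarrow> (\<And>a. a \<in> A \<Longrightarrow> rapid (c a)) \<Longrightarrow> rapid (\<lambda>m. \<Sum>a\<in>A. c a m)"
  by (induction A rule: finite_induct) (simp_all add: rapid_zero rapid_add)

lemma series_distr_sum:
  assumes "finite A" "\<And>a. a \<in> A \<Longrightarrow> rapid (c a)" "continuous_on tbox \<phi>"
  shows "series_distr (\<lambda>m. \<Sum>a\<in>A. c a m) \<phi> = (\<Sum>a\<in>A. series_distr (c a) \<phi>)"
  using assms(1,2)
proof (induction A rule: finite_induct)
  case (insert a A)
  then have "series_distr (\<lambda>m. c a m + (\<Sum>a\<in>A. c a m)) \<phi>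
      = series_distr (c a) \<phi> + series_distr (\<lambda>m. \<Sum>a\<in>A. c a m) \<phi>"
    by (intro series_distr_add rapid_sum assms(3)) auto
  with insert show ?case by simp
qed (simp add: series_distr_def)

lemma rapid_norm: "rapid c \<Longrightarrow> rapid (\<lambda>m. of_real (norm (c m)))"
  using rapid_bounded_by[of c "\<lambda>m. of_real (norm (c m))" 1 0] by simp

lemma rapid_total_symbol:
  assumes c: "rapid c" and s: "poly_growth (s j)"
  shows "rapid (\<lambda>m. total_symbol s j m * c m)"
proof -
  let ?e = "(axis j 1, 0) :: (real^'a) \<times> real"
  have "rapid (\<lambda>m. of_real (m \<bullet> ?e) * c m)"
    using rapid_cmult[OF rapid_derivative[OF c, of ?e], of "- \<i>"] by (simp add: mult.assoc[symmetric])
  from rapid_add[OF this rapid_symbol[OF s c]] show ?thesis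
    by (simp add: total_symbol_def inner_axis_Pair distrib_right)
qed

text \<open>The hypothesis on \<open>u\<close> asks for agreement with \<open>series_distr\<close>
  only under \<open>L_op\<close>, so the lemma serves both series distributions and the
  distributions of smooth Fourier series.\<close>

lemma LL_series_distr:
  fixes \<phi> :: "(real, 'n::{finite,linorder}) vec \<times> real \<Rightarrow> complex"
  assumes c: "\<And>K. rapid (c K)" and s: "\<And>j. poly_growth (s j)" and \<phi>: "\<phi> \<in> torus_smooth"
    and J: "card J = p + 1" and u: "\<And>j K. card K = p \<Longrightarrow> L_op s j (u K) \<phi> = L_op s j (series_distr (c K)) \<phi>"
  shows "LL s p u J \<phi> = series_distr (\<lambda>m. \<i> * wedge (\<lambda>j. total_symbol s j m) (\<lambda>K. c K m) J) \<phi>"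
proof -
  have "LL s p u J \<phi> = (\<Sum>j\<in>J. shuffle_sign j (J - {j}) * (\<i> * L_op s j (series_distr (c (J - {j}))) \<phi>))"
    using J u by (simp add: LL_eq)
  also have "\<dots> = \<i> * (\<Sum>j\<in>J. shuffle_sign j (J - {j}) * series_distr (\<lambda>m. total_symbol s j m * c (J - {j}) m) \<phi>)"
    by (simp add: L_op_series_distr[OF c s \<phi>] sum_distrib_left mult_ac)
  also have "\<dots> = \<i> * (\<Sum>j\<in>J. series_distr (\<lambda>m. shuffle_sign j (J - {j}) * (total_symbol s j m * c (J - {j}) m)) \<phi>)"
    by (simp only: series_distr_cmult)
  also have "\<dots> = \<i> * series_distr (\<lambda>m. wedge (\<lambda>j. total_symbol s j m) (\<lambda>K. c K m) J) \<phi>"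
    unfolding wedge_def
    by (subst series_distr_sum)
       (simp_all add: rapid_cmult rapid_total_symbol c s torus_smooth_continuous[OF \<phi>])
  finally show ?thesis by (simp only: series_distr_cmult)
qed

section \<open>Integral forms with constant coefficients\<close>

lemma c_form_singleton [simp]: "c_form s \<xi> {j} t = s j \<xi>"
  by (simp add: c_form_def)

lemma torus_point_eqI:
  assumes "\<And>j. \<exists>k::int. y $ j = z $ j + 2 * pi * of_int k"
  shows "torus_point y = torus_point z"
proof -
  obtain k :: "'a \<Rightarrow> int" where k: "\<And>j. y $ j = z $ j + 2 * pi * of_int (k j)"
    using assms by metis
  have "(\<exists>i::int. x = y $ j + 2 * pi * of_int i) \<longleftrightarrow> (\<exists>i::int. x = z $ j + 2 * pi * of_int i)" for x j
  proof
    assume "\<exists>i::int. x = y $ j + 2 * pi * of_int i"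
    then obtain i :: int where "x = y $ j + 2 * pi * of_int i" ..
    then have "x = z $ j + 2 * pi * of_int (k j + i)" by (simp add: k algebra_simps)
    then show "\<exists>i::int. x = z $ j + 2 * pi * of_int i" ..
  next
    assume "\<exists>i::int. x = z $ j + 2 * pi * of_int i"
    then obtain i :: int where "x = z $ j + 2 * pi * of_int i" ..
    then have "x = y $ j + 2 * pi * of_int (i - k j)" by (simp add: k algebra_simps)
    then show "\<exists>i::int. x = y $ j + 2 * pi * of_int i" ..
  qed
  then show ?thesis by (simp add: torus_point_def)
qed

lemma torus_point_self: "y \<in> torus_point y"
  unfolding torus_point_def by (auto intro: exI[of _ "0::int"])

text \<open>Test integrality on the loop that runs once around the \<open>j\<close>-th circle; its
  integral is \<open>2 * pi\<close> times the coefficient.\<close>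

lemma integral_form_imp_Ints:
  fixes s :: "'n::finite \<Rightarrow> int \<Rightarrow> complex"
  assumes "integral_form (c_form s \<xi>)"
  shows "s j \<xi> \<in> \<int>"
proof -
  define \<gamma> where "\<gamma> \<tau> = (2 * pi * \<tau>) *\<^sub>R (axis j 1 :: real^'n)" for \<tau> :: real
  have d: "(\<gamma> has_vector_derivative (2 * pi) *\<^sub>R axis j 1) (at \<tau>)" for \<tau>
    unfolding \<gamma>_def by (auto intro!: derivative_eq_intros)
  have "\<gamma> C1_differentiable_on {0..1}"
    unfolding C1_differentiable_on_def using d by (intro exI[of _ "\<lambda>_. (2 * pi) *\<^sub>R axis j 1"]) auto
  then have "\<gamma> piecewise_C1_differentiable_on {0..1}"
    by (rule C1_differentiable_imp_piecewise)
  moreover have "torus_point (\<gamma> 1) = torus_point (\<gamma> 0)"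
  proof (rule torus_point_eqI)
    fix i
    show "\<exists>k::int. \<gamma> 1 $ i = \<gamma> 0 $ i + 2 * pi * of_int k"
      by (intro exI[of _ "if i = j then 1 else 0"]) (simp add: \<gamma>_def axis_def)
  qed
  ultimately have "torus_1cycle (frag_of \<gamma>)"
    by (simp add: torus_1cycle_def)
  with assms have "1 / (2 * of_real pi) * chain_integral (c_form s \<xi>) (frag_of \<gamma>) \<in> \<int>"
    unfolding integral_form_def by blast
  moreover have "path_integral (c_form s \<xi>) \<gamma> = 2 * of_real pi * s j \<xi>"
  proof -
    have "vector_derivative \<gamma> (at \<tau>) = (2 * pi) *\<^sub>R axis j 1" for \<tau>
      by (rule vector_derivative_at[OF d])
    moreover have "(\<Sum>i\<in>UNIV. s i \<xi> * of_real (2 * pi * axis j 1 $ i)) = (\<Sum>i\<in>{j}. s i \<xi> * of_real (2 * pi))"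
      by (intro sum.mono_neutral_cong_right) (auto simp: axis_def)
    ultimately show ?thesis by (simp add: path_integral_def mult_ac)
  qed
  then have "chain_integral (c_form s \<xi>) (frag_of \<gamma>) = 2 * of_real pi * s j \<xi>"
    by (simp add: chain_integral_def)
  ultimately show ?thesis by simp
qed

lemma path_integral_c_form:
  fixes s :: "'n::finite \<Rightarrow> int \<Rightarrow> complex"
  assumes "\<gamma> piecewise_C1_differentiable_on {0..1}"
  shows "path_integral (c_form s \<xi>) \<gamma> = (\<Sum>j\<in>UNIV. s j \<xi> * of_real (\<gamma> 1 $ j - \<gamma> 0 $ j))"
proof -
  obtain S where S: "continuous_on {0..1} \<gamma>" "finite S" "\<gamma> C1_differentiable_on ({0..1} - S)"
    using assms unfolding piecewise_C1_differentiable_on_def by blast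
  have "((\<lambda>\<tau>. vector_derivative \<gamma> (at \<tau>)) has_integral \<gamma> 1 - \<gamma> 0) {0..1}"
  proof (rule fundamental_theorem_of_calculus_strong[OF S(2)])
    fix \<tau> assume "\<tau> \<in> {0..1} - S"
    then show "(\<gamma> has_vector_derivative vector_derivative \<gamma> (at \<tau>)) (at \<tau>)"
      using S(3) by (auto simp: C1_differentiable_on_eq vector_derivative_works)
  qed (use S in auto)
  moreover have "bounded_linear (\<lambda>h::real^'n. \<Sum>j\<in>UNIV. s j \<xi> * of_real (h $ j))"
    by (intro bounded_linear_sum bounded_linear_const_mult bounded_linear_compose[OF bounded_linear_of_real]
        bounded_linear_vec_nth)
  ultimately have "((\<lambda>\<tau>. \<Sum>j\<in>UNIV. s j \<xi> * of_real (vector_derivative \<gamma> (at \<tau>) $ j)) has_integral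
      (\<Sum>j\<in>UNIV. s j \<xi> * of_real ((\<gamma> 1 - \<gamma> 0) $ j))) {0..1}"
    using has_integral_linear[of "\<lambda>\<tau>. vector_derivative \<gamma> (at \<tau>)"] unfolding o_def by blast
  then show ?thesis by (simp add: path_integral_def integral_unique)
qed

lemma lookup_frag_extend:
  "Poly_Mapping.lookup (frag_extend b \<sigma>) P =
    (\<Sum>\<gamma>\<in>Poly_Mapping.keys \<sigma>. Poly_Mapping.lookup \<sigma> \<gamma> * Poly_Mapping.lookup (b \<gamma>) P)"
  by (simp add: frag_extend_def lookup_sum)

text \<open>Regroup the sum by end points: each value of \<open>R\<close> is multiplied by the
  coefficient of its point in the boundary, which is zero.\<close>

lemma cycle_sum_eq_0:
  fixes R :: "(real^'n) set \<Rightarrow> real"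
  assumes "torus_1cycle \<sigma>"
  shows "(\<Sum>\<gamma>\<in>Poly_Mapping.keys \<sigma>. of_int (Poly_Mapping.lookup \<sigma> \<gamma>) *
    (R (torus_point (\<gamma> 1)) - R (torus_point (\<gamma> 0)))) = 0"
proof -
  let ?P = "\<lambda>(\<gamma> :: real \<Rightarrow> real^'n) \<tau>. torus_point (\<gamma> \<tau>)"
  let ?K = "Poly_Mapping.keys \<sigma>"
  let ?n = "\<lambda>\<gamma>. real_of_int (Poly_Mapping.lookup \<sigma> \<gamma>)"
  define A where "A = (\<lambda>\<gamma>. ?P \<gamma> 1) ` ?K \<union> (\<lambda>\<gamma>. ?P \<gamma> 0) ` ?K"
  have A: "finite A" by (simp add: A_def)
  have ind: "(\<Sum>Q\<in>A. (if Q = Q0 then 1 else 0) * R Q) = R Q0" if "Q0 \<in> A" for Q0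
    using that A by (subst sum.remove[OF A that]) (auto intro!: sum.neutral)
  have zero: "(\<Sum>\<gamma>\<in>?K. Poly_Mapping.lookup \<sigma> \<gamma> * ((if Q = ?P \<gamma> 1 then 1 else 0) - (if Q = ?P \<gamma> 0 then 1 else 0))) = 0" for Q
  proof -
    have "Poly_Mapping.lookup (frag_extend (\<lambda>\<gamma>. frag_of (?P \<gamma> 1) - frag_of (?P \<gamma> 0)) \<sigma>) Q = 0"
      using assms by (simp add: torus_1cycle_def)
    then show ?thesis by (simp add: lookup_frag_extend lookup_minus cong: if_cong)
  qed
  have "(\<Sum>\<gamma>\<in>?K. ?n \<gamma> * (R (?P \<gamma> 1) - R (?P \<gamma> 0))) =
      (\<Sum>\<gamma>\<in>?K. ?n \<gamma> * (\<Sum>Q\<in>A. ((if Q = ?P \<gamma> 1 then 1 else 0) - (if Q = ?P \<gamma> 0 then 1 else 0)) * R Q))"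
  proof (rule sum.cong[OF refl])
    fix \<gamma> assume "\<gamma> \<in> ?K"
    then have "?P \<gamma> 1 \<in> A" "?P \<gamma> 0 \<in> A" by (auto simp: A_def)
    then show "?n \<gamma> * (R (?P \<gamma> 1) - R (?P \<gamma> 0)) =
        ?n \<gamma> * (\<Sum>Q\<in>A. ((if Q = ?P \<gamma> 1 then 1 else 0) - (if Q = ?P \<gamma> 0 then 1 else 0)) * R Q)"
      by (simp only: left_diff_distrib sum_subtractf ind)
  qed
  also have "\<dots> = (\<Sum>Q\<in>A. (\<Sum>\<gamma>\<in>?K. ?n \<gamma> * ((if Q = ?P \<gamma> 1 then 1 else 0) - (if Q = ?P \<gamma> 0 then 1 else 0))) * R Q)"
    unfolding sum_distrib_left sum_distrib_right by (subst sum.swap) (simp add: mult.assoc)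
  also have "\<dots> = (\<Sum>Q\<in>A. of_int (\<Sum>\<gamma>\<in>?K. Poly_Mapping.lookup \<sigma> \<gamma> *
      ((if Q = ?P \<gamma> 1 then 1 else 0) - (if Q = ?P \<gamma> 0 then 1 else 0))) * R Q)"
    by (intro sum.cong refl arg_cong2[where f = "(*)"]) (auto intro!: sum.cong)
  also have "\<dots> = 0" by (simp only: zero) simp
  finally show ?thesis .
qed

text \<open>The primitive \<open>L\<close> does not descend to the torus, but modulo
  \<open>2 * pi\<close> times the integers it does. Choosing a lift of each point splits
  \<open>L\<close> into a function \<open>R\<close> of the torus point, which cancels on cycles, and
  an integer multiple of \<open>2 * pi\<close>.\<close>

lemma integral_formI:
  fixes s :: "'n::finite \<Rightarrow> int \<Rightarrow> complex"
  assumes s: "\<And>j. s j \<xi> = of_int (k j)"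
  shows "integral_form (c_form s \<xi>)"
  unfolding integral_form_def
proof (intro conjI allI impI)
  show "c_form s \<xi> {j} t \<in> \<real>" for j t by (simp add: s)
  fix \<sigma> :: "(real \<Rightarrow> real^'n) \<Rightarrow>\<^sub>0 int" assume \<sigma>: "torus_1cycle \<sigma>"
  define L where "L y = (\<Sum>j\<in>UNIV. of_int (k j) * y $ j)" for y :: "real^'n"
  define R where "R P = L (SOME y. torus_point y = P)" for P
  let ?K = "Poly_Mapping.keys \<sigma>"
  let ?n = "\<lambda>\<gamma>. real_of_int (Poly_Mapping.lookup \<sigma> \<gamma>)"
  have "\<exists>i::int. L y = R (torus_point y) + 2 * pi * of_int i" for y
  proof -
    define z where "z = (SOME z. torus_point z = torus_point y)"
    have "torus_point z = torus_point y" unfolding z_def by (rule someI[of _ y]) simp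
    then have "y \<in> torus_point z" using torus_point_self by blast
    then obtain i :: "'n \<Rightarrow> int" where i: "\<And>j. y $ j = z $ j + 2 * pi * of_int (i j)"
      unfolding torus_point_def by (auto simp: choice_iff)
    have "L y = L z + 2 * pi * of_int (\<Sum>j\<in>UNIV. k j * i j)"
      by (simp add: L_def i distrib_left sum.distrib sum_distrib_left mult_ac)
    then show ?thesis unfolding R_def z_def by blast
  qed
  then obtain I where I: "\<And>y. L y = R (torus_point y) + 2 * pi * of_int (I y)" by metis
  have "chain_integral (c_form s \<xi>) \<sigma> = (\<Sum>\<gamma>\<in>?K. of_real (?n \<gamma> * (L (\<gamma> 1) - L (\<gamma> 0))))"
    unfolding chain_integral_def
  proof (rule sum.cong[OF refl])
    fix \<gamma> assume "\<gamma> \<in> ?K"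
    with \<sigma> have "\<gamma> piecewise_C1_differentiable_on {0..1}" by (simp add: torus_1cycle_def)
    then show "of_int (Poly_Mapping.lookup \<sigma> \<gamma>) * path_integral (c_form s \<xi>) \<gamma> = of_real (?n \<gamma> * (L (\<gamma> 1) - L (\<gamma> 0)))"
      by (simp add: path_integral_c_form s L_def right_diff_distrib sum_subtractf)
  qed
  also have "\<dots> = of_real (\<Sum>\<gamma>\<in>?K. ?n \<gamma> * (R (torus_point (\<gamma> 1)) - R (torus_point (\<gamma> 0)))
      + 2 * pi * (?n \<gamma> * of_int (I (\<gamma> 1) - I (\<gamma> 0))))"
    unfolding of_real_sum[symmetric] by (intro arg_cong[where f = of_real] sum.cong refl) (simp add: I algebra_simps)
  also have "\<dots> = of_real (2 * pi * of_int (\<Sum>\<gamma>\<in>?K. Poly_Mapping.lookup \<sigma> \<gamma> * (I (\<gamma> 1) - I (\<gamma> 0))))"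
    unfolding sum.distrib cycle_sum_eq_0[OF \<sigma>] by (simp add: sum_distrib_left)
  finally have "1 / (2 * of_real pi) * chain_integral (c_form s \<xi>) \<sigma> =
      of_int (\<Sum>\<gamma>\<in>?K. Poly_Mapping.lookup \<sigma> \<gamma> * (I (\<gamma> 1) - I (\<gamma> 0)))"
    by simp
  then show "1 / (2 * of_real pi) * chain_integral (c_form s \<xi>) \<sigma> \<in> \<int>"
    by (simp only: Ints_of_int)
qed

section \<open>Primitives and exact forms\<close>

lemma pderiv_dir_affine: "pderiv_dir b (\<lambda>t. r \<bullet> t + a) = (\<lambda>t. r \<bullet> b)"
proof
  fix t
  have "((\<lambda>t. r \<bullet> t + a) has_derivative (\<lambda>h. r \<bullet> h)) (at t)"
    by (auto intro!: derivative_eq_intros)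
  then show "pderiv_dir b (\<lambda>t. r \<bullet> t + a) t = r \<bullet> b"
    by (simp add: pderiv_dir_def frechet_derivative_at[symmetric])
qed

text \<open>Affine functions, unlike linear ones, are closed under \<open>pderiv_dir\<close>; this
  is the invariant of the induction.\<close>

lemma smooth_inner: "smooth (\<lambda>t. r \<bullet> t)"
  unfolding smooth_def
proof safe
  fix bs :: "'a list"
  have "\<exists>q a. pderivs bs (\<lambda>t. r \<bullet> t) = (\<lambda>t. q \<bullet> t + a)"
  proof (induction bs)
    case Nil
    show ?case by (intro exI[of _ r] exI[of _ 0]) simp
  next
    case (Cons b bs)
    then obtain q a where "pderivs bs (\<lambda>t. r \<bullet> t) = (\<lambda>t. q \<bullet> t + a)" by blast
    then show ?case by (intro exI[of _ 0] exI[of _ "q \<bullet> b"]) (simp add: pderivs_Cons pderiv_dir_affine)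
  qed
  then obtain q a where qa: "pderivs bs (\<lambda>t. r \<bullet> t) = (\<lambda>t. q \<bullet> t + a)" by blast
  have "((\<lambda>t. q \<bullet> t + a) has_derivative (\<lambda>h. q \<bullet> h)) (at t)" for t
    by (auto intro!: derivative_eq_intros)
  then show "pderivs bs (\<lambda>t. r \<bullet> t) differentiable_on UNIV"
    unfolding qa by (meson differentiableI differentiable_at_imp_differentiable_on)
qed

lemma integral_d_t_eq_0:
  fixes v :: "'n::{finite,linorder} set \<Rightarrow> (real, 'n) vec \<Rightarrow> complex"
  assumes "v \<in> smooth_forms p"
  shows "integral tbox (d_t p v J) = 0"
proof -
  have v: "v K \<in> torus_smooth" if "card K = p" for K
    using assms that by (auto simp: smooth_forms_def dest: spec[of _ K])
  have ax: "axis j 1 \<in> (Basis :: ((real, 'n) vec) set)" for j by (simp add: axis_in_Basis_iff)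
  have "((\<lambda>t. wedge_coeff j K J * pderiv_dir (axis j 1) (v K) t) has_integral wedge_coeff j K J * 0) tbox"
    if K: "card K = p" for j K
  proof -
    have cont: "continuous_on S (pderiv_dir (axis j 1) (v K))" for S
      by (intro torus_smooth_continuous torus_smooth_pderiv_dir v K ax)
    have "integral tbox (pderiv_dir (axis j 1) (v K)) = 0"
      using v[OF K] smooth_differentiable_pderivs[of "v K" "[]"] cont
      by (intro integral_pderiv_dir_eq_0 ax) (auto simp: torus_smooth_iff)
    moreover have "pderiv_dir (axis j 1) (v K) integrable_on tbox"
      by (intro integrable_continuous cont)
    ultimately have "(pderiv_dir (axis j 1) (v K) has_integral 0) tbox"
      by (metis integrable_integral)
    then show ?thesis by (rule has_integral_mult_right)
  qed
  then have "(d_t p v J has_integral (\<Sum>j\<in>UNIV. \<Sum>K | card K = p. wedge_coeff j K J * 0)) tbox"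
    unfolding d_t_def[abs_def] by (intro has_integral_sum) auto
  then show ?thesis by (simp add: integral_unique)
qed

section \<open>Solvability and the small divisor condition\<close>

text \<open>The maximum norm is taken so that the size is attained at a coordinate, the one used for
  the contraction.\<close>

definition symbol_size :: "('n::finite \<Rightarrow> int \<Rightarrow> complex) \<Rightarrow> (real^'n) \<times> real \<Rightarrow> real" where
  "symbol_size s m = (MAX j. norm (total_symbol s j m))"

definition no_small_divisors :: "('n::finite \<Rightarrow> int \<Rightarrow> complex) \<Rightarrow> bool" where
  "no_small_divisors s \<longleftrightarrow>
    (\<exists>C>0. \<exists>N. \<forall>m\<in>lattice. symbol_size s m \<noteq> 0 \<longrightarrow> C \<le> symbol_size s m * (1 + norm m) ^ N)"

lemma total_symbol_le_size: "norm (total_symbol s j m) \<le> symbol_size s m"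
  by (simp add: symbol_size_def)

lemma symbol_size_attained: "\<exists>j. norm (total_symbol s j m) = symbol_size s m"
proof -
  have "symbol_size s m \<in> range (\<lambda>j. norm (total_symbol s j m))"
    unfolding symbol_size_def by (rule Max_in) auto
  then obtain j where "symbol_size s m = norm (total_symbol s j m)" by (rule imageE)
  then show ?thesis by (intro exI[of _ j]) simp
qed

lemma symbol_size_nonneg: "0 \<le> symbol_size s m"
  using total_symbol_le_size[of s undefined m] norm_ge_zero order_trans by blast

lemma distr_of_cmult: "distr_of f (\<lambda>x. a * g x) = a * distr_of f g"
  by (simp add: distr_of_def mult.left_commute)

lemma smooth_forms_torus_smooth: "f \<in> smooth_forms p \<Longrightarrow> f K \<in> torus_smooth"
  by (cases "card K = p") (auto simp: smooth_forms_def torus_smooth_zero dest: spec[of _ K])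

lemma smooth_forms_eq_0: "f \<in> smooth_forms p \<Longrightarrow> card K \<noteq> p \<Longrightarrow> f K = (\<lambda>_. 0)"
  by (auto simp: smooth_forms_def dest: spec[of _ K])

lemma fst_lattice_Ints:
  assumes "m \<in> lattice"
  obtains k :: "'n::finite \<Rightarrow> int" where "\<And>j. fst (m :: (real^'n) \<times> real) $ j = of_int (k j)"
proof -
  have "fst m $ j \<in> \<int>" for j
    using assms axis_Basis_Pair[of j] inner_axis_Pair[of m j] by (auto simp: lattice_def)
  then have "\<forall>j. \<exists>k::int. fst m $ j = of_int k" by (blast elim: Ints_cases)
  then show ?thesis using that by metis
qed

text \<open>A zero of the symbol at \<open>m\<close> means that the 1-form has the integer
  coefficients \<open>- fst m\<close>, with primitive \<open>(- fst m) \<bullet> t\<close>.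
  Multiplying by its exponential moves the mode \<open>m\<close> to the mean value over the n-torus,
  and each coefficient of an exact form has mean zero.\<close>

lemma EE_fourier_eq_0:
  fixes s :: "'n::{finite,linorder} \<Rightarrow> int \<Rightarrow> complex"
  assumes f: "f \<in> EE s p" and m: "m \<in> lattice" and size: "symbol_size s m = 0"
  shows "distr_of (f K) (chr (- m)) = 0"
proof -
  define \<xi> where "\<xi> = \<lfloor>snd m\<rfloor>"
  have f1: "f \<in> smooth_forms (p + 1)" using f by (simp add: EE_def)
  have w: "s j \<xi> = of_real (- (fst m $ j))" for j
    using total_symbol_le_size[of s j m] size
    by (simp add: total_symbol_def \<xi>_def add_eq_0_iff2)
  obtain k where k: "\<And>j. fst m $ j = of_int (k j)" using fst_lattice_Ints[OF m] by blast
  have "integral_form (c_form s \<xi>)"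
    by (rule integral_formI[of s \<xi> "\<lambda>j. - k j"]) (simp add: w k)
  moreover define \<psi> where "\<psi> = (\<lambda>t. (- fst m) \<bullet> t)"
  moreover have "primitive (c_form s \<xi>) \<psi>"
    using pderiv_dir_affine[of _ "- fst m" 0]
    by (simp add: primitive_def \<psi>_def smooth_inner[of "- fst m"] w inner_axis del: inner_minus_left)
  ultimately have "exact_Suc p (\<lambda>K t. fourier_coeff (f K) \<xi> t * exp (\<i> * of_real (\<psi> t)))"
    using f unfolding EE_def by blast
  then obtain v where v: "v \<in> smooth_forms p"
      "d_t p v = (\<lambda>K t. fourier_coeff (f K) \<xi> t * exp (\<i> * of_real (\<psi> t)))"
    unfolding exact_Suc_def by blast
  have "integral tbox (\<lambda>t. fourier_coeff (f K) \<xi> t * chr (- fst m) t) = 0"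
    using integral_d_t_eq_0[OF v(1), of K] unfolding v(2) \<psi>_def chr_def .
  moreover have "(- fst m, - of_int \<xi>) = - m"
    using snd_lattice[OF m] by (simp add: \<xi>_def prod_eq_iff)
  ultimately show ?thesis
    using integral_fourier_coeff_chr[OF torus_smooth_continuous[OF smooth_forms_torus_smooth[OF f1]], of K \<xi> "- fst m"]
    by simp
qed

proposition no_small_divisors_imp_solvable:
  fixes s :: "'n::{finite,linorder} \<Rightarrow> int \<Rightarrow> complex"
  assumes s: "\<And>j. poly_growth (s j)" and ds: "no_small_divisors s"
  shows "globally_solvable s p"
  unfolding globally_solvable_def
proof
  fix f assume f: "f \<in> EE s p"
  then have f1: "f \<in> smooth_forms (p + 1)"
    and LLf: "eq_distr_form (LL s (p + 1) (\<lambda>K. distr_of (f K))) (\<lambda>_ _. 0)"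
    by (auto simp: EE_def)
  note fs = smooth_forms_torus_smooth[OF f1]
  let ?D = "DIM((real, 'n) vec \<times> real)"
  define F where "F m K = distr_of (f K) (chr (- m)) / (2 * of_real pi) ^ ?D" for m K
  define w where "w m j = total_symbol s j m" for m j
  obtain jm where jm: "\<And>m. norm (w m (jm m)) = symbol_size s m"
    using symbol_size_attained[of s] unfolding w_def by metis
  \<comment> \<open>At a zero of the symbol the value 0 is a solution, because the mode of
    \<open>f\<close> vanishes there.\<close>
  define u where "u m K = (if jm m \<in> K \<or> symbol_size s m = 0 then 0
    else shuffle_sign (jm m) K * F m (insert (jm m) K) / w m (jm m))" for m K
  have rapidF: "rapid (\<lambda>m. F m K)" for K
    unfolding F_def by (rule rapid_reflect_divide[OF rapid_torus_smooth[OF fs]])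
  have closed: "wedge (w m) (F m) J = 0" if m: "m \<in> lattice" and J: "card J = p + 2" for m J
  proof -
    have mm: "- m \<in> lattice" using m by (rule lattice_uminus)
    have "LL s (p + 1) (\<lambda>K. distr_of (f K)) J (chr (- m)) = 0"
      using LLf torus_smooth_chr[OF mm] by (simp add: eq_distr_form_def)
    then have "wedge (\<lambda>j. total_symbol s j (- (- m))) (\<lambda>K. distr_of (f K) (chr (- m))) J = 0"
      using LL_chr[of "\<lambda>K. distr_of (f K)" "- m" J "p + 1" s] mm J by (simp add: distr_of_cmult)
    moreover have "wedge (w m) (F m) J = wedge (w m) (\<lambda>K. distr_of (f K) (chr (- m))) J / (2 * of_real pi) ^ ?D"
      unfolding wedge_def F_def sum_divide_distrib by (intro sum.cong) auto
    ultimately show ?thesis by (simp add: w_def[abs_def])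
  qed
  have wedge_u: "wedge (w m) (u m) J = F m J" if m: "m \<in> lattice" and J: "card J = p + 1" for m J
  proof (cases "symbol_size s m = 0")
    case True
    then have "F m J = 0" using EE_fourier_eq_0[OF f m] by (simp add: F_def)
    then show ?thesis using True by (simp add: wedge_def u_def)
  next
    case False
    have u: "u m = (\<lambda>K. if jm m \<in> K then 0 else shuffle_sign (jm m) K * F m (insert (jm m) K) / w m (jm m))"
      using False by (auto simp: u_def)
    show ?thesis
      unfolding u
    proof (rule wedge_contraction)
      show "w m (jm m) \<noteq> 0" using jm[of m] False by auto
      show "wedge (w m) (F m) (insert (jm m) J) = 0" if "jm m \<notin> J"
        using that J by (intro closed m) simp
    qed simp
  qed
  obtain C N where C: "C > 0" "\<And>m. m \<in> lattice \<Longrightarrow> symbol_size s m \<noteq> 0 \<Longrightarrow> C \<le> symbol_size s m * (1 + norm m) ^ N"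
    using ds unfolding no_small_divisors_def by blast
  have rapidu: "rapid (\<lambda>m. u m K)" for K
  proof (rule rapid_bounded_by)
    \<comment> \<open>The index \<open>jm m\<close> changes with \<open>m\<close>, so the
      coefficient of \<open>F\<close> that enters \<open>u m K\<close> does too; the sum over all
      multi-indices majorises each of them.\<close>
    show "rapid (\<lambda>m. \<Sum>K\<in>UNIV. of_real (norm (F m K)))"
      by (intro rapid_sum rapid_norm rapidF) auto
    fix m :: "(real, 'n) vec \<times> real" assume m: "m \<in> lattice"
    show "norm (u m K) \<le> (1 / C) * (1 + norm m) ^ N * norm (\<Sum>K\<in>UNIV. complex_of_real (norm (F m K)))"
    proof (cases "jm m \<in> K \<or> symbol_size s m = 0")
      case True
      then show ?thesis using C(1) by (auto simp: u_def)
    next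
      case False
      then have pos: "symbol_size s m > 0" using symbol_size_nonneg[of s m] by simp
      have le: "norm (F m (insert (jm m) K)) \<le> (\<Sum>K\<in>UNIV. norm (F m K))"
        by (rule member_le_sum) auto
      have "1 / symbol_size s m \<le> (1 / C) * (1 + norm m) ^ N"
        using C(2)[OF m] C(1) pos by (simp add: field_simps)
      then have "norm (F m (insert (jm m) K)) * (1 / symbol_size s m)
          \<le> (\<Sum>K\<in>UNIV. norm (F m K)) * ((1 / C) * (1 + norm m) ^ N)"
        using le pos by (intro mult_mono) (auto intro: sum_nonneg)
      moreover have "norm (u m K) = norm (F m (insert (jm m) K)) * (1 / symbol_size s m)"
        using False by (simp add: u_def norm_divide norm_mult jm)
      moreover have "norm (\<Sum>K\<in>UNIV. complex_of_real (norm (F m K))) = (\<Sum>K\<in>UNIV. norm (F m K))"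
        unfolding of_real_sum[symmetric] norm_of_real by (simp add: sum_nonneg)
      ultimately show ?thesis by (simp add: mult_ac)
    qed
  qed
  \<comment> \<open>The factor \<open>- \<i>\<close> cancels the \<i> in \<open>LL\<close>; degrees
    other than \<open>p\<close> are set to zero as \<open>distr_forms\<close> requires.\<close>
  define v where "v K = (if card K = p then series_distr (\<lambda>m. - \<i> * u m K) else (\<lambda>_. 0))" for K
  have "torus_distribution (series_distr (\<lambda>m. - \<i> * u m K))" for K
    by (intro torus_distribution_series_distr rapid_cmult rapidu)
  then have "v \<in> distr_forms p" by (simp add: distr_forms_def v_def)
  moreover have "eq_distr_form (LL s p v) (\<lambda>K. distr_of (f K))"
    unfolding eq_distr_form_def
  proof (intro allI ballI)
    fix J and \<phi> :: "(real, 'n) vec \<times> real \<Rightarrow> complex" assume \<phi>: "\<phi> \<in> torus_smooth"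
    show "LL s p v J \<phi> = distr_of (f J) \<phi>"
    proof (cases "card J = p + 1")
      case True
      have "LL s p v J \<phi> = series_distr (\<lambda>m. \<i> * wedge (w m) (\<lambda>K. - \<i> * u m K) J) \<phi>"
        unfolding w_def using True
        by (intro LL_series_distr rapid_cmult rapidu s \<phi>) (auto simp: v_def)
      also have "\<dots> = series_distr (\<lambda>m. F m J) \<phi>"
        unfolding series_distr_def
      proof (rule infsum_cong)
        fix m :: "(real, 'n) vec \<times> real" assume m: "m \<in> lattice"
        have "\<i> * wedge (w m) (\<lambda>K. - \<i> * u m K) J = wedge (w m) (u m) J"
          unfolding wedge_def sum_distrib_left by (rule sum.cong) (auto simp: mult_ac)
        then show "\<i> * wedge (w m) (\<lambda>K. - \<i> * u m K) J * distr_of \<phi> (chr m) = F m J * distr_of \<phi> (chr m)"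
          using wedge_u[OF m True] by simp
      qed
      also have "\<dots> = distr_of (fourier_series (\<lambda>m. F m J)) \<phi>"
        by (rule distr_of_fourier_series(1)[OF rapidF torus_smooth_continuous[OF \<phi>], symmetric])
      also have "fourier_series (\<lambda>m. F m J) = f J"
        unfolding F_def by (rule fourier_inversion[OF fs, symmetric])
      finally show ?thesis .
    next
      case False
      then show ?thesis by (simp add: LL_eq smooth_forms_eq_0[OF f1] distr_of_def)
    qed
  qed
  ultimately show "\<exists>u\<in>distr_forms p. eq_distr_form (LL s p u) (\<lambda>K. distr_of (f K))" by blast
qed

section \<open>Necessity of the lower bound for the divisors\<close>

lemma Ck_norm_chr_le:
  "\<exists>A\<ge>0. \<forall>m\<in>lattice. Ck_norm k (chr m) \<le> A * (1 + norm (m :: 'a::euclidean_space)) ^ k"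
proof (intro exI conjI ballI)
  let ?B = "{bs :: 'a list. set bs \<subseteq> Basis \<and> length bs \<le> k}"
  fix m :: 'a
  have "(SUP x. norm (pderivs bs (chr m) x)) \<le> (1 + norm m) ^ k" if bs: "bs \<in> ?B" for bs
  proof (rule cSUP_least)
    fix x
    have "norm (\<Prod>b\<leftarrow>bs. \<i> * of_real (m \<bullet> b)) \<le> (1 + norm m) ^ length bs"
      if "set bs \<subseteq> Basis" for bs
      using that
    proof (induction bs)
      case (Cons b bs)
      have "\<bar>m \<bullet> b\<bar> \<le> 1 + norm m"
        using Basis_le_norm[of b m] Cons.prems by simp
      then show ?case
        using Cons by (auto simp: norm_mult intro!: mult_mono)
    qed simp
    also have "(1 + norm m) ^ length bs \<le> (1 + norm m) ^ k"
      using bs by (intro power_increasing) auto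
    finally show "norm (pderivs bs (chr m) x) \<le> (1 + norm m) ^ k"
      using bs by (simp add: pderivs_chr norm_mult)
  qed simp
  then have "Ck_norm k (chr m) \<le> (\<Sum>bs\<in>?B. (1 + norm m) ^ k)"
    unfolding Ck_norm_def by (rule sum_mono)
  then show "Ck_norm k (chr m) \<le> real (card ?B) * (1 + norm m) ^ k" by simp
qed simp

text \<open>The seminorm estimate limits a distribution to polynomial growth on characters, since
  each derivative of a character costs one power of the frequency.\<close>

lemma torus_distribution_chr_le:
  fixes u :: "'a::euclidean_space functional"
  assumes "torus_distribution u"
  shows "\<exists>A\<ge>0. \<exists>k. \<forall>m\<in>lattice. norm (u (chr m)) \<le> A * (1 + norm m) ^ k"
proof -
  obtain C k where C: "\<And>f. f \<in> torus_smooth \<Longrightarrow> norm (u f) \<le> C * Ck_norm k f"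
    using assms unfolding torus_distribution_def by blast
  obtain A where A: "A \<ge> 0" "\<And>m::'a. m \<in> lattice \<Longrightarrow> Ck_norm k (chr m) \<le> A * (1 + norm m) ^ k"
    using Ck_norm_chr_le by blast
  have "norm (u (chr m)) \<le> (\<bar>C\<bar> * A) * (1 + norm m) ^ k" if m: "m \<in> lattice" for m
  proof -
    have "0 \<le> Ck_norm k (chr m)"
      using pderivs_le_Ck_norm[OF torus_smooth_chr[OF m], of "[]" k 0] by simp
    then have "norm (u (chr m)) \<le> \<bar>C\<bar> * Ck_norm k (chr m)"
      using C[OF torus_smooth_chr[OF m]] by (meson abs_ge_self mult_right_mono order_trans)
    also have "\<dots> \<le> \<bar>C\<bar> * (A * (1 + norm m) ^ k)"
      using A(2)[OF m] by (intro mult_left_mono) auto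
    finally show ?thesis by simp
  qed
  moreover have "0 \<le> \<bar>C\<bar> * A" using A(1) by simp
  ultimately show ?thesis by blast
qed

lemma exact_Suc_zero: "exact_Suc p (\<lambda>K t. 0)"
proof -
  have "d_t p (\<lambda>K t. 0) = (\<lambda>K t. 0)"
    by (intro ext) (simp add: d_t_def pderiv_dir_def)
  moreover have "(\<lambda>K t. 0) \<in> smooth_forms p"
    by (simp add: smooth_forms_def torus_smooth_zero)
  ultimately show ?thesis unfolding exact_Suc_def by blast
qed

text \<open>At a resonant \<open>\<xi>\<close> the symbol takes integer values, so small divisors occur only where \<open>EE\<close>
  imposes no exactness condition.\<close>

lemma symbol_size_ge_1:
  fixes s :: "'n::finite \<Rightarrow> int \<Rightarrow> complex"
  assumes "integral_form (c_form s \<lfloor>snd m\<rfloor>)" "m \<in> lattice" "symbol_size s m \<noteq> 0"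
  shows "1 \<le> symbol_size s m"
proof -
  obtain j where j: "norm (total_symbol s j m) = symbol_size s m"
    using symbol_size_attained by blast
  have "complex_of_real (fst m $ j) \<in> \<int>"
    using fst_lattice_Ints[OF assms(2)] by (metis Ints_of_int of_real_of_int_eq)
  then have "total_symbol s j m \<in> \<int>"
    unfolding total_symbol_def by (intro Ints_add integral_form_imp_Ints[OF assms(1)])
  then obtain i where i: "total_symbol s j m = of_int i" by (elim Ints_cases)
  have "i \<noteq> 0" using j assms(3) i by auto
  then have "1 \<le> norm (total_symbol s j m)" unfolding i by simp
  then show ?thesis using j by simp
qed

proposition solvable_imp_no_small_divisors:
  fixes s :: "'n::{finite,linorder} \<Rightarrow> int \<Rightarrow> complex"
  assumes s: "\<And>j. poly_growth (s j)" and p: "p < CARD('n)" and gs: "globally_solvable s p"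
  shows "no_small_divisors s"
proof (rule ccontr)
  assume neg: "\<not> no_small_divisors s"
  let ?size = "symbol_size s"
  \<comment> \<open>The bound fails for exponent \<open>N\<close> and constant
    \<open>1 / (N + 1)\<close> at once: the power yields rapid decrease of the datum, the constant
    the final contradiction.\<close>
  have "\<exists>m\<in>lattice. ?size m \<noteq> 0 \<and> ?size m * (1 + norm m) ^ N < 1 / (real N + 1)" for N
  proof -
    have "0 < 1 / (real N + 1)" by simp
    then show ?thesis using neg unfolding no_small_divisors_def by (metis linorder_not_less)
  qed
  then obtain mm where mm: "\<And>N. mm N \<in> lattice" "\<And>N. ?size (mm N) \<noteq> 0"
      "\<And>N. ?size (mm N) * (1 + norm (mm N)) ^ N < 1 / (real N + 1)"
    by metis
  define S where "S = range mm"
  have S: "m \<in> lattice" "0 < ?size m" "?size m < 1" if mS: "m \<in> S" for m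
  proof -
    obtain N where N: "m = mm N" using mS by (auto simp: S_def)
    show "m \<in> lattice" using mm(1)[of N] N by simp
    show pos: "0 < ?size m" using mm(2)[of N] symbol_size_nonneg[of s m] N by simp
    have "?size m * 1 \<le> ?size m * (1 + norm m) ^ N"
      using pos by (intro mult_left_mono one_le_power) auto
    also have "\<dots> < 1 / (real N + 1)" using mm(3)[of N] N by simp
    also have "\<dots> \<le> 1" by simp
    finally show "?size m < 1" by simp
  qed
  define w where "w m j = total_symbol s j m" for m j
  obtain jm where jm: "\<And>m. norm (w m (jm m)) = ?size m"
    using symbol_size_attained[of s] unfolding w_def by metis
  \<comment> \<open>This is where \<open>p < CARD('n)\<close> enters: room is needed for a
    \<open>p\<close>-element set that avoids the coordinate of the largest symbol.\<close>
  have "\<exists>K. j \<notin> K \<and> card K = p" for j :: 'n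
  proof -
    have "p \<le> card (UNIV - {j})" using p by (simp add: card_Diff_singleton)
    then obtain K where "K \<subseteq> UNIV - {j}" "card K = p"
      by (rule obtain_subset_with_card_n)
    then show ?thesis by blast
  qed
  then obtain K1 where K1: "\<And>j :: 'n. j \<notin> K1 j \<and> card (K1 j) = p" by metis
  define K0 where "K0 m = K1 (jm m)" for m
  have K0: "jm m \<notin> K0 m" "card (K0 m) = p" for m
    using K1 by (auto simp: K0_def)
  \<comment> \<open>The size of the coefficients of \<open>f\<close> is \<open>sqrt (?size m)\<close>, rapidly decreasing on \<open>S\<close>, whereas a
    solution would have coefficients of size at least \<open>1 / sqrt (?size m)\<close> up to a constant.\<close>
  define e where "e m K = (if m \<in> S \<and> K = K0 m then complex_of_real (1 / sqrt (?size m)) else 0)" for m K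
  define c where "c K m = wedge (w m) (e m) K" for K m
  have c_le: "norm (c K m) \<le> CARD('n) * sqrt (?size m)" for K m
  proof (cases "m \<in> S")
    case True
    have "norm (c K m) \<le> (\<Sum>j\<in>K. norm (shuffle_sign j (K - {j}) * (w m j * e m (K - {j}))))"
      unfolding c_def wedge_def by (rule norm_sum)
    also have "\<dots> \<le> (\<Sum>j\<in>K. ?size m * (1 / sqrt (?size m)))"
    proof (rule sum_mono)
      fix j
      have "norm (e m (K - {j})) \<le> 1 / sqrt (?size m)"
        using S(2)[OF True] by (simp add: e_def norm_divide)
      then have "norm (w m j) * norm (e m (K - {j})) \<le> ?size m * (1 / sqrt (?size m))"
        unfolding w_def by (intro mult_mono total_symbol_le_size symbol_size_nonneg norm_ge_zero)
      then show "norm (shuffle_sign j (K - {j}) * (w m j * e m (K - {j}))) \<le> ?size m * (1 / sqrt (?size m))"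
        by (simp add: norm_mult)
    qed
    also have "\<dots> = card K * sqrt (?size m)"
      using S(2)[OF True] by (simp add: real_div_sqrt)
    also have "\<dots> \<le> CARD('n) * sqrt (?size m)"
      using S(2)[OF True] by (intro mult_right_mono) (auto simp: card_mono)
    finally show ?thesis .
  qed (simp add: c_def wedge_def e_def symbol_size_nonneg)
  have c0: "c K m = 0" if "m \<notin> S \<or> card K \<noteq> p + 1" for K m
  proof -
    have "e m (K - {j}) = 0" if "j \<in> K" for j
    proof (rule ccontr)
      assume "e m (K - {j}) \<noteq> 0"
      then have "m \<in> S" "K - {j} = K0 m" by (auto simp: e_def split: if_splits)
      moreover have "card K = Suc (card (K - {j}))"
        using that by (intro card.remove) auto
      ultimately show False using \<open>m \<notin> S \<or> card K \<noteq> p + 1\<close> K0(2) by simp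
    qed
    then show ?thesis by (simp add: c_def wedge_def)
  qed
  have rapidc: "rapid (c K)" for K
  proof (rule rapidI)
    fix k
    define g where "g m = sqrt (?size m) * (1 + norm m) ^ k" for m
    have g0: "0 \<le> g m" for m by (simp add: g_def symbol_size_nonneg)
    \<comment> \<open>For \<open>N\<close> at least \<open>2 * k\<close> the defining inequality of
      \<open>mm N\<close> bounds \<open>g\<close> by 1, the factor 2 coming from the square root.
      The finitely many remaining points are bounded by their sum.\<close>
    have g: "g m \<le> 1 + (\<Sum>N<2*k. g (mm N))" if mS: "m \<in> S" for m
    proof -
      obtain N where N: "m = mm N" using mS by (auto simp: S_def)
      show ?thesis
      proof (cases "N < 2 * k")
        case True
        then have "g m \<le> (\<Sum>N<2*k. g (mm N))"
          unfolding N by (intro member_le_sum) (auto simp: g0)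
        then show ?thesis by simp
      next
        case False
        have "?size m * (1 + norm m) ^ (2 * k) \<le> ?size m * (1 + norm m) ^ N"
          using False by (intro mult_left_mono power_increasing) (auto simp: symbol_size_nonneg)
        also have "\<dots> \<le> 1"
        proof -
          have "1 / (real N + 1) \<le> 1" by simp
          then show ?thesis using mm(3)[of N] unfolding N by linarith
        qed
        finally have "sqrt (?size m * ((1 + norm m) ^ k)\<^sup>2) \<le> 1"
          by (simp add: power_mult[symmetric] mult.commute)
        then have "g m \<le> 1" by (simp add: g_def real_sqrt_mult)
        also have "\<dots> \<le> 1 + (\<Sum>N<2*k. g (mm N))" by (simp add: sum_nonneg g0)
        finally show ?thesis .
      qed
    qed
    have "norm (c K m) * (1 + norm m) ^ k \<le> CARD('n) * (1 + (\<Sum>N<2*k. g (mm N)))" for m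
    proof (cases "m \<in> S")
      case True
      have "norm (c K m) * (1 + norm m) ^ k \<le> CARD('n) * sqrt (?size m) * (1 + norm m) ^ k"
        by (intro mult_right_mono c_le) simp
      also have "\<dots> \<le> CARD('n) * (1 + (\<Sum>N<2*k. g (mm N)))"
        using g[OF True] by (simp add: g_def mult.assoc mult_left_mono)
      finally show ?thesis .
    qed (simp add: c0 sum_nonneg g0 add_nonneg_nonneg)
    then show "\<exists>C. \<forall>m\<in>lattice. norm (c K m) * (1 + norm m) ^ k \<le> C" by blast
  qed
  define f where "f K = fourier_series (c K)" for K
  have f0: "f K = (\<lambda>_. 0)" if "card K \<noteq> p + 1" for K
    unfolding f_def by (rule ext) (simp add: fourier_series_def c0[OF disjI2[OF that]])
  have "f \<in> EE s p"
    unfolding EE_def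
  proof (intro CollectI conjI allI impI)
    show "f \<in> smooth_forms (p + 1)"
      using f0 by (auto simp: smooth_forms_def f_def intro!: torus_smooth_fourier_series rapidc)
    show "eq_distr_form (LL s (p + 1) (\<lambda>K. distr_of (f K))) (\<lambda>_ _. 0)"
      unfolding eq_distr_form_def
    proof (intro allI ballI)
      fix J and \<phi> :: "(real, 'n) vec \<times> real \<Rightarrow> complex" assume \<phi>: "\<phi> \<in> torus_smooth"
      show "LL s (p + 1) (\<lambda>K. distr_of (f K)) J \<phi> = 0"
      proof (cases "card J = p + 1 + 1")
        case True
        have "LL s (p + 1) (\<lambda>K. distr_of (f K)) J \<phi> =
            series_distr (\<lambda>m. \<i> * wedge (\<lambda>j. total_symbol s j m) (\<lambda>K. c K m) J) \<phi>"
          unfolding f_def by (intro LL_series_distr rapidc s \<phi> True L_op_distr_of_fourier_series)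
        also have "\<dots> = 0"
          unfolding c_def w_def[symmetric] by (simp add: wedge_wedge series_distr_def)
        finally show ?thesis .
      next
        case False
        then show ?thesis by (simp add: LL_eq)
      qed
    qed
    fix \<xi> \<psi> assume \<xi>: "integral_form (c_form s \<xi>) \<and> primitive (c_form s \<xi>) \<psi>"
    have "fourier_coeff (f K) \<xi> t = 0" for K t
      unfolding f_def
    proof (rule fourier_coeff_fourier_series_eq_0[OF rapidc])
      fix m :: "(real, 'n) vec \<times> real" assume m: "m \<in> lattice" "snd m = of_int \<xi>"
      \<comment> \<open>Sizes on \<open>S\<close> are positive and below 1, whereas nonzero sizes at
        a resonant frequency are at least 1.\<close>
      have "m \<notin> S"
        using symbol_size_ge_1[of s m] S[of m] \<xi> m by fastforce
      then show "c K m = 0" using c0 by blast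
    qed
    then show "exact_Suc p (\<lambda>K t. fourier_coeff (f K) \<xi> t * exp (\<i> * of_real (\<psi> t)))"
      by (simp add: exact_Suc_zero)
  qed
  with gs obtain u where u: "u \<in> distr_forms p" "eq_distr_form (LL s p u) (\<lambda>K. distr_of (f K))"
    unfolding globally_solvable_def by blast
  have homog: "u K (\<lambda>z. a * g z) = a * u K g" if "g \<in> torus_smooth" for K g a
  proof (cases "card K = p")
    case True
    then have "torus_distribution (u K)" using u(1) by (simp add: distr_forms_def)
    then show ?thesis using that unfolding torus_distribution_def by blast
  next
    case False
    then have "u K = (\<lambda>_. 0)" using u(1) by (simp add: distr_forms_def)
    then show ?thesis by simp
  qed
  have "\<exists>A\<ge>0. \<exists>k. \<forall>m\<in>lattice. norm (u K (chr m)) \<le> A * (1 + norm m) ^ k" for K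
  proof (cases "card K = p")
    case True
    then show ?thesis using u(1) by (intro torus_distribution_chr_le) (simp add: distr_forms_def)
  next
    case False
    then have "u K = (\<lambda>_. 0)" using u(1) by (simp add: distr_forms_def)
    then show ?thesis by (intro exI[of _ 0]) simp
  qed
  then obtain A k where A: "\<And>K. 0 \<le> A K" "\<And>K m. m \<in> lattice \<Longrightarrow> norm (u K (chr m)) \<le> A K * (1 + norm m) ^ k K"
    by metis
  define A' where "A' = (\<Sum>K\<in>UNIV. A K)"
  define k' where "k' = (\<Sum>K\<in>UNIV. k K)"
  have u_le: "norm (u K (chr m)) \<le> A' * (1 + norm m) ^ k'" if m: "m \<in> lattice" for K m
  proof -
    have "A K \<le> A'" unfolding A'_def by (rule member_le_sum) (auto simp: A)
    moreover have "k K \<le> k'" unfolding k'_def by (rule member_le_sum) auto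
    ultimately have "A K * (1 + norm m) ^ k K \<le> A' * (1 + norm m) ^ k'"
      using A(1)[of K] by (intro mult_mono power_increasing) auto
    then show ?thesis using A(2)[OF m, of K] by linarith
  qed
  let ?E = "(2 * pi) ^ DIM((real, 'n) vec \<times> real)"
  define B where "B = CARD('n) * A'"
  have A'0: "0 \<le> A'" unfolding A'_def by (simp add: sum_nonneg A(1))
  then have B0: "0 \<le> B" by (simp add: B_def)
  have E1: "1 \<le> ?E" using pi_ge_two by (intro one_le_power) simp
  \<comment> \<open>Comparing both sides of the equation at one mode bounds the square root of the
    size by the size itself times a polynomial; cancelling the root and squaring gives the
    claim.\<close>
  have main: "1 \<le> B\<^sup>2 * (?size m * (1 + norm m) ^ (2 * k'))" if mS: "m \<in> S" for m
  proof -
    note Sm = S[OF mS]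
    have mm': "- m \<in> lattice" using Sm(1) by (rule lattice_uminus)
    \<comment> \<open>On this multi-index a single term of the wedge survives, so nothing can cancel
      and the coefficient of the datum has modulus exactly the root of the size.\<close>
    define J where "J = insert (jm m) (K0 m)"
    have J: "card J = p + 1" "J - {jm m} = K0 m" using K0[of m] by (auto simp: J_def)
    have "norm (LL s p u J (chr (- m))) = norm (wedge (w m) (\<lambda>K. u K (chr (- m))) J)"
      using LL_chr[of u "- m" J p s, OF homog _ J(1)] mm' by (simp add: norm_mult w_def[abs_def])
    also have "\<dots> \<le> (\<Sum>j\<in>J. norm (w m j) * norm (u (J - {j}) (chr (- m))))"
      unfolding wedge_def by (rule order_trans[OF norm_sum]) (simp add: norm_mult)
    also have "\<dots> \<le> (\<Sum>j\<in>J. ?size m * (A' * (1 + norm m) ^ k'))"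
      using u_le[OF mm'] symbol_size_nonneg[of s m]
      by (intro sum_mono mult_mono) (auto simp: w_def total_symbol_le_size)
    also have "\<dots> = card J * (?size m * (A' * (1 + norm m) ^ k'))" by simp
    also have "\<dots> \<le> CARD('n) * (?size m * (A' * (1 + norm m) ^ k'))"
      using A'0 symbol_size_nonneg[of s m] by (intro mult_right_mono) (auto simp: card_mono)
    also have "\<dots> = B * (?size m * (1 + norm m) ^ k')" by (simp add: B_def)
    finally have upper: "norm (LL s p u J (chr (- m))) \<le> B * (?size m * (1 + norm m) ^ k')" .
    have "LL s p u J (chr (- m)) = distr_of (f J) (chr (- m))"
      using u(2) torus_smooth_chr[OF mm'] by (simp add: eq_distr_form_def)
    also have "\<dots> = (2 * of_real pi) ^ DIM((real, 'n) vec \<times> real) * c J m"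
      unfolding f_def using distr_of_fourier_series_chr[OF rapidc mm'] by simp
    finally have "norm (LL s p u J (chr (- m))) = ?E * norm (c J m)"
      by (simp add: norm_mult norm_power)
    also have "norm (c J m) = sqrt (?size m)"
    proof -
      have "c J m = (\<Sum>j\<in>{jm m}. shuffle_sign j (J - {j}) * (w m j * e m (J - {j})))"
        unfolding c_def wedge_def
      proof (rule sum.mono_neutral_right)
        show "\<forall>j\<in>J - {jm m}. shuffle_sign j (J - {j}) * (w m j * e m (J - {j})) = 0"
        proof
          fix j assume "j \<in> J - {jm m}"
          then have "J - {j} \<noteq> K0 m" using K0(1)[of m] by (auto simp: J_def)
          then show "shuffle_sign j (J - {j}) * (w m j * e m (J - {j})) = 0" by (simp add: e_def)
        qed
      qed (auto simp: J_def)
      then have "norm (c J m) = ?size m * (1 / sqrt (?size m))"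
        using Sm(2) mS by (simp add: norm_mult J e_def jm norm_divide)
      then show ?thesis using Sm(2) by (simp add: real_div_sqrt)
    qed
    finally have "?E * sqrt (?size m) \<le> B * (?size m * (1 + norm m) ^ k')"
      using upper by simp
    moreover have "1 * sqrt (?size m) \<le> ?E * sqrt (?size m)"
      using E1 Sm(2) by (intro mult_right_mono) auto
    moreover have "?size m = sqrt (?size m) * sqrt (?size m)"
      using Sm(2) by simp
    ultimately have "sqrt (?size m) * 1 \<le> sqrt (?size m) * (B * (sqrt (?size m) * (1 + norm m) ^ k'))"
      by (metis (no_types, opaque_lifting) mult.assoc mult.left_commute mult.right_neutral mult_1 order_trans)
    then have "1 \<le> B * (sqrt (?size m) * (1 + norm m) ^ k')"
      using Sm(2) by (subst (asm) mult_le_cancel_left_pos) auto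
    then have "1 \<le> (B * (sqrt (?size m) * (1 + norm m) ^ k'))\<^sup>2"
      by (rule one_le_power)
    also have "\<dots> = B\<^sup>2 * (?size m * (1 + norm m) ^ (2 * k'))"
      using Sm(2) by (simp add: power_mult_distrib power_mult[symmetric] mult.commute)
    finally show ?thesis .
  qed
  obtain N0 where N0: "B\<^sup>2 < real N0" using reals_Archimedean2 by blast
  \<comment> \<open>The summand \<open>2 * k'\<close> dominates the polynomial growth of the
    solution, and \<open>N0\<close> makes the constant \<open>1 / (N + 1)\<close> smaller than
    \<open>1 / B^2\<close> when \<open>B\<close> is nonzero.\<close>
  define N where "N = N0 + 2 * k'"
  have NS: "mm N \<in> S" by (simp add: S_def)
  have "1 \<le> B\<^sup>2 * (?size (mm N) * (1 + norm (mm N)) ^ (2 * k'))"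
    by (rule main[OF NS])
  also have "\<dots> \<le> B\<^sup>2 * (?size (mm N) * (1 + norm (mm N)) ^ N)"
    by (intro mult_left_mono power_increasing) (auto simp: N_def symbol_size_nonneg)
  also have "\<dots> \<le> B\<^sup>2 * (1 / (real N + 1))"
    using mm(3)[of N] by (intro mult_left_mono) auto
  also have "\<dots> < 1"
    using N0 by (simp add: N_def field_simps)
  finally show False by simp
qed

section \<open>Small divisors and simultaneous approximation\<close>

text \<open>The condition \<open>SDA\<close> without the irrationality of \<open>\<alpha>\<close>, which then follows.\<close>

definition approximable :: "nat \<Rightarrow> real^'n::finite \<Rightarrow> bool" where
  "approximable \<mu> \<alpha> \<longleftrightarrow>
     (\<exists>C>0. \<exists>(P :: nat \<Rightarrow> int^'n) (q :: nat \<Rightarrow> nat). \<forall>l. q l \<ge> 2 \<and>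
        0 < (MAX j. \<bar>(\<alpha> $ j) ^ \<mu> - of_int (P l $ j) ^ \<mu> / of_nat (q l)\<bar>) \<and>
        (MAX j. \<bar>(\<alpha> $ j) ^ \<mu> - of_int (P l $ j) ^ \<mu> / of_nat (q l)\<bar>) < C / real (q l) ^ l)"

lemma SDA_iff: "SDA \<mu> \<alpha> \<longleftrightarrow> \<not> rational_vec \<alpha> \<and> approximable \<mu> \<alpha>"
  by (simp add: SDA_def approximable_def Let_def)

section \<open>Elementary inequalities for powers\<close>

lemma abs_diff_power_le:
  fixes a b :: real
  assumes "\<bar>a\<bar> \<le> M" "\<bar>b\<bar> \<le> M"
  shows "\<bar>a ^ n - b ^ n\<bar> \<le> \<bar>a - b\<bar> * (n * M ^ (n - 1))"
proof -
  have "0 \<le> M" using assms(1) by linarith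
  have "\<bar>\<Sum>i<n. b ^ (n - Suc i) * a ^ i\<bar> \<le> (\<Sum>i<n. M ^ (n - 1))"
  proof (rule order_trans[OF sum_abs sum_mono])
    fix i assume "i \<in> {..<n}"
    then have "M ^ (n - 1) = M ^ (n - Suc i) * M ^ i"
      by (simp flip: power_add)
    moreover have "\<bar>b\<bar> ^ (n - Suc i) * \<bar>a\<bar> ^ i \<le> M ^ (n - Suc i) * M ^ i"
      using assms \<open>0 \<le> M\<close> by (intro mult_mono power_mono) auto
    ultimately show "\<bar>b ^ (n - Suc i) * a ^ i\<bar> \<le> M ^ (n - 1)"
      by (simp add: abs_mult power_abs)
  qed
  then have "\<bar>a - b\<bar> * \<bar>\<Sum>i<n. b ^ (n - Suc i) * a ^ i\<bar> \<le> \<bar>a - b\<bar> * (n * M ^ (n - 1))"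
    by (intro mult_left_mono) auto
  then show ?thesis by (simp add: power_diff_sumr2 abs_mult)
qed

lemma sum_power_le_power_sum:
  fixes x y :: real
  assumes "0 \<le> x" "0 \<le> y" "0 < n"
  shows "x ^ n + y ^ n \<le> (x + y) ^ n"
  using assms(3)
proof (induction n rule: nat_induct_non_zero)
  case (Suc n)
  have "0 \<le> x * y ^ n" "0 \<le> y * x ^ n" using assms by auto
  then have "x ^ Suc n + y ^ Suc n \<le> (x + y) * (x ^ n + y ^ n)"
    by (simp add: algebra_simps)
  also have "\<dots> \<le> (x + y) * (x + y) ^ n"
    using Suc.IH assms by (intro mult_left_mono) auto
  finally show ?case by simp
qed simp

lemma power_abs_diff_le_nonneg:
  fixes a b :: real
  assumes "0 \<le> b" "b \<le> a" "0 < n"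
  shows "(a - b) ^ n \<le> a ^ n - b ^ n"
  using sum_power_le_power_sum[of "a - b" b n] assms by simp

text \<open>For even \<open>n\<close> and opposite signs the powers may coincide although the bases
  differ, hence the hypothesis. With equal signs superadditivity of powers gives the bound; with
  opposite signs and odd \<open>n\<close> the absolute values add up, and the factor
  \<open>2 ^ n\<close> comes from bounding the difference by twice the larger absolute
  value.\<close>

lemma power_abs_diff_le:
  fixes a b :: real
  assumes "odd n \<or> 0 \<le> a * b" "0 < n"
  shows "\<bar>a - b\<bar> ^ n \<le> 2 ^ n * \<bar>a ^ n - b ^ n\<bar>"
proof (cases "0 \<le> a * b")
  case True
  have *: "\<bar>x - y\<bar> ^ n \<le> \<bar>x ^ n - y ^ n\<bar>" if "0 \<le> x" "0 \<le> y" for x y :: real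
    using that power_abs_diff_le_nonneg[of y x n] power_abs_diff_le_nonneg[of x y n] assms(2)
    by (cases "y \<le> x") (auto simp: abs_minus_commute power_mono)
  have "\<bar>a - b\<bar> ^ n \<le> \<bar>a ^ n - b ^ n\<bar>"
  proof (cases "0 \<le> a \<and> 0 \<le> b")
    case False
    then have "a \<le> 0" "b \<le> 0" using True by (auto simp: zero_le_mult_iff)
    then have "\<bar>- a - - b\<bar> ^ n \<le> \<bar>(- a) ^ n - (- b) ^ n\<bar>" by (intro *) auto
    also have "\<dots> = \<bar>a ^ n - b ^ n\<bar>"
      by (cases "even n") (simp_all add: abs_minus_commute)
    finally show ?thesis by (simp add: abs_minus_commute)
  qed (simp add: *)
  also have "\<dots> \<le> 2 ^ n * \<bar>a ^ n - b ^ n\<bar>"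
    using mult_right_mono[of 1 "2 ^ n" "\<bar>a ^ n - b ^ n\<bar>"] by simp
  finally show ?thesis .
next
  case False
  then have odd: "odd n" using assms(1) by blast
  have eq: "\<bar>a ^ n - b ^ n\<bar> = \<bar>a\<bar> ^ n + \<bar>b\<bar> ^ n"
  proof (cases "0 \<le> a")
    case True
    then have "b < 0" using False by (simp add: zero_le_mult_iff not_le)
    then have "b ^ n < 0" "\<bar>b\<bar> ^ n = - (b ^ n)" using odd by (simp_all add: power_minus_odd)
    moreover have "0 \<le> a ^ n" using True by simp
    ultimately have "\<bar>a ^ n - b ^ n\<bar> = a ^ n + \<bar>b\<bar> ^ n" by linarith
    then show ?thesis using True by simp
  next
    case a: False
    then have "0 \<le> b" using False by (simp add: zero_le_mult_iff not_le)
    have "a ^ n < 0" "\<bar>a\<bar> ^ n = - (a ^ n)" using a odd by (simp_all add: power_minus_odd)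
    moreover have "0 \<le> b ^ n" using \<open>0 \<le> b\<close> by simp
    ultimately have "\<bar>a ^ n - b ^ n\<bar> = \<bar>a\<bar> ^ n + b ^ n" by linarith
    then show ?thesis using \<open>0 \<le> b\<close> by simp
  qed
  let ?M = "max \<bar>a\<bar> \<bar>b\<bar>"
  have "\<bar>a - b\<bar> ^ n \<le> (2 * ?M) ^ n" by (intro power_mono) auto
  also have "\<dots> = 2 ^ n * ?M ^ n" by (rule power_mult_distrib)
  also have "\<dots> \<le> 2 ^ n * (\<bar>a\<bar> ^ n + \<bar>b\<bar> ^ n)"
    by (intro mult_left_mono) (auto simp: max_def)
  finally show ?thesis unfolding eq .
qed

section \<open>Divisors at a fixed frequency, non-real and rational coefficients\<close>

lemma int_translates_bounded_below:
  fixes z :: complex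
  shows "\<exists>C>0. \<forall>k::int. of_int k + z \<noteq> 0 \<longrightarrow> C \<le> norm (of_int k + z)"
proof -
  define N where "N = \<lceil>norm z\<rceil> + 1"
  define A where "A = (\<lambda>k::int. norm (of_int k + z)) ` {k \<in> {- N..N}. of_int k + z \<noteq> 0}"
  have A: "finite A"
    unfolding A_def by (rule finite_imageI, rule finite_subset[of _ "{- N..N}"]) auto
  have "Min (insert 1 A) \<le> norm (of_int k + z)" if k: "of_int k + z \<noteq> 0" for k :: int
  proof (cases "k \<in> {- N..N}")
    case True
    then have "norm (of_int k + z) \<in> insert 1 A" using k by (auto simp: A_def)
    then show ?thesis using A by (intro Min_le) auto
  next
    case False
    then have "N + 1 \<le> \<bar>k\<bar>" by auto
    then have "norm z + 1 \<le> \<bar>real_of_int k\<bar>" unfolding N_def by linarith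
    moreover have "norm (of_int k :: complex) \<le> norm (of_int k + z) + norm z"
      using norm_triangle_ineq4[of "of_int k + z" z] by simp
    ultimately have "1 \<le> norm (of_int k + z)" by simp
    moreover have "Min (insert 1 A) \<le> 1" using A by (intro Min_le) auto
    ultimately show ?thesis by linarith
  qed
  moreover have "0 < Min (insert 1 A)"
    using A by (subst Min_gr_iff) (auto simp: A_def)
  ultimately show ?thesis by blast
qed

text \<open>For fixed \<xi> each component runs through an integer translate of one number, which is
  a discrete set. This treats the frequency 0, where the symbol is unrestricted, and later excludes
  frequencies that would give a denominator below 2.\<close>

lemma symbol_size_fixed_mode:
  fixes s :: "'n::finite \<Rightarrow> int \<Rightarrow> complex"
  shows "\<exists>C>0. \<forall>m\<in>lattice. \<lfloor>snd m\<rfloor> = \<xi> \<and> symbol_size s m \<noteq> 0 \<longrightarrow> C \<le> symbol_size s m"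
proof -
  obtain C where C: "\<And>j. C j > 0" "\<And>j (k::int). of_int k + s j \<xi> \<noteq> 0 \<Longrightarrow> C j \<le> norm (of_int k + s j \<xi>)"
    using int_translates_bounded_below[of "s _ \<xi>"] by metis
  have "Min (range C) \<le> symbol_size s m"
    if m: "m \<in> lattice" "\<lfloor>snd m\<rfloor> = \<xi>" "symbol_size s m \<noteq> 0" for m
  proof -
    obtain k where k: "\<And>j. fst m $ j = of_int (k j)" using fst_lattice_Ints[OF m(1)] by blast
    obtain j where j: "norm (total_symbol s j m) = symbol_size s m" using symbol_size_attained by blast
    have w: "total_symbol s j m = of_int (k j) + s j \<xi>"
      by (simp add: total_symbol_def k m(2))
    have "Min (range C) \<le> C j" by (intro Min_le) auto
    also have "\<dots> \<le> norm (total_symbol s j m)"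
      unfolding w using j m(3) w by (intro C(2)) auto
    finally show ?thesis using j by simp
  qed
  moreover have "0 < Min (range C)" using C(1) by (subst Min_gr_iff) auto
  ultimately show ?thesis by blast
qed

lemma poly_growth_power_symbol:
  assumes "\<And>\<xi>. \<xi> \<noteq> 0 \<Longrightarrow> \<sigma> \<xi> = c * of_real (real_of_int \<bar>\<xi>\<bar> powr \<kappa>)" "\<kappa> \<le> real N"
  shows "poly_growth \<sigma>"
  unfolding poly_growth_def
proof (intro exI allI)
  fix \<xi>
  \<comment> \<open>The summand \<open>norm (\<sigma> 0)\<close> covers the unrestricted value at
    0.\<close>
  show "norm (\<sigma> \<xi>) \<le> (norm (\<sigma> 0) + norm c) * (1 + \<bar>real_of_int \<xi>\<bar>) ^ N"
  proof (cases "\<xi> = 0")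
    case False
    then have ge1: "1 \<le> real_of_int \<bar>\<xi>\<bar>" by linarith
    have "real_of_int \<bar>\<xi>\<bar> powr \<kappa> \<le> real_of_int \<bar>\<xi>\<bar> powr real N"
      using ge1 assms(2) by (intro powr_mono) auto
    also have "\<dots> = real_of_int \<bar>\<xi>\<bar> ^ N" using ge1 by (subst powr_realpow) auto
    also have "\<dots> \<le> (1 + \<bar>real_of_int \<xi>\<bar>) ^ N" by (intro power_mono) auto
    finally have "norm c * real_of_int \<bar>\<xi>\<bar> powr \<kappa> \<le> (norm (\<sigma> 0) + norm c) * (1 + \<bar>real_of_int \<xi>\<bar>) ^ N"
      by (intro mult_mono) auto
    then show ?thesis using assms(1)[OF False] by (simp add: norm_mult)
  qed simp
qed

text \<open>The integer shift is real and cannot cancel the imaginary part, which has modulus at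
  least \<open>|Im c|\<close> for every nonzero frequency.\<close>

lemma no_small_divisors_complex:
  fixes s :: "'n::finite \<Rightarrow> int \<Rightarrow> complex"
  assumes s: "\<And>\<xi>. \<xi> \<noteq> 0 \<Longrightarrow> s j \<xi> = c * of_real (real_of_int \<bar>\<xi>\<bar> powr \<kappa>)"
    and c: "Im c \<noteq> 0" and \<kappa>: "0 \<le> \<kappa>"
  shows "no_small_divisors s"
proof -
  obtain C where C: "C > 0" "\<And>m. m \<in> lattice \<Longrightarrow> \<lfloor>snd m\<rfloor> = 0 \<Longrightarrow> symbol_size s m \<noteq> 0 \<Longrightarrow> C \<le> symbol_size s m"
    using symbol_size_fixed_mode[of 0 s] by blast
  have "min C \<bar>Im c\<bar> \<le> symbol_size s m" if m: "m \<in> lattice" "symbol_size s m \<noteq> 0" for m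
  proof (cases "\<lfloor>snd m\<rfloor> = 0")
    case False
    then have "1 \<le> real_of_int \<bar>\<lfloor>snd m\<rfloor>\<bar>" by linarith
    then have "1 \<le> real_of_int \<bar>\<lfloor>snd m\<rfloor>\<bar> powr \<kappa>" using \<kappa> by (intro ge_one_powr_ge_zero) auto
    then have "\<bar>Im c\<bar> * 1 \<le> \<bar>Im c\<bar> * real_of_int \<bar>\<lfloor>snd m\<rfloor>\<bar> powr \<kappa>"
      by (intro mult_left_mono) auto
    also have "\<dots> = \<bar>Im (total_symbol s j m)\<bar>"
      by (simp add: total_symbol_def s[OF False] abs_mult)
    also have "\<dots> \<le> symbol_size s m"
      using abs_Im_le_cmod total_symbol_le_size by (rule order_trans)
    finally show ?thesis by simp
  qed (use C(2)[OF m(1)] m(2) in simp)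
  then show ?thesis
    unfolding no_small_divisors_def using C(1) c
    by (intro exI[of _ "min C \<bar>Im c\<bar>"]) (auto intro!: exI[of _ 0])
qed

text \<open>With a common denominator \<open>B\<close>, a nonzero error is at least
  \<open>1 / (B ^ \<mu> * q)\<close>, which contradicts an error of order \<open>q ^ (- l)\<close>
  for large \<open>l\<close>.\<close>

lemma rational_not_approximable:
  fixes \<alpha> :: "real^'n::finite"
  assumes "rational_vec \<alpha>"
  shows "\<not> approximable \<mu> \<alpha>"
proof
  assume "approximable \<mu> \<alpha>"
  then obtain C and P :: "nat \<Rightarrow> int^'n" and q :: "nat \<Rightarrow> nat" where C: "C > 0"
    and q: "\<And>l. q l \<ge> 2"
    and pos: "\<And>l. 0 < (MAX j. \<bar>(\<alpha> $ j) ^ \<mu> - of_int (P l $ j) ^ \<mu> / of_nat (q l)\<bar>)"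
    and less: "\<And>l. (MAX j. \<bar>(\<alpha> $ j) ^ \<mu> - of_int (P l $ j) ^ \<mu> / of_nat (q l)\<bar>) < C / real (q l) ^ l"
    unfolding approximable_def by blast
  have "\<forall>j. \<exists>a b::int. b > 0 \<and> \<alpha> $ j = of_int a / of_int b"
    using assms unfolding rational_vec_def by (metis Rats_cases')
  then obtain a b :: "'n \<Rightarrow> int" where ab: "\<And>j. b j > 0" "\<And>j. \<alpha> $ j = of_int (a j) / of_int (b j)"
    by metis
  define B where "B = (\<Prod>j\<in>UNIV. b j)"
  have B: "B > 0" using ab(1) by (simp add: B_def prod_pos)
  have "\<exists>A::int. \<alpha> $ j = of_int A / of_int B" for j
  proof -
    define R where "R = (\<Prod>i\<in>UNIV - {j}. b i)"
    have "B = b j * R" unfolding B_def R_def by (simp add: prod.remove)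
    moreover from this B have "R \<noteq> 0" by auto
    ultimately have "\<alpha> $ j = of_int (a j * R) / of_int B"
      using ab(2)[of j] by simp
    then show ?thesis by blast
  qed
  then obtain A :: "'n \<Rightarrow> int" where A: "\<And>j. \<alpha> $ j = of_int (A j) / of_int B" by metis
  have "2 ^ k < C * of_int B ^ \<mu>" for k :: nat
  proof -
    \<comment> \<open>One power of \<open>q\<close> is spent on the denominator of the error, so
      \<open>k\<close> powers remain.\<close>
    define l where "l = Suc k"
    let ?e = "\<lambda>j. \<bar>(\<alpha> $ j) ^ \<mu> - of_int (P l $ j) ^ \<mu> / of_nat (q l)\<bar>"
    have q0: "0 < real (q l)" using q[of l] by simp
    have "(MAX j. ?e j) \<in> range ?e" by (rule Max_in) auto
    then obtain j where j: "(MAX j. ?e j) = ?e j" by (rule imageE)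
    have "(\<alpha> $ j) ^ \<mu> - of_int (P l $ j) ^ \<mu> / of_nat (q l) =
        of_int (A j ^ \<mu> * int (q l) - (P l $ j) ^ \<mu> * B ^ \<mu>) / (of_int B ^ \<mu> * real (q l))"
      (is "_ = of_int ?z / _")
      using B q0 by (simp add: A power_divide field_simps)
    then have e: "?e j = \<bar>of_int ?z\<bar> / (of_int B ^ \<mu> * real (q l))"
      using B q0 by (simp add: abs_mult)
    have "?e j > 0" using pos[of l] unfolding j .
    have "?z \<noteq> 0"
    proof
      assume z: "?z = 0"
      have "?e j = 0" unfolding e z by simp
      with \<open>?e j > 0\<close> show False by simp
    qed
    then have "1 \<le> \<bar>?z\<bar>" by linarith
    then have "1 \<le> \<bar>real_of_int ?z\<bar>" by linarith
    then have "1 / (of_int B ^ \<mu> * real (q l)) \<le> ?e j"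
      unfolding e using B q0 by (intro divide_right_mono) auto
    also have "\<dots> < C / real (q l) ^ l" using less[of l] unfolding j .
    finally have "real (q l) ^ l < C * (of_int B ^ \<mu> * real (q l))"
      using B q0 by (simp add: field_simps)
    then have "real (q l) ^ k * real (q l) < (C * of_int B ^ \<mu>) * real (q l)"
      by (simp add: l_def mult_ac)
    then have "real (q l) ^ k < C * of_int B ^ \<mu>" using q0 by simp
    moreover have "(2::real) ^ k \<le> real (q l) ^ k" using q[of l] by (intro power_mono) auto
    ultimately show ?thesis by linarith
  qed
  moreover obtain k where "C * of_int B ^ \<mu> < 2 ^ k"
    using real_arch_pow[of 2 "C * of_int B ^ \<mu>"] by auto
  ultimately show False by (meson less_asym)
qed

section \<open>Real coefficients: divisors and approximations\<close>

locale real_power_symbol =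
  fixes \<rho> \<mu> :: nat and \<alpha> :: "real^'n::finite" and s :: "'n \<Rightarrow> int \<Rightarrow> complex"
  assumes \<rho>: "\<rho> > 0" and \<mu>: "\<mu> > 0"
    and s: "\<And>j \<xi>. \<xi> \<noteq> 0 \<Longrightarrow> s j \<xi> = of_real (\<alpha> $ j * real_of_int \<bar>\<xi>\<bar> powr (real \<rho> / real \<mu>))"
begin

abbreviation "X \<xi> \<equiv> real_of_int \<bar>\<xi>\<bar> powr (real \<rho> / real \<mu>)"

lemma X_power: "\<xi> \<noteq> 0 \<Longrightarrow> X \<xi> ^ \<mu> = real_of_int \<bar>\<xi>\<bar> ^ \<rho>"
proof -
  assume "\<xi> \<noteq> 0"
  then have pos: "0 < real_of_int \<bar>\<xi>\<bar>" by simp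
  then have "X \<xi> ^ \<mu> = X \<xi> powr real \<mu>" by (subst powr_realpow) auto
  also have "\<dots> = real_of_int \<bar>\<xi>\<bar> powr real \<rho>" using \<mu> by (simp add: powr_powr)
  also have "\<dots> = real_of_int \<bar>\<xi>\<bar> ^ \<rho>" using pos by (rule powr_realpow)
  finally show ?thesis .
qed

lemma X_ge_1: "\<xi> \<noteq> 0 \<Longrightarrow> 1 \<le> X \<xi>"
  by (intro ge_one_powr_ge_zero) auto

lemma total_symbol_real:
  "\<lfloor>snd m\<rfloor> \<noteq> 0 \<Longrightarrow> total_symbol s j m = of_real (\<alpha> $ j * X \<lfloor>snd m\<rfloor> + fst m $ j)"
  by (simp add: total_symbol_def s)

text \<open>An approximation with denominator \<open>q\<close> and error below
  \<open>C / q ^ l\<close> produces a frequency of norm at most a fixed power of \<open>q\<close>,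
  whose size has \<open>\<mu>\<close>-th power at most a fixed power of \<open>q\<close> divided by
  \<open>q ^ l\<close>. A polynomial lower bound on sizes would bound \<open>q ^ l\<close> by a
  fixed power of \<open>q\<close>, which is impossible for large \<open>l\<close> as
  \<open>q\<close> is at least 2.\<close>

lemma approximable_imp_small_divisors:
  assumes cop: "coprime \<rho> \<mu>" and appr: "approximable \<mu> \<alpha>"
  shows "\<not> no_small_divisors s"
proof
  assume "no_small_divisors s"
  then obtain C' N where C': "C' > 0"
    "\<And>m. m \<in> lattice \<Longrightarrow> symbol_size s m \<noteq> 0 \<Longrightarrow> C' \<le> symbol_size s m * (1 + norm m) ^ N"
    unfolding no_small_divisors_def by blast
  obtain C and P :: "nat \<Rightarrow> int^'n" and q :: "nat \<Rightarrow> nat" where C: "C > 0"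
    and q: "\<And>l. q l \<ge> 2"
    and pos: "\<And>l. 0 < (MAX j. \<bar>(\<alpha> $ j) ^ \<mu> - of_int (P l $ j) ^ \<mu> / of_nat (q l)\<bar>)"
    and less: "\<And>l. (MAX j. \<bar>(\<alpha> $ j) ^ \<mu> - of_int (P l $ j) ^ \<mu> / of_nat (q l)\<bar>) < C / real (q l) ^ l"
    using appr unfolding approximable_def by blast
  \<comment> \<open>Since \<open>\<rho> t = \<mu> a + 1\<close>, the fraction \<open>P\<^sup>\<mu> / q\<close> equals \<open>(P q\<^sup>a)\<^sup>\<mu> / (q\<^sup>t)\<^sup>\<rho>\<close>: the frequency
    \<open>\<xi> = q\<^sup>t\<close> realises an arbitrary denominator.\<close>
  obtain t a where ta: "\<rho> * t = \<mu> * a + 1"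
  proof (cases "\<mu> = 1")
    case True
    then show ?thesis using that[of 1 "\<rho> - 1"] \<rho> by simp
  next
    case False
    then show ?thesis using coprime_bezout_strong[OF cop] that by blast
  qed
  then have t: "t > 0" by (cases t) auto
  \<comment> \<open>With \<open>Q = q\<close> and \<open>\<xi> = q ^ t\<close>, the quantity
    \<open>Q ^ b\<close> is the \<open>\<mu>\<close>-th power of \<open>|\<xi>|^\<kappa>\<close>.
    The constants \<open>D\<close> and \<open>E\<close> are read off below: \<open>D * Q ^ b\<close>
    bounds \<open>1 + norm m\<close>, and \<open>E\<close> collects the constants after raising the
    lower bound to the power \<open>\<mu>\<close>.\<close>
  define b where "b = \<mu> * a + 1"
  define D where "D = 2 + CARD('n) * (2 * (C + 1)) + (\<Sum>j\<in>UNIV. \<bar>\<alpha> $ j\<bar>)"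
  define E where "E = 2 ^ \<mu> * C * D ^ (N * \<mu>) / C' ^ \<mu>"
  have "real (q l) ^ l \<le> E * real (q l) ^ (b + b * (N * \<mu>))" for l
  proof -
    define Q where "Q = real (q l)"
    have Q: "2 \<le> Q" using q[of l] by (simp add: Q_def)
    define \<xi> where "\<xi> = int (q l) ^ t"
    have \<xi>: "1 \<le> \<xi>" using q[of l] by (simp add: \<xi>_def)
    \<comment> \<open>For even \<open>\<mu>\<close> only \<open>P\<^sup>\<mu>\<close> is given, so \<open>P\<close> must be given the sign of \<open>\<alpha>\<close>.\<close>
    define P' where "P' j = (if even \<mu> \<and> \<alpha> $ j * of_int (P l $ j) < 0 then - (P l $ j) else P l $ j)" for j
    have P'_power: "P' j ^ \<mu> = (P l $ j) ^ \<mu>" for j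
      by (simp add: P'_def)
    have P'_sign: "odd \<mu> \<or> 0 \<le> \<alpha> $ j * of_int (P' j)" for j
      by (auto simp: P'_def)
    define m :: "(real^'n) \<times> real" where "m = (\<chi> j. - of_int (P' j) * Q ^ a, of_int \<xi>)"
    have Q_int: "Q ^ a = of_int (int (q l) ^ a)" by (simp add: Q_def)
    have m: "m \<in> lattice"
      unfolding m_def mem_lattice_Pair Q_int
      by (auto simp: lattice_def Basis_vec_def inner_axis intro!: Ints_mult Ints_power)
    have floor_m: "\<lfloor>snd m\<rfloor> = \<xi>" "\<lfloor>snd m\<rfloor> \<noteq> 0" using \<xi> by (auto simp: m_def)
    define Y where "Y = X \<xi>"
    have Y1: "1 \<le> Y" using X_ge_1[of \<xi>] \<xi> by (simp add: Y_def)
    have Y_power: "Y ^ \<mu> = Q ^ b"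
    proof -
      have "Y ^ \<mu> = real_of_int \<bar>\<xi>\<bar> ^ \<rho>" unfolding Y_def using \<xi> by (intro X_power) auto
      also have "\<dots> = Q ^ (\<rho> * t)" using \<xi> by (simp add: \<xi>_def Q_def power_mult[symmetric] mult.commute)
      finally show ?thesis by (simp add: ta b_def)
    qed
    have w: "total_symbol s j m = of_real (\<alpha> $ j * Y - of_int (P' j) * Q ^ a)" for j
      using total_symbol_real[OF floor_m(2)] by (simp add: floor_m(1) Y_def m_def)
    let ?e = "\<lambda>j. \<bar>(\<alpha> $ j) ^ \<mu> - of_int (P l $ j) ^ \<mu> / of_nat (q l)\<bar>"
    have powdiff: "\<bar>(\<alpha> $ j * Y) ^ \<mu> - (of_int (P' j) * Q ^ a) ^ \<mu>\<bar> = Q ^ b * ?e j" for j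
    proof -
      have "(of_int (P' j) * Q ^ a) ^ \<mu> = of_int (P l $ j) ^ \<mu> * Q ^ (\<mu> * a)"
        using P'_power[of j] by (simp add: power_mult_distrib power_mult[symmetric] mult.commute flip: of_int_power)
      also have "\<dots> = Q ^ b * (of_int (P l $ j) ^ \<mu> / Q)"
        using Q by (simp add: b_def)
      finally have "(\<alpha> $ j * Y) ^ \<mu> - (of_int (P' j) * Q ^ a) ^ \<mu>
          = Q ^ b * ((\<alpha> $ j) ^ \<mu> - of_int (P l $ j) ^ \<mu> / Q)"
        by (simp add: power_mult_distrib Y_power algebra_simps)
      then show ?thesis using Q by (simp add: abs_mult Q_def)
    qed
    have e_less: "?e j < C / Q ^ l" for j
    proof -
      have "?e j \<le> (MAX j. ?e j)" by (intro Max_ge) auto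
      then show ?thesis using less[of l] by (simp add: Q_def)
    qed
    have w_le: "norm (total_symbol s j m) ^ \<mu> \<le> 2 ^ \<mu> * (Q ^ b * (C / Q ^ l))" for j
    proof -
      have sign: "odd \<mu> \<or> 0 \<le> (\<alpha> $ j * Y) * (of_int (P' j) * Q ^ a)"
      proof (cases "odd \<mu>")
        case False
        then have "0 \<le> (\<alpha> $ j * of_int (P' j)) * (Y * Q ^ a)"
          using P'_sign[of j] Y1 Q
          by (intro mult_nonneg_nonneg[of "\<alpha> $ j * of_int (P' j)" "Y * Q ^ a"]) auto
        then show ?thesis by (simp add: mult_ac)
      qed simp
      have "norm (total_symbol s j m) ^ \<mu> = \<bar>\<alpha> $ j * Y - of_int (P' j) * Q ^ a\<bar> ^ \<mu>"
        unfolding w norm_of_real ..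
      also have "\<dots> \<le> 2 ^ \<mu> * (Q ^ b * ?e j)"
        unfolding powdiff[symmetric] by (rule power_abs_diff_le[OF sign \<mu>])
      also have "\<dots> \<le> 2 ^ \<mu> * (Q ^ b * (C / Q ^ l))"
        using e_less[of j] Q by (intro mult_left_mono) auto
      finally show ?thesis .
    qed
    let ?S = "symbol_size s m"
    have size_le: "?S ^ \<mu> \<le> 2 ^ \<mu> * (Q ^ b * (C / Q ^ l))"
      using symbol_size_attained[of s m] w_le by metis
    \<comment> \<open>Here the inexactness of the approximation is used: a zero of the symbol would
      make every component exact.\<close>
    have size_nz: "?S \<noteq> 0"
    proof
      assume "?S = 0"
      then have "total_symbol s j m = 0" for j
        using total_symbol_le_size[of s j m] by simp
      then have "\<alpha> $ j * Y = of_int (P' j) * Q ^ a" for j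
        using w[of j] by (metis eq_iff_diff_eq_0 of_real_eq_0_iff)
      then have "?e j = 0" for j using powdiff[of j] Q by simp
      then show False using pos[of l] by simp
    qed
    have Qb1: "1 \<le> Q ^ b" using Q by (intro one_le_power) auto
    have Ql1: "1 \<le> Q ^ l" using Q by (intro one_le_power) auto
    \<comment> \<open>A crude bound without the gain in \<open>l\<close>; it serves to control the
      integer part of the frequency through the triangle inequality.\<close>
    have size_le2: "?S \<le> 2 * (C + 1) * Q ^ b"
    proof (rule power_le_imp_le_base[where n = "\<mu> - 1"])
      have "C / Q ^ l \<le> C / 1" using C Ql1 by (intro divide_left_mono) auto
      also have "\<dots> \<le> C + 1" by simp
      also have "\<dots> \<le> (C + 1) ^ \<mu>" using C \<mu> by (intro self_le_power) auto
      finally have "C / Q ^ l \<le> (C + 1) ^ \<mu>" .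
      moreover have "Q ^ b \<le> (Q ^ b) ^ \<mu>" by (rule self_le_power[OF Qb1 \<mu>])
      ultimately have "Q ^ b * (C / Q ^ l) \<le> (Q ^ b) ^ \<mu> * (C + 1) ^ \<mu>"
        using C Q by (intro mult_mono) simp_all
      then have "?S ^ \<mu> \<le> 2 ^ \<mu> * ((Q ^ b) ^ \<mu> * (C + 1) ^ \<mu>)"
        using size_le by (intro order_trans[OF size_le] mult_left_mono) simp_all
      also have "\<dots> = (2 * (C + 1) * Q ^ b) ^ \<mu>" by (simp only: power_mult_distrib mult_ac)
      finally show "?S ^ Suc (\<mu> - 1) \<le> (2 * (C + 1) * Q ^ b) ^ Suc (\<mu> - 1)" using \<mu> by simp
      show "0 \<le> 2 * (C + 1) * Q ^ b" using C Q by simp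
    qed
    have Y_le: "Y \<le> Q ^ b" using self_le_power[of Y \<mu>] Y1 \<mu> Y_power by simp
    have fst_le: "\<bar>fst m $ j\<bar> \<le> 2 * (C + 1) * Q ^ b + \<bar>\<alpha> $ j\<bar> * Q ^ b" for j
    proof -
      have "\<bar>fst m $ j\<bar> \<le> \<bar>\<alpha> $ j * Y - of_int (P' j) * Q ^ a\<bar> + \<bar>\<alpha> $ j * Y\<bar>"
        by (simp add: m_def)
      moreover have "\<bar>\<alpha> $ j * Y - of_int (P' j) * Q ^ a\<bar> \<le> ?S"
        using total_symbol_le_size[of s j m] unfolding w norm_of_real .
      moreover have "\<bar>\<alpha> $ j * Y\<bar> \<le> \<bar>\<alpha> $ j\<bar> * Q ^ b"
        using Y1 Y_le by (simp add: abs_mult mult_left_mono)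
      ultimately show ?thesis using size_le2 by linarith
    qed
    have "norm (fst m) \<le> (\<Sum>j\<in>UNIV. \<bar>fst m $ j\<bar>)" by (rule norm_le_l1_cart)
    also have "\<dots> \<le> (\<Sum>j\<in>UNIV. 2 * (C + 1) * Q ^ b + \<bar>\<alpha> $ j\<bar> * Q ^ b)"
      by (intro sum_mono fst_le)
    also have "\<dots> = CARD('n) * (2 * (C + 1)) * Q ^ b + (\<Sum>j\<in>UNIV. \<bar>\<alpha> $ j\<bar>) * Q ^ b"
      by (simp add: sum.distrib sum_distrib_right)
    finally have fst_norm: "norm (fst m) \<le> CARD('n) * (2 * (C + 1)) * Q ^ b + (\<Sum>j\<in>UNIV. \<bar>\<alpha> $ j\<bar>) * Q ^ b" .
    have snd_norm: "norm (snd m) \<le> Q ^ b"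
    proof -
      have "t \<le> \<rho> * t" using \<rho> by simp
      then have "t \<le> b" unfolding b_def ta[symmetric] .
      then have "Q ^ t \<le> Q ^ b" using Q by (intro power_increasing) auto
      then show ?thesis by (simp add: m_def \<xi>_def Q_def)
    qed
    have "1 + norm m \<le> 1 + (norm (fst m) + norm (snd m))"
      using norm_Pair_le[of "fst m" "snd m"] by simp
    also have "\<dots> \<le> Q ^ b + (CARD('n) * (2 * (C + 1)) * Q ^ b + (\<Sum>j\<in>UNIV. \<bar>\<alpha> $ j\<bar>) * Q ^ b + Q ^ b)"
      using fst_norm snd_norm Qb1 by linarith
    also have "\<dots> = D * Q ^ b" by (simp add: D_def algebra_simps)
    finally have "1 + norm m \<le> D * Q ^ b" .
    then have norm_le: "(1 + norm m) ^ N \<le> (D * Q ^ b) ^ N"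
      by (intro power_mono) auto
    have D0: "0 \<le> D" using C by (simp add: D_def sum_nonneg)
    have "C' ^ \<mu> \<le> (?S * (D * Q ^ b) ^ N) ^ \<mu>"
    proof (rule power_mono)
      have "C' \<le> ?S * (1 + norm m) ^ N" by (rule C'(2)[OF m size_nz])
      also have "\<dots> \<le> ?S * (D * Q ^ b) ^ N"
        by (intro mult_left_mono norm_le symbol_size_nonneg)
      finally show "C' \<le> ?S * (D * Q ^ b) ^ N" .
    qed (use C' in simp)
    also have "\<dots> = ?S ^ \<mu> * (D ^ (N * \<mu>) * Q ^ (b * (N * \<mu>)))"
      by (simp add: power_mult_distrib power_mult[symmetric] mult_ac)
    also have "\<dots> \<le> (2 ^ \<mu> * (Q ^ b * (C / Q ^ l))) * (D ^ (N * \<mu>) * Q ^ (b * (N * \<mu>)))"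
      using size_le D0 Q by (intro mult_right_mono) auto
    finally have "C' ^ \<mu> * Q ^ l \<le> 2 ^ \<mu> * C * D ^ (N * \<mu>) * Q ^ (b + b * (N * \<mu>))"
      using Q by (simp add: field_simps power_add)
    then show ?thesis
      using C'(1) by (simp add: E_def Q_def field_simps)
  qed
  note bound = this
  have "2 ^ k \<le> E" for k :: nat
  proof -
    let ?d = "b + b * (N * \<mu>)"
    \<comment> \<open>This choice of \<open>l\<close> cancels the fixed power of \<open>q\<close>
      and leaves \<open>q ^ k\<close> bounded by \<open>E\<close> for every
      \<open>k\<close>.\<close>
    let ?l = "?d + k"
    have "0 < real (q ?l) ^ ?d" using q[of ?l] by simp
    moreover have "real (q ?l) ^ ?d * real (q ?l) ^ k \<le> real (q ?l) ^ ?d * E"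
      using bound[of ?l] by (simp only: power_add mult_ac)
    ultimately have "real (q ?l) ^ k \<le> E" by simp
    moreover have "(2::real) ^ k \<le> real (q ?l) ^ k" using q[of ?l] by (intro power_mono) auto
    ultimately show ?thesis by linarith
  qed
  moreover obtain k where "E < 2 ^ k" using real_arch_pow[of 2 E] by auto
  ultimately show False by (meson not_less)
qed

text \<open>A small divisor at \<xi> gives \<open>\<alpha>\<close> times
  \<open>|\<xi>|^\<kappa>\<close> close to an integer vector; the \<open>\<mu>\<close>-th powers are
  then close, with denominator \<open>q = |\<xi>|^\<rho>\<close>.\<close>

lemma small_divisors_imp_approximable:
  assumes neg: "\<not> no_small_divisors s"
  shows "approximable \<mu> \<alpha>"
proof -
  have "\<forall>\<xi>. \<exists>C>0. \<forall>m\<in>lattice. \<lfloor>snd m\<rfloor> = \<xi> \<and> symbol_size s m \<noteq> 0 \<longrightarrow> C \<le> symbol_size s m"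
    using symbol_size_fixed_mode by blast
  then obtain C0 where C0: "\<And>\<xi>. C0 \<xi> > 0"
    "\<And>m. m \<in> lattice \<Longrightarrow> symbol_size s m \<noteq> 0 \<Longrightarrow> C0 \<lfloor>snd m\<rfloor> \<le> symbol_size s m"
    by metis
  \<comment> \<open>The threshold \<open>c\<close> is the minimum of three kinds of numbers: the
    lower bounds at frequencies -1, 0 and 1, which force \<open>q\<close> to be at least 2; the
    nonzero \<open>|\<alpha> $ j|\<close>, which exclude spurious exactness from a sign; and 1,
    which normalises the estimates.\<close>
  define A where "A = insert 1 (C0 ` {-1..1} \<union> (\<lambda>j. \<bar>\<alpha> $ j\<bar>) ` {j. \<alpha> $ j \<noteq> 0})"
  define c where "c = Min A"
  have A: "finite A" by (simp add: A_def)
  have c0: "0 < c" unfolding c_def using A C0(1) by (subst Min_gr_iff) (auto simp: A_def)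
  have c_le: "c \<le> x" if "x \<in> A" for x unfolding c_def using A that by simp
  define a where "a = (\<Sum>j\<in>UNIV. \<bar>\<alpha> $ j\<bar>)"
  have a: "\<bar>\<alpha> $ j\<bar> \<le> a" for j unfolding a_def by (rule member_le_sum) auto
  then have a0: "0 \<le> a" by (rule order_trans[rotated]) simp
  define K where "K = \<mu> * (a + 1) ^ \<mu>"
  have K0: "K > 0" using \<mu> a0 by (simp add: K_def)
  define good where "good l P q \<longleftrightarrow> q \<ge> 2 \<and>
        0 < (MAX j. \<bar>(\<alpha> $ j) ^ \<mu> - of_int (P $ j) ^ \<mu> / of_nat q\<bar>) \<and>
        (MAX j. \<bar>(\<alpha> $ j) ^ \<mu> - of_int (P $ j) ^ \<mu> / of_nat q\<bar>) < K / real q ^ l"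
    for l and P :: "int^'n" and q :: nat
  have "\<exists>P q. good l P q" for l
  proof -
    \<comment> \<open>The exponent \<open>\<rho> * l\<close> is what
      \<open>q ^ l = |\<xi>| ^ (\<rho> * l)\<close> requires.\<close>
    obtain m where m: "m \<in> lattice" "symbol_size s m \<noteq> 0" "symbol_size s m * (1 + norm m) ^ (\<rho> * l) < c"
      using neg c0 unfolding no_small_divisors_def by (metis linorder_not_less)
    let ?S = "symbol_size s m"
    have S0: "0 < ?S" using m(2) symbol_size_nonneg[of s m] by simp
    have "?S * 1 \<le> ?S * (1 + norm m) ^ (\<rho> * l)"
      using S0 by (intro mult_left_mono one_le_power) auto
    then have S_less: "?S < c" using m(3) by simp
    define \<xi> where "\<xi> = \<lfloor>snd m\<rfloor>"
    have "\<xi> \<notin> {-1..1}"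
    proof
      assume "\<xi> \<in> {-1..1}"
      then have "C0 \<xi> \<in> A" unfolding A_def by blast
      then show False using C0(2)[OF m(1,2)] c_le S_less by (fastforce simp: \<xi>_def)
    qed
    then have \<xi>: "2 \<le> \<bar>\<xi>\<bar>" by auto
    then have \<xi>0: "\<xi> \<noteq> 0" by auto
    define Y where "Y = X \<xi>"
    have Y1: "1 \<le> Y" unfolding Y_def by (rule X_ge_1[OF \<xi>0])
    define q where "q = nat \<bar>\<xi>\<bar> ^ \<rho>"
    have rq: "real q = real_of_int \<bar>\<xi>\<bar> ^ \<rho>" by (simp add: q_def)
    have Y_power: "Y ^ \<mu> = real q" unfolding Y_def rq by (rule X_power[OF \<xi>0])
    have "2 \<le> nat \<bar>\<xi>\<bar>" using \<xi> by simp
    also have "\<dots> \<le> q" unfolding q_def using \<rho> \<open>2 \<le> nat \<bar>\<xi>\<bar>\<close> by (intro self_le_power) auto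
    finally have q2: "2 \<le> q" .
    obtain k where k: "\<And>j. fst m $ j = of_int (k j)" using fst_lattice_Ints[OF m(1)] by blast
    define P :: "int^'n" where "P = (\<chi> j. - k j)"
    have w: "total_symbol s j m = of_real (\<alpha> $ j * Y - of_int (P $ j))" for j
      using total_symbol_real[of m j] \<xi>0 by (simp add: \<xi>_def Y_def k P_def)
    have w_le: "\<bar>\<alpha> $ j * Y - of_int (P $ j)\<bar> \<le> ?S" for j
      using total_symbol_le_size[of s j m] unfolding w norm_of_real .
    let ?e = "\<lambda>j. \<bar>(\<alpha> $ j) ^ \<mu> - of_int (P $ j) ^ \<mu> / of_nat q\<bar>"
    have e_eq: "?e j * Y ^ \<mu> = \<bar>(\<alpha> $ j * Y) ^ \<mu> - of_int (P $ j) ^ \<mu>\<bar>" for j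
    proof -
      have "((\<alpha> $ j) ^ \<mu> - of_int (P $ j) ^ \<mu> / of_nat q) * Y ^ \<mu> = (\<alpha> $ j * Y) ^ \<mu> - of_int (P $ j) ^ \<mu>"
        using q2 by (simp add: Y_power left_diff_distrib power_mult_distrib)
      then show ?thesis using Y1 by (metis abs_mult abs_of_nonneg order_trans zero_le_one zero_le_power)
    qed
    have e_le: "?e j \<le> K * ?S" for j
    proof -
      \<comment> \<open>Both numbers whose powers are compared are at most
        \<open>(a + 1) * Y\<close>, because their distance is at most \<open>?S\<close>, which is
        below 1. This is the origin of \<open>K\<close>.\<close>
      let ?M = "(a + 1) * Y"
      have "c \<le> 1" by (rule c_le) (simp add: A_def)
      have aY: "\<bar>\<alpha> $ j * Y\<bar> \<le> a * Y" using a[of j] Y1 by (simp add: abs_mult mult_right_mono)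
      then have M1: "\<bar>\<alpha> $ j * Y\<bar> \<le> ?M" using Y1 by (simp add: algebra_simps)
      have M2: "\<bar>of_int (P $ j)\<bar> \<le> ?M"
        using w_le[of j] aY S_less \<open>c \<le> 1\<close> Y1 by (simp add: algebra_simps)
      have "?e j * Y ^ \<mu> \<le> \<bar>\<alpha> $ j * Y - of_int (P $ j)\<bar> * (\<mu> * ?M ^ (\<mu> - 1))"
        unfolding e_eq by (rule abs_diff_power_le[OF M1 M2])
      also have "\<dots> \<le> ?S * (\<mu> * ?M ^ \<mu>)"
      proof (rule mult_mono[OF w_le])
        have "1 \<le> ?M" using a0 Y1 mult_mono[of 1 "a + 1" 1 Y] by simp
        then show "real \<mu> * ?M ^ (\<mu> - 1) \<le> real \<mu> * ?M ^ \<mu>"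
          by (intro mult_left_mono power_increasing) auto
      qed (use a0 Y1 S0 in auto)
      also have "\<dots> = (K * ?S) * Y ^ \<mu>" by (simp add: K_def power_mult_distrib)
      finally show ?thesis using Y1 by simp
    qed
    have Max_eq: "\<exists>j. (MAX j. ?e j) = ?e j"
    proof -
      have "(MAX j. ?e j) \<in> range ?e" by (rule Max_in) auto
      then show ?thesis by blast
    qed
    have "0 < (MAX j. ?e j)"
    proof -
      obtain j where j: "norm (total_symbol s j m) = ?S" using symbol_size_attained by blast
      \<comment> \<open>Equal \<open>\<mu>\<close>-th powers leave two cases. Equal bases would give
        size zero; opposite bases give \<open>?S = 2 * |\<alpha> $ j * Y|\<close>, which exceeds the
        threshold \<open>c\<close>.\<close>
      have "?e j \<noteq> 0"
      proof
        assume "?e j = 0"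
        then have "(\<alpha> $ j * Y) ^ \<mu> = of_int (P $ j) ^ \<mu>" using e_eq[of j] by simp
        then have "\<bar>\<alpha> $ j * Y\<bar> ^ \<mu> = \<bar>of_int (P $ j)\<bar> ^ \<mu>" by (simp flip: power_abs)
        then have abs_eq: "\<bar>\<alpha> $ j * Y\<bar> = \<bar>of_int (P $ j)\<bar>"
          using \<mu> by (simp add: power_eq_iff_eq_base)
        have jS: "\<bar>\<alpha> $ j * Y - of_int (P $ j)\<bar> = ?S" using j unfolding w norm_of_real .
        then have S2: "?S = 2 * \<bar>\<alpha> $ j * Y\<bar>" using abs_eq S0 by (auto simp: abs_if split: if_splits)
        then have "\<alpha> $ j \<noteq> 0" using S0 by auto
        then have "c \<le> \<bar>\<alpha> $ j\<bar>" by (intro c_le) (auto simp: A_def)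
        also have "\<dots> \<le> \<bar>\<alpha> $ j * Y\<bar>" using Y1 by (simp add: abs_mult mult_le_cancel_left1)
        finally show False using S2 S_less S0 by linarith
      qed
      then have "0 < ?e j" by simp
      also have "\<dots> \<le> (MAX j. ?e j)" by (intro Max_ge) auto
      finally show ?thesis .
    qed
    moreover have "(MAX j. ?e j) < K / real q ^ l"
    proof -
      obtain j where "(MAX j. ?e j) = ?e j" using Max_eq by blast
      then have "(MAX j. ?e j) \<le> K * ?S" using e_le by simp
      moreover have "?S * real q ^ l < 1"
      proof -
        have "real_of_int \<bar>\<xi>\<bar> = \<bar>snd m\<bar>"
          unfolding \<xi>_def by (simp only: of_int_abs snd_lattice[OF m(1)])
        then have "real_of_int \<bar>\<xi>\<bar> \<le> 1 + norm m"
          using norm_snd_le_Pair[of m] by linarith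
        then have "real_of_int \<bar>\<xi>\<bar> ^ (\<rho> * l) \<le> (1 + norm m) ^ (\<rho> * l)"
          by (intro power_mono) auto
        then have "?S * real q ^ l \<le> ?S * (1 + norm m) ^ (\<rho> * l)"
          using S0 by (simp add: rq flip: power_mult)
        moreover have "c \<le> 1" by (rule c_le) (simp add: A_def)
        ultimately show ?thesis using m(3) by linarith
      qed
      then have "K * (?S * real q ^ l) < K * 1" using K0 by (intro mult_strict_left_mono)
      then have "K * ?S < K / real q ^ l" using q2 by (simp add: field_simps)
      ultimately show ?thesis by linarith
    qed
    ultimately have "good l P q" using q2 by (simp only: good_def)
    then show ?thesis by blast
  qed
  then obtain P q where "\<forall>l. good l (P l) (q l)" by metis
  then show ?thesis
    unfolding approximable_def good_def using K0 by blast
qed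

text \<open>Rational vectors are never \<open>approximable\<close>, so the right-hand side just says
  that \<open>\<alpha>\<close> is not \<open>approximable\<close>.\<close>

lemma no_small_divisors_iff:
  assumes "coprime \<rho> \<mu>"
  shows "no_small_divisors s \<longleftrightarrow> rational_vec \<alpha> \<or> \<not> SDA \<mu> \<alpha>"
  using approximable_imp_small_divisors[OF assms] small_divisors_imp_approximable
    rational_not_approximable[of \<alpha> \<mu>]
  by (auto simp: SDA_iff)

end

theorem theorem3p3:
  fixes \<rho> \<mu> p :: nat and \<kappa> :: real
    and c :: "complex ^ 'n::{finite,linorder}"
    and \<alpha> \<beta> :: "real ^ 'n::{finite,linorder}"
    and s :: "'n::{finite,linorder} \<Rightarrow> int \<Rightarrow> complex"
  assumes "\<rho> > 0" and "\<mu> > 0" and "coprime \<rho> \<mu>" and "\<kappa> = real \<rho> / real \<mu>"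
    and "\<And>j. c $ j = Complex (\<alpha> $ j) (\<beta> $ j)"
    and "\<And>j \<xi>. \<xi> \<noteq> 0 \<Longrightarrow> s j \<xi> = c $ j * of_real (real_of_int \<bar>\<xi>\<bar> powr \<kappa>)"
    and "p < CARD('n)"
  shows "globally_solvable s p \<longleftrightarrow>
    \<beta> \<noteq> 0 \<or> rational_vec \<alpha> \<or> (\<not> rational_vec \<alpha> \<and> \<not> SDA \<mu> \<alpha>)"
proof -
  have "\<kappa> \<le> real \<rho>"
    using assms(1,2,4) by (simp add: divide_le_eq mult_le_cancel_left1)
  then have growth: "poly_growth (s j)" for j
    using poly_growth_power_symbol[OF assms(6)] by blast
  have "globally_solvable s p \<longleftrightarrow> no_small_divisors s"
    using no_small_divisors_imp_solvable[of s p, OF growth]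
      solvable_imp_no_small_divisors[of s p, OF growth assms(7)] by blast
  moreover have "no_small_divisors s" if \<beta>: "\<beta> \<noteq> 0"
  proof -
    obtain j where "\<beta> $ j \<noteq> 0" using \<beta> by (auto simp: vec_eq_iff)
    then show ?thesis
      using no_small_divisors_complex[of s j "c $ j" \<kappa>, OF assms(6)] by (simp add: assms(4,5))
  qed
  moreover have "no_small_divisors s \<longleftrightarrow> rational_vec \<alpha> \<or> \<not> SDA \<mu> \<alpha>" if \<beta>: "\<beta> = 0"
  proof -
    interpret real_power_symbol \<rho> \<mu> \<alpha> s
    proof
      fix j and \<xi> :: int assume "\<xi> \<noteq> 0"
      moreover have "c $ j = of_real (\<alpha> $ j)" by (simp add: assms(5) \<beta> complex_eq_iff)
      ultimately show "s j \<xi> = of_real (\<alpha> $ j * real_of_int \<bar>\<xi>\<bar> powr (real \<rho> / real \<mu>))"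
        by (simp add: assms(4,6))
    qed (use assms in auto)
    show ?thesis by (rule no_small_divisors_iff[OF assms(3)])
  qed
  ultimately show ?thesis by blast
qed

end
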